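(* Let $\Gamma$ be any group. Then the groups $\mathrm{Aut}_\infty(\Gamma^{*\infty})$, $\mathrm{Aut}_\infty(\Gamma^{\times\infty})$ and $\mathrm{Aut}_\infty(\Gamma^{\oplus\infty})$ are $\mathfrak{X}^{\mathrm{sep}}$-boundedly acyclic. In particular, $\mathrm{Aut}_\infty(F_\infty)=\bigcup_{n\in\mathbb{N}}\mathrm{Aut}(F_n)$ is $\mathfrak{X}^{\mathrm{sep}}$-boundedly acyclic.
   Context: **Groups.** Let $\Gamma^{*\infty}$, $\Gamma^{\times\infty}$, $\Gamma^{\oplus\infty}$ be respectively the free product, direct product and direct sum of copies of $\Gamma$ indexed by $\mathbb{N}$, and let $\Gamma^{*n}$, $\Gamma^{\times n}$ be the free product and the direct product of the first $n$ copies. $\mathrm{Aut}_\infty(\Gamma^{*\infty})\le\mathrm{Aut}(\Gamma^{*\infty})$ is the direct union over $n$ of the groups $\mathrm{Aut}(\Gamma^{*n})$, where an automorphism of $\Gamma^{*n}$ is extended by the identity on the remaining free factors. Similarly $\mathrm{Aut}_\infty(\Gamma^{\times\infty})\le\mathrm{Aut}(\Gamma^{\times\infty})$ and $\mathrm{Aut}_\infty(\Gamma^{\oplus\infty})\le\mathrm{Aut}(\Gamma^{\oplus\infty})$ are the direct unions over $n$ of the groups $\mathrm{Aut}(\Gamma^{\times n})$, extended by the identity on the remaining factors. For $\Gamma=\mathbb{Z}$, $F_\infty=\mathbb{Z}^{*\infty}$ is the free group of countably infinite rank and $F_n=\mathbb{Z}^{*n}$. **Bounded cohomology.** All groups are discrete.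 A Banach $\Gamma$-module is a real Banach space $E$ with an action of $\Gamma$ by linear isometries. $C^k_b(\Gamma;E)$ is the space of bounded functions $\Gamma^{k+1}\to E$, with the action $(\gamma\cdot f)(\gamma_0,\dots,\gamma_k)=\gamma f(\gamma^{-1}\gamma_0,\dots,\gamma^{-1}\gamma_k)$ and the simplicial coboundary; $H^\bullet_b(\Gamma;E)$ is the cohomology of the complex $C^\bullet_b(\Gamma;E)^\Gamma$ of invariants. $E$ is dual if it is isometrically $\Gamma$-isomorphic to the dual of some Banach $\Gamma$-module (with the contragredient action); separable means norm-separable. A group $\Gamma$ is $\mathfrak{X}^{\mathrm{sep}}$-boundedly acyclic if $H^n_b(\Gamma;E)=0$ for all $n\ge1$ and every separable dual Banach $\Gamma$-module $E$. *)

theory Defs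
  imports "HOL-Analysis.Analysis" "HOL-Algebra.Bij" "HOL-Algebra.Product_Groups"
begin

section \<open>Free products\<close>

text \<open>Elements of the free product are the reduced words: lists of pairs \<open>(i, g)\<close> with
  \<open>g\<close> a nontrivial element of the \<open>i\<close>-th factor, neighbouring letters coming from different factors.
  With this model \<open>free_product J G\<close> is literally a subgroup of \<open>free_product I G\<close> for \<open>J \<subseteq> I\<close>.\<close>

definition reduced_words :: "'i set \<Rightarrow> ('i \<Rightarrow> ('a, 'b) monoid_scheme) \<Rightarrow> ('i \<times> 'a) list set"
  where "reduced_words I G =
    {w \<in> lists (SIGMA i:I. carrier (G i) - {\<one>\<^bsub>G i\<^esub>}). distinct_adj (map fst w)}"

text \<open>Left multiplication of a reduced word by a single, possibly trivial, letter.\<close>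

fun letter_mult :: "('i \<Rightarrow> ('a, 'b) monoid_scheme) \<Rightarrow> 'i \<times> 'a \<Rightarrow> ('i \<times> 'a) list \<Rightarrow> ('i \<times> 'a) list"
  where
    "letter_mult G (i, g) [] = (if g = \<one>\<^bsub>G i\<^esub> then [] else [(i, g)])"
  | "letter_mult G (i, g) ((j, h) # w) =
      (if i = j then (if g \<otimes>\<^bsub>G i\<^esub> h = \<one>\<^bsub>G i\<^esub> then w else (i, g \<otimes>\<^bsub>G i\<^esub> h) # w)
       else if g = \<one>\<^bsub>G i\<^esub> then (j, h) # w else (i, g) # (j, h) # w)"

definition free_product :: "'i set \<Rightarrow> ('i \<Rightarrow> ('a, 'b) monoid_scheme) \<Rightarrow> ('i \<times> 'a) list monoid"
  where "free_product I G =
    \<lparr>carrier = reduced_words I G,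
     monoid.mult = (\<lambda>u v. foldr (letter_mult G) u v),
     one = []\<rparr>"

definition free_product_incl :: "('i \<Rightarrow> ('a, 'b) monoid_scheme) \<Rightarrow> 'i \<Rightarrow> 'a \<Rightarrow> ('i \<times> 'a) list"
  where "free_product_incl G i g = (if g = \<one>\<^bsub>G i\<^esub> then [] else [(i, g)])"

lemma reduced_words_Nil [simp]: "[] \<in> reduced_words I G"
  by (simp add: reduced_words_def)

lemma reduced_words_Cons:
  "(i, g) # w \<in> reduced_words I G \<longleftrightarrow>
     i \<in> I \<and> g \<in> carrier (G i) \<and> g \<noteq> \<one>\<^bsub>G i\<^esub> \<and> w \<in> reduced_words I G \<and> (w = [] \<or> i \<noteq> fst (hd w))"
  by (cases w) (auto simp: reduced_words_def)

context
  fixes I :: "'i set" and G :: "'i \<Rightarrow> ('a, 'b) monoid_scheme"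
  assumes grp: "\<And>i. i \<in> I \<Longrightarrow> group (G i)"
begin

lemma letter_mult_closed:
  assumes "i \<in> I" "g \<in> carrier (G i)" "w \<in> reduced_words I G"
  shows "letter_mult G (i, g) w \<in> reduced_words I G"
proof (cases w)
  case Nil
  then show ?thesis using assms by (auto simp: reduced_words_Cons)
next
  case (Cons x v)
  obtain j h where x: "x = (j, h)" by (cases x)
  interpret group "G i" using grp assms by simp
  show ?thesis
  proof (cases "j = i")
    case True
    show ?thesis using assms unfolding Cons x True
      by (auto simp: reduced_words_Cons)
  next
    case False
    then show ?thesis using assms unfolding Cons x
      by (auto simp: reduced_words_Cons)
  qed
qed

lemma letter_mult_one:
  assumes "i \<in> I" "w \<in> reduced_words I G"
  shows "letter_mult G (i, \<one>\<^bsub>G i\<^esub>) w = w"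
proof -
  interpret group "G i" using grp assms by simp
  show ?thesis using assms
    by (cases w) (auto simp: reduced_words_Cons)
qed

lemma letter_mult_mult:
  assumes "i \<in> I" "g \<in> carrier (G i)" "h \<in> carrier (G i)" "w \<in> reduced_words I G"
  shows "letter_mult G (i, g) (letter_mult G (i, h) w) = letter_mult G (i, g \<otimes>\<^bsub>G i\<^esub> h) w"
proof -
  interpret group "G i" using grp assms by simp
  show ?thesis
  proof (cases w)
    case Nil
    then show ?thesis using assms by auto
  next
    case (Cons x v)
    obtain j k where x: "x = (j, k)" by (cases x)
    show ?thesis
    proof (cases "j = i")
      case False
      then show ?thesis using assms unfolding Cons x by auto
    next
      case True
      note ji = this
      have k: "k \<in> carrier (G i)" "v \<in> reduced_words I G" "v = [] \<or> i \<noteq> fst (hd v)"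
        using assms unfolding Cons x ji by (auto simp: reduced_words_Cons)
      have a: "g \<otimes>\<^bsub>G i\<^esub> h \<otimes>\<^bsub>G i\<^esub> k = g \<otimes>\<^bsub>G i\<^esub> (h \<otimes>\<^bsub>G i\<^esub> k)"
        using assms k by (simp add: m_assoc)
      show ?thesis
      proof (cases "h \<otimes>\<^bsub>G i\<^esub> k = \<one>\<^bsub>G i\<^esub>")
        case True
        then show ?thesis using assms k a letter_mult_one[OF assms(1) k(2)] unfolding Cons x ji
          by (cases v) auto
      next
        case False
        then show ?thesis using assms k a unfolding Cons x ji by auto
      qed
    qed
  qed
qed

lemma foldr_letter_mult_closed:
  assumes "set u \<subseteq> (SIGMA i:I. carrier (G i))" "v \<in> reduced_words I G"
  shows "foldr (letter_mult G) u v \<in> reduced_words I G"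
  using assms by (induction u) (auto intro: letter_mult_closed)

lemma set_reduced_words:
  "u \<in> reduced_words I G \<Longrightarrow> set u \<subseteq> (SIGMA i:I. carrier (G i))"
  by (auto simp: reduced_words_def)

lemma foldr_letter_mult:
  assumes "i \<in> I" "g \<in> carrier (G i)" "u \<in> reduced_words I G" "v \<in> reduced_words I G"
  shows "foldr (letter_mult G) (letter_mult G (i, g) u) v
       = letter_mult G (i, g) (foldr (letter_mult G) u v)"
proof (cases u)
  case Nil
  then show ?thesis using assms by (auto simp: letter_mult_one)
next
  case (Cons x u')
  obtain j h where x: "x = (j, h)" by (cases x)
  have *: "j \<in> I" "h \<in> carrier (G j)" "foldr (letter_mult G) u' v \<in> reduced_words I G"
    using assms by (auto simp: Cons x reduced_words_Cons intro!: foldr_letter_mult_closed set_reduced_words)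
  interpret group "G i" using grp assms by simp
  have one: "letter_mult G (i, \<one>\<^bsub>G i\<^esub>) w = w" if "w \<in> reduced_words I G" for w
    using letter_mult_one that assms by blast
  show ?thesis
  proof (cases "i = j")
    case True
    then show ?thesis using assms * one[OF *(3)]
      by (auto simp: Cons x letter_mult_mult)
  next
    case False
    then show ?thesis using assms * one[OF letter_mult_closed[OF *]]
      by (auto simp: Cons x)
  qed
qed

theorem group_free_product: "group (free_product I G)"
proof (rule groupI)
  show "\<one>\<^bsub>free_product I G\<^esub> \<in> carrier (free_product I G)"
    by (simp add: free_product_def)
next
  fix u v assume "u \<in> carrier (free_product I G)" "v \<in> carrier (free_product I G)"
  then show "u \<otimes>\<^bsub>free_product I G\<^esub> v \<in> carrier (free_product I G)"
    by (simp add: free_product_def foldr_letter_mult_closed set_reduced_words)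
next
  fix u assume "u \<in> carrier (free_product I G)"
  then show "\<one>\<^bsub>free_product I G\<^esub> \<otimes>\<^bsub>free_product I G\<^esub> u = u"
    by (simp add: free_product_def)
next
  fix u v w
  assume uvw: "u \<in> carrier (free_product I G)" "v \<in> carrier (free_product I G)"
    "w \<in> carrier (free_product I G)"
  have "foldr (letter_mult G) (foldr (letter_mult G) u' v) w
      = foldr (letter_mult G) u' (foldr (letter_mult G) v w)"
    if "set u' \<subseteq> (SIGMA i:I. carrier (G i))" for u'
    using that
  proof (induction u')
    case (Cons x u')
    obtain j h where x: "x = (j, h)" by (cases x)
    have "foldr (letter_mult G) u' v \<in> reduced_words I G"
      using Cons uvw by (intro foldr_letter_mult_closed) (auto simp: free_product_def)
    then show ?case using Cons uvw by (auto simp: x foldr_letter_mult free_product_def)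
  qed simp
  then show "u \<otimes>\<^bsub>free_product I G\<^esub> v \<otimes>\<^bsub>free_product I G\<^esub> w
      = u \<otimes>\<^bsub>free_product I G\<^esub> (v \<otimes>\<^bsub>free_product I G\<^esub> w)"
    using uvw set_reduced_words by (simp add: free_product_def)
next
  fix u assume u: "u \<in> carrier (free_product I G)"
  define iv where "iv = (\<lambda>w. rev (map (\<lambda>(i, g). (i, inv\<^bsub>G i\<^esub> g)) w))"
  have main: "foldr (letter_mult G) (iv u) u = [] \<and> set (iv u) \<subseteq> (SIGMA i:I. carrier (G i))"
    if "u \<in> reduced_words I G" for u
    using that
  proof (induction u)
    case (Cons x u)
    obtain j h where x: "x = (j, h)" by (cases x)
    have jh: "j \<in> I" "h \<in> carrier (G j)" "u \<in> reduced_words I G"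
      using Cons by (auto simp: x reduced_words_Cons)
    interpret group "G j" using grp jh by simp
    show ?case using Cons jh by (auto simp: x iv_def)
  qed (simp add: iv_def)
  define v where "v = foldr (letter_mult G) (iv u) []"
  have v: "v \<in> reduced_words I G"
    unfolding v_def using main[of u] u by (intro foldr_letter_mult_closed) (auto simp: free_product_def)
  have "foldr (letter_mult G) (foldr (letter_mult G) z []) u = foldr (letter_mult G) z u"
    if "set z \<subseteq> (SIGMA i:I. carrier (G i))" for z
    using that
  proof (induction z)
    case (Cons x z)
    obtain j h where x: "x = (j, h)" by (cases x)
    have "foldr (letter_mult G) z [] \<in> reduced_words I G"
      using Cons by (intro foldr_letter_mult_closed) auto
    then show ?case using Cons u by (auto simp: x foldr_letter_mult free_product_def)
  qed simp
  then have "foldr (letter_mult G) v u = []"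
    using main[of u] u by (simp add: v_def free_product_def)
  then show "\<exists>v\<in>carrier (free_product I G). v \<otimes>\<^bsub>free_product I G\<^esub> u = \<one>\<^bsub>free_product I G\<^esub>"
    using v by (auto simp: free_product_def)
qed

end


section \<open>The groups of stable automorphisms\<close>

text \<open>The direct unions, as subgroups of the full automorphism groups. An automorphism of the first
  \<open>n\<close> factors is extended by the identity on the remaining factors: for the free product this
  prescribes the values on the two free factors \<open>\<Gamma>\<^bsup>*n\<^esup>\<close> and the rest, which determines the extension;
  for the direct product and the direct sum the extension is \<open>\<phi> \<times> id\<close> on
  \<open>\<Gamma>\<^bsup>n\<^esup> \<times> (\<Prod>i\<ge>n. \<Gamma>)\<close>, respectively \<open>\<Gamma>\<^bsup>n\<^esup> \<times> (\<Oplus>i\<ge>n. \<Gamma>)\<close>.\<close>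

definition Aut_inf_free_product :: "('a, 'b) monoid_scheme \<Rightarrow> ((nat \<times> 'a) list \<Rightarrow> (nat \<times> 'a) list) monoid"
  where "Aut_inf_free_product \<Gamma> =
    (AutoGroup (free_product UNIV (\<lambda>_::nat. \<Gamma>)))
      \<lparr>carrier := (\<Union>n. {\<psi> \<in> auto (free_product UNIV (\<lambda>_. \<Gamma>)).
         \<exists>\<phi> \<in> auto (free_product {..<n} (\<lambda>_. \<Gamma>)).
           (\<forall>w \<in> carrier (free_product {..<n} (\<lambda>_. \<Gamma>)). \<psi> w = \<phi> w) \<and>
           (\<forall>i\<ge>n. \<forall>g \<in> carrier \<Gamma>.
              \<psi> (free_product_incl (\<lambda>_. \<Gamma>) i g) = free_product_incl (\<lambda>_. \<Gamma>) i g)})\<rparr>"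

definition Aut_inf_direct_product :: "('a, 'b) monoid_scheme \<Rightarrow> ((nat \<Rightarrow> 'a) \<Rightarrow> (nat \<Rightarrow> 'a)) monoid"
  where "Aut_inf_direct_product \<Gamma> =
    (AutoGroup (product_group UNIV (\<lambda>_::nat. \<Gamma>)))
      \<lparr>carrier := (\<Union>n. {\<psi> \<in> auto (product_group UNIV (\<lambda>_. \<Gamma>)).
         \<exists>\<phi> \<in> auto (product_group {..<n} (\<lambda>_. \<Gamma>)).
           \<forall>x \<in> carrier (product_group UNIV (\<lambda>_. \<Gamma>)).
             \<psi> x = (\<lambda>i. if i < n then \<phi> (restrict x {..<n}) i else x i)})\<rparr>"

definition Aut_inf_direct_sum :: "('a, 'b) monoid_scheme \<Rightarrow> ((nat \<Rightarrow> 'a) \<Rightarrow> (nat \<Rightarrow> 'a)) monoid"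
  where "Aut_inf_direct_sum \<Gamma> =
    (AutoGroup (sum_group UNIV (\<lambda>_::nat. \<Gamma>)))
      \<lparr>carrier := (\<Union>n. {\<psi> \<in> auto (sum_group UNIV (\<lambda>_. \<Gamma>)).
         \<exists>\<phi> \<in> auto (product_group {..<n} (\<lambda>_. \<Gamma>)).
           \<forall>x \<in> carrier (sum_group UNIV (\<lambda>_. \<Gamma>)).
             \<psi> x = (\<lambda>i. if i < n then \<phi> (restrict x {..<n}) i else x i)})\<rparr>"


section \<open>Banach modules\<close>

definition banach_module :: "('g, 'b) monoid_scheme \<Rightarrow> ('g \<Rightarrow> 'e::banach \<Rightarrow> 'e) \<Rightarrow> bool"
  where "banach_module G \<pi> \<longleftrightarrow>
    (\<forall>g \<in> carrier G. linear (\<pi> g) \<and> (\<forall>x. norm (\<pi> g x) = norm x)) \<and>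
    (\<forall>x. \<pi> \<one>\<^bsub>G\<^esub> x = x) \<and>
    (\<forall>g \<in> carrier G. \<forall>h \<in> carrier G. \<forall>x. \<pi> (g \<otimes>\<^bsub>G\<^esub> h) x = \<pi> g (\<pi> h x))"

definition contragredient ::
    "('g, 'b) monoid_scheme \<Rightarrow> ('g \<Rightarrow> 'f::banach \<Rightarrow> 'f) \<Rightarrow> 'g \<Rightarrow> ('f \<Rightarrow>\<^sub>L real) \<Rightarrow> ('f \<Rightarrow>\<^sub>L real)"
  where "contragredient G \<rho> g l = l o\<^sub>L Blinfun (\<rho> (inv\<^bsub>G\<^esub> g))"

text \<open>The underlying Banach space \<open>'f\<close> of the predual is a type parameter, since one cannot
  quantify over it inside a formula.\<close>

definition dual_banach_module ::
    "'f::banach itself \<Rightarrow> ('g, 'b) monoid_scheme \<Rightarrow> ('g \<Rightarrow> 'e::banach \<Rightarrow> 'e) \<Rightarrow> bool"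
  where "dual_banach_module _ G \<pi> \<longleftrightarrow>
    banach_module G \<pi> \<and>
    (\<exists>(\<rho> :: 'g \<Rightarrow> 'f \<Rightarrow> 'f) (T :: 'e \<Rightarrow> 'f \<Rightarrow>\<^sub>L real).
       banach_module G \<rho> \<and> linear T \<and> surj T \<and> (\<forall>x. norm (T x) = norm x) \<and>
       (\<forall>g \<in> carrier G. \<forall>x. T (\<pi> g x) = contragredient G \<rho> g (T x)))"


section \<open>Bounded cohomology\<close>

text \<open>Elements \<open>(\<gamma>\<^sub>0, \<dots>, \<gamma>\<^sub>k)\<close> of \<open>\<Gamma>\<^bsup>k+1\<^esup>\<close> are lists of length \<open>k + 1\<close>; cochains are total
  functions that vanish outside \<open>\<Gamma>\<^bsup>k+1\<^esup>\<close>.\<close>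

definition tuples :: "('g, 'b) monoid_scheme \<Rightarrow> nat \<Rightarrow> 'g list set"
  where "tuples G k = {xs \<in> lists (carrier G). length xs = Suc k}"

definition bounded_cochains :: "('g, 'b) monoid_scheme \<Rightarrow> nat \<Rightarrow> ('g list \<Rightarrow> 'e::banach) set"
  where "bounded_cochains G k = {f. bounded (f ` tuples G k) \<and> (\<forall>xs. xs \<notin> tuples G k \<longrightarrow> f xs = 0)}"

definition cochain_action ::
    "('g, 'b) monoid_scheme \<Rightarrow> ('g \<Rightarrow> 'e::banach \<Rightarrow> 'e) \<Rightarrow> 'g \<Rightarrow> ('g list \<Rightarrow> 'e) \<Rightarrow> 'g list \<Rightarrow> 'e"
  where "cochain_action G \<pi> g f xs = \<pi> g (f (map (\<lambda>x. inv\<^bsub>G\<^esub> g \<otimes>\<^bsub>G\<^esub> x) xs))"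

definition invariant_cochains ::
    "('g, 'b) monoid_scheme \<Rightarrow> ('g \<Rightarrow> 'e::banach \<Rightarrow> 'e) \<Rightarrow> nat \<Rightarrow> ('g list \<Rightarrow> 'e) set"
  where "invariant_cochains G \<pi> k =
    {f \<in> bounded_cochains G k. \<forall>g \<in> carrier G. \<forall>xs \<in> tuples G k. cochain_action G \<pi> g f xs = f xs}"

definition coboundary ::
    "('g, 'b) monoid_scheme \<Rightarrow> nat \<Rightarrow> ('g list \<Rightarrow> 'e::banach) \<Rightarrow> 'g list \<Rightarrow> 'e"
  where "coboundary G k f xs =
    (if xs \<in> tuples G (Suc k)
     then \<Sum>i\<le>Suc k. (- 1) ^ i *\<^sub>R f (take i xs @ drop (Suc i) xs) else 0)"

definition bounded_cocycles ::
    "('g, 'b) monoid_scheme \<Rightarrow> ('g \<Rightarrow> 'e::banach \<Rightarrow> 'e) \<Rightarrow> nat \<Rightarrow> ('g list \<Rightarrow> 'e) set"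
  where "bounded_cocycles G \<pi> k = {f \<in> invariant_cochains G \<pi> k. \<forall>xs. coboundary G k f xs = 0}"

definition bounded_coboundaries ::
    "('g, 'b) monoid_scheme \<Rightarrow> ('g \<Rightarrow> 'e::banach \<Rightarrow> 'e) \<Rightarrow> nat \<Rightarrow> ('g list \<Rightarrow> 'e) set"
  where "bounded_coboundaries G \<pi> k =
    (case k of 0 \<Rightarrow> {\<lambda>_. 0} | Suc j \<Rightarrow> coboundary G j ` invariant_cochains G \<pi> j)"

definition cocycle_group ::
    "('g, 'b) monoid_scheme \<Rightarrow> ('g \<Rightarrow> 'e::banach \<Rightarrow> 'e) \<Rightarrow> nat \<Rightarrow> ('g list \<Rightarrow> 'e) monoid"
  where "cocycle_group G \<pi> k =
    \<lparr>carrier = bounded_cocycles G \<pi> k, monoid.mult = (\<lambda>f h xs. f xs + h xs), one = (\<lambda>_. 0)\<rparr>"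

definition bounded_cohomology ::
    "('g, 'b) monoid_scheme \<Rightarrow> ('g \<Rightarrow> 'e::banach \<Rightarrow> 'e) \<Rightarrow> nat \<Rightarrow> ('g list \<Rightarrow> 'e) set monoid"
  where "bounded_cohomology G \<pi> k = cocycle_group G \<pi> k Mod bounded_coboundaries G \<pi> k"

text \<open>Bounded acyclicity with respect to separable dual coefficient modules on the Banach space
  \<open>'e\<close> with predual \<open>'f\<close>. A theorem in which \<open>'e\<close> and \<open>'f\<close> are arbitrary type variables asserts
  this for all separable dual Banach modules.\<close>

definition Xsep_boundedly_acyclic ::
    "'e::banach itself \<Rightarrow> 'f::banach itself \<Rightarrow> ('g, 'b) monoid_scheme \<Rightarrow> bool"
  where "Xsep_boundedly_acyclic _ _ G \<longleftrightarrow>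
    (\<forall>n\<ge>1. \<forall>\<pi> :: 'g \<Rightarrow> 'e \<Rightarrow> 'e.
       dual_banach_module TYPE('f) G \<pi> \<and> separable_space (euclidean :: 'e topology) \<longrightarrow>
       trivial_group (bounded_cohomology G \<pi> n))"

end

theory Submission
  imports Defs
begin

text \<open>
  Every finite set \<open>S\<close> of stable automorphisms lives on the first \<open>n\<close> factors. Permuting blocks of \<open>n\<close>
  factors, the finitary symmetric group of \<open>\<nat>\<close> acts, and it moves \<open>S\<close> to commuting conjugates
  \<open>S\<^sub>0 = S, S\<^sub>1, S\<^sub>2, \<dots>\<close>.

  Given a bounded cocycle \<open>c\<close> of degree \<open>k \<ge> 1\<close>, average \<open>c (g\<^sub>0 x\<^sub>0, \<dots>, g\<^sub>k x\<^sub>k)\<close> over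
  \<open>x\<^sub>i = s\<^sub>i\<^sub>1 \<cdots> s\<^sub>i\<^sub>N \<sigma>\<close> with independent uniform \<open>s\<^sub>i\<^sub>j \<in> S\<^sub>j\<close> and a common uniform permutation
  \<open>\<sigma>\<close>. The result differs from \<open>c\<close> by the coboundary of a cochain of norm at most \<open>k\<close> times that of
  \<open>c\<close>. For \<open>g\<^sub>i \<in> S\<close> it is the conditional expectation, given the letters in block 0, of a bounded
  function on \<open>(S\<^bsup>k+1\<^esup>)\<^bsup>N\<^esup>\<close> that is equivariant under permutations of the blocks.
  As \<open>N \<rightarrow> \<infinity>\<close> such a conditional expectation becomes independent of the
  condition when the values lie in a separable dual space: weak-* fragmentability makes block 0
  almost independent of the function after multiplication with some cylinder density, and by
  equivariance and the law of large numbers these densities average out. So weak-* limits, first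
  over \<open>N\<close> and then over \<open>S\<close>, show that \<open>c\<close> is cohomologous to a constant cocycle, and constant
  cocycles of positive degree are coboundaries.
\<close>

section \<open>Averaged prism operators\<close>

text \<open>The obstacle is that independence of block 0 is easy in the weak-* sense but useless
  there. For a fixed predual vector, near-orthogonality of cylinder densities shows that all but
  finitely many blocks are almost independent of the function; a permutation bringing such a block
  to position 0 moves the predual vector as well. Norms, in contrast, survive because the module
  action is isometric. So smallness is needed in norm, and fragmentability is what converts weak-*
  smallness into norm smallness; this is the only use of separability. The permutation is common to
  all arguments because equivariance under permuting blocks is obtained by substituting in one
  average. The letters are independent between arguments so that a block takes arbitrary values in
  the (k+1)-tuples of elements of S, and every tuple of arguments from S can appear as the value of
  block 0. The primitives are bounded by \<open>k * C\<close> whatever N and S are. Hence both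
  weak-* limits exist, and they commute with the finite coboundary sums and with the action, which
  has an adjoint on the predual.\<close>

fun list_coboundary :: "('x list \<Rightarrow> 'e::real_vector) \<Rightarrow> 'x list \<Rightarrow> 'e" where
  "list_coboundary c [] = 0"
| "list_coboundary c (x # xs) = c xs - list_coboundary (\<lambda>l. c (x # l)) xs"

text \<open>The classical prism operator for the two maps \<open>fst\<close> and \<open>snd\<close>:
  an alternating sum over lists that run through first coordinates up to some position, repeat that
  position and continue with second coordinates.\<close>

fun prism :: "('x list \<Rightarrow> 'e::real_vector) \<Rightarrow> ('x \<times> 'x) list \<Rightarrow> 'e" where
  "prism c [] = 0"
| "prism c (z # zs) = c (fst z # snd z # map snd zs) - prism (\<lambda>l. c (fst z # l)) zs"

text \<open>Links the recursive form to the face sum in \<open>coboundary\<close>. With the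
  recursion, identities between faces become list inductions with an arbitrary cochain, the degree
  being carried by the list length.\<close>

lemma list_coboundary_eq_sum:
  "list_coboundary f xs = (\<Sum>i<length xs. (- 1) ^ i *\<^sub>R f (take i xs @ drop (Suc i) xs))"
proof (induction xs arbitrary: f)
  case (Cons x xs)
  then show ?case
    by (simp add: sum.lessThan_Suc_shift sum_negf del: sum.lessThan_Suc)
qed simp

lemma list_coboundary_diff:
  "list_coboundary (\<lambda>l. c l - d l) xs = list_coboundary c xs - list_coboundary d xs"
  by (induction xs arbitrary: c d) auto

lemma list_coboundary_scaleR: "list_coboundary (\<lambda>l. a *\<^sub>R c l) xs = a *\<^sub>R list_coboundary c xs"
  by (induction xs arbitrary: c) (auto simp: algebra_simps)

lemma list_coboundary_sum:
  "list_coboundary (\<lambda>l. \<Sum>i\<in>I. c i l) xs = (\<Sum>i\<in>I. list_coboundary (c i) xs)"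
  by (induction xs arbitrary: c) (auto simp: sum_subtractf)

lemma list_coboundary_cong:
  assumes "\<And>ys. set ys \<subseteq> set xs \<Longrightarrow> Suc (length ys) = length xs \<Longrightarrow> c ys = d ys"
  shows "list_coboundary c xs = list_coboundary d xs"
  using assms
proof (induction xs arbitrary: c d)
  case (Cons x xs)
  have "list_coboundary (\<lambda>l. c (x # l)) xs = list_coboundary (\<lambda>l. d (x # l)) xs"
    by (intro Cons.IH Cons.prems) auto
  then show ?case using Cons.prems[of xs] by auto
qed simp

lemma list_coboundary_map: "list_coboundary c (map h xs) = list_coboundary (\<lambda>l. c (map h l)) xs"
  by (induction xs arbitrary: c) auto

lemma list_coboundary_linear:
  assumes "linear A"
  shows "A (list_coboundary c xs) = list_coboundary (\<lambda>l. A (c l)) xs"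
  by (induction xs arbitrary: c) (auto simp: linear_diff[OF assms] linear_0[OF assms])

lemma list_coboundary_list_coboundary [simp]: "list_coboundary (list_coboundary c) xs = 0"
  by (induction xs arbitrary: c) (auto simp: list_coboundary_diff)

text \<open>The parity decides the fate of constants in \<open>cocycle_is_coboundary\<close>: in one
  parity a constant is a coboundary, in the other the cocycle identity forces it to be zero.\<close>

lemma list_coboundary_const:
  "list_coboundary (\<lambda>_. v) xs = (if odd (length xs) then v else 0)"
  by (induction xs) auto

lemma prism_diff: "prism (\<lambda>l. c l - d l) zs = prism c zs - prism d zs"
  by (induction zs arbitrary: c d) auto

text \<open>The induction hypothesis for \<open>c\<close> prefixed with \<open>fst z\<close>
  accounts for the change in the tail, the head terms for the step from \<open>fst z\<close> to
  \<open>snd z\<close>; all else cancels. The empty list is separate because both summands vanish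
  there.\<close>

lemma prism_homotopy:
  "prism (list_coboundary c) zs + list_coboundary (prism c) zs
   = (if zs = [] then 0 else c (map snd zs) - c (map fst zs))"
proof (induction zs arbitrary: c)
  case (Cons z zs)
  show ?case
    using Cons.IH[of "\<lambda>l. c (fst z # l)"]
    by (cases "zs = []") (auto simp: prism_diff list_coboundary_diff list_coboundary_map algebra_simps)
qed simp

lemma prism_zero:
  assumes "\<And>xs. set xs \<subseteq> fst ` set zs \<union> snd ` set zs \<Longrightarrow> length xs = Suc (length zs) \<Longrightarrow> c xs = 0"
  shows "prism c zs = 0"
  using assms
proof (induction zs arbitrary: c)
  case (Cons z zs)
  have "prism (\<lambda>l. c (fst z # l)) zs = 0"
    by (intro Cons.IH Cons.prems) auto
  moreover have "c (fst z # snd z # map snd zs) = 0"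
    by (intro Cons.prems) auto
  ultimately show ?case by simp
qed simp

lemma prism_cong:
  assumes "\<And>xs. set xs \<subseteq> fst ` set zs \<union> snd ` set zs \<Longrightarrow> length xs = Suc (length zs) \<Longrightarrow> c xs = d xs"
  shows "prism c zs = prism d zs"
  using prism_zero[of zs "\<lambda>l. c l - d l"] assms by (simp add: prism_diff)

lemma prism_map:
  "prism c (map (map_prod h h) zs) = prism (\<lambda>l. c (map h l)) zs"
proof (induction zs arbitrary: c)
  case (Cons z zs)
  then show ?case by (cases z) (auto simp: comp_def)
qed simp

lemma prism_linear:
  assumes "linear A"
  shows "A (prism c zs) = prism (\<lambda>l. A (c l)) zs"
  by (induction zs arbitrary: c) (auto simp: linear_diff[OF assms] linear_0[OF assms])

text \<open>One value of \<open>c\<close> occurs per pair; this is the origin of the factor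
  \<open>k\<close> in the norms of the primitives.\<close>

lemma norm_prism_le:
  fixes c :: "'x list \<Rightarrow> 'e::real_normed_vector"
  assumes "\<And>xs. set xs \<subseteq> fst ` set zs \<union> snd ` set zs \<Longrightarrow> length xs = Suc (length zs) \<Longrightarrow> norm (c xs) \<le> C"
  shows "norm (prism c zs) \<le> real (length zs) * C"
  using assms
proof (induction zs arbitrary: c)
  case (Cons z zs)
  have "norm (prism (\<lambda>l. c (fst z # l)) zs) \<le> real (length zs) * C"
    by (intro Cons.IH Cons.prems) auto
  moreover have "norm (c (fst z # snd z # map snd zs)) \<le> C"
    by (intro Cons.prems) auto
  ultimately show ?case
    using norm_triangle_ineq4[of "c (fst z # snd z # map snd zs)" "prism (\<lambda>l. c (fst z # l)) zs"]
    by (simp add: algebra_simps)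
qed simp

section \<open>Averages over finite sets and independent randomisation of arguments\<close>

definition avg :: "'i set \<Rightarrow> ('i \<Rightarrow> 'e::real_vector) \<Rightarrow> 'e"
  where "avg A f = (1 / real (card A)) *\<^sub>R sum f A"

lemma avg_cong: "(\<And>i. i \<in> A \<Longrightarrow> f i = g i) \<Longrightarrow> avg A f = avg A g"
  by (simp add: avg_def)

lemma avg_diff: "avg A (\<lambda>i. f i - g i) = avg A f - avg A g"
  by (simp add: avg_def sum_subtractf algebra_simps)

lemma avg_add: "avg A (\<lambda>i. f i + g i) = avg A f + avg A g"
  by (simp add: avg_def sum.distrib algebra_simps)

lemma avg_scaleR: "avg A (\<lambda>i. a *\<^sub>R f i) = a *\<^sub>R avg A f"
  by (simp add: avg_def scaleR_sum_right[symmetric])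

lemma avg_sum: "avg A (\<lambda>i. \<Sum>j\<in>J. f i j) = (\<Sum>j\<in>J. avg A (\<lambda>i. f i j))"
  unfolding avg_def by (subst sum.swap) (simp add: scaleR_sum_right)

lemma avg_const: "finite A \<Longrightarrow> A \<noteq> {} \<Longrightarrow> avg A (\<lambda>_. v) = v"
  by (simp add: avg_def sum_constant_scaleR)

lemma avg_linear: "linear T \<Longrightarrow> T (avg A f) = avg A (\<lambda>i. T (f i))"
  by (simp add: avg_def linear_scale linear_sum)

lemma avg_bij_betw: "bij_betw h A B \<Longrightarrow> avg B f = avg A (\<lambda>i. f (h i))"
  unfolding avg_def by (simp add: sum.reindex_bij_betw bij_betw_same_card)

lemma avg_mono:
  fixes f g :: "'i \<Rightarrow> real"
  shows "(\<And>i. i \<in> A \<Longrightarrow> f i \<le> g i) \<Longrightarrow> avg A f \<le> avg A g"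
  unfolding avg_def by (auto intro!: mult_left_mono divide_right_mono sum_mono)

lemma norm_avg_le_avg:
  fixes f :: "'i \<Rightarrow> 'e::real_normed_vector"
  shows "norm (avg A f) \<le> avg A (\<lambda>i. norm (f i))"
  unfolding avg_def by (auto intro!: divide_right_mono norm_sum)

lemma norm_avg_le:
  fixes f :: "'i \<Rightarrow> 'e::real_normed_vector"
  assumes "\<And>i. i \<in> A \<Longrightarrow> norm (f i) \<le> C" "finite A" "A \<noteq> {}"
  shows "norm (avg A f) \<le> C"
proof -
  have "avg A (\<lambda>i. norm (f i)) \<le> avg A (\<lambda>_. C)"
    using assms(1) by (rule avg_mono)
  then show ?thesis using norm_avg_le_avg[of A f] avg_const[OF assms(2,3), of C] by simp
qed

lemma avg_Times: "avg (A \<times> B) (\<lambda>(a, b). f a b) = avg A (\<lambda>a. avg B (f a))"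
  unfolding avg_def
  by (simp add: sum.cartesian_product[symmetric] card_cartesian_product scaleR_sum_right[symmetric])

definition words_of_length :: "'w set \<Rightarrow> nat \<Rightarrow> 'w list set"
  where "words_of_length W n = {ws. set ws \<subseteq> W \<and> length ws = n}"

lemma finite_words_of_length [simp]: "finite W \<Longrightarrow> finite (words_of_length W n)"
  by (simp add: words_of_length_def finite_lists_length_eq)

lemma words_of_length_nonempty [simp]: "W \<noteq> {} \<Longrightarrow> words_of_length W n \<noteq> {}"
proof -
  assume "W \<noteq> {}"
  then obtain w where "w \<in> W" by blast
  then have "replicate n w \<in> words_of_length W n" by (auto simp: words_of_length_def)
  then show ?thesis by blast
qed

lemma words_of_length_0: "words_of_length W 0 = {[]}"
  by (auto simp: words_of_length_def)

lemma avg_words_Suc: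
  "avg (words_of_length W (Suc n)) f = avg W (\<lambda>w. avg (words_of_length W n) (\<lambda>ws. f (w # ws)))"
proof -
  have "bij_betw (\<lambda>(w, ws). w # ws) (W \<times> words_of_length W n) (words_of_length W (Suc n))"
    by (auto simp: bij_betw_def inj_on_def words_of_length_def image_def length_Suc_conv)
  from avg_bij_betw[OF this, of f] show ?thesis
    by (simp add: avg_Times[symmetric] case_prod_unfold)
qed

text \<open>The extension of a cochain from points to measures: each argument is randomised independently.\<close>

definition smear :: "'w set \<Rightarrow> ('g \<Rightarrow> 'w \<Rightarrow> 'z) \<Rightarrow> ('z list \<Rightarrow> 'e::real_vector) \<Rightarrow> 'g list \<Rightarrow> 'e"
  where "smear W z c gs = avg (words_of_length W (length gs)) (\<lambda>ws. c (map2 z gs ws))"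

lemma smear_Nil [simp]: "smear W z c [] = c []"
  by (simp add: smear_def words_of_length_0 avg_def)

lemma smear_Cons: "smear W z c (g # gs) = avg W (\<lambda>w. smear W z (\<lambda>l. c (z g w # l)) gs)"
  by (simp add: smear_def avg_words_Suc)

lemma smear_diff: "smear W z (\<lambda>l. c l - d l) gs = smear W z c gs - smear W z d gs"
  by (simp add: smear_def avg_diff)

lemma list_coboundary_avg:
  "list_coboundary (\<lambda>l. avg A (\<lambda>i. c i l)) xs = avg A (\<lambda>i. list_coboundary (c i) xs)"
  unfolding avg_def by (simp add: list_coboundary_scaleR list_coboundary_sum)

text \<open>Deleting an argument also deletes its random letter, and averaging over a letter that no
  longer occurs changes nothing. This uses that the letters of different arguments are
  independent.\<close>

lemma list_coboundary_smear:
  assumes "finite W" "W \<noteq> {}"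
  shows "list_coboundary (smear W z c) gs = smear W z (list_coboundary c) gs"
proof (induction gs arbitrary: c)
  case (Cons g gs)
  have "list_coboundary (smear W z c) (g # gs)
      = smear W z c gs - avg W (\<lambda>w. list_coboundary (smear W z (\<lambda>l. c (z g w # l))) gs)"
    by (simp add: smear_Cons list_coboundary_avg)
  also have "\<dots> = avg W (\<lambda>w. smear W z c gs - smear W z (list_coboundary (\<lambda>l. c (z g w # l))) gs)"
    by (simp add: Cons.IH avg_diff avg_const assms)
  finally show ?case by (simp add: smear_Cons smear_diff)
qed simp

section \<open>Weak-* limits in dual spaces\<close>

definition ultrafilter :: "'i filter \<Rightarrow> bool"
  where "ultrafilter U \<longleftrightarrow> U \<noteq> bot \<and> (\<forall>P. eventually P U \<or> eventually (\<lambda>x. \<not> P x) U)"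

lemma ultrafilter_exists:
  assumes "F \<noteq> (bot :: 'i filter)"
  shows "\<exists>U\<le>F. ultrafilter U"
proof -
  define A where "A = {G. G \<le> F \<and> G \<noteq> (bot :: 'i filter)}"
  \<comment> \<open>Finer filters are smaller in the order on filters, so Zorn's lemma is applied to
    the reversed order and a chain is bounded by its infimum.\<close>
  define R where "R = (\<lambda>G H :: 'i filter. H \<le> G)"
  have "\<exists>m\<in>A. \<forall>a\<in>A. R m a \<longrightarrow> a = m"
  proof (rule predicate_Zorn)
    show "partial_order_on A (relation_of R A)"
      by (rule partial_order_on_relation_ofI) (auto simp: R_def)
  next
    fix C assume C: "C \<in> Chains (relation_of R A)"
    then have CA: "C \<subseteq> A" and ch: "\<And>G H. G \<in> C \<Longrightarrow> H \<in> C \<Longrightarrow> G \<le> H \<or> H \<le> G"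
      by (auto simp: Chains_def relation_of_def R_def)
    show "\<exists>u\<in>A. \<forall>a\<in>C. R a u"
    proof (cases "C = {}")
      case True
      then show ?thesis using assms by (auto simp: A_def)
    next
      case False
      have "eventually P (Inf C) \<longleftrightarrow> (\<exists>b\<in>C. eventually P b)" for P
        by (rule eventually_Inf_base[OF False]) (use ch in \<open>auto simp: inf_absorb1 inf_absorb2\<close>)
      then have "Inf C \<noteq> bot"
        using CA by (auto simp: A_def trivial_limit_def)
      moreover have "Inf C \<le> F"
      proof -
        obtain c where "c \<in> C" using False by blast
        then have "Inf C \<le> c" "c \<le> F" using CA by (auto simp: A_def intro: Inf_lower)
        then show ?thesis by (rule order_trans)
      qed
      ultimately show ?thesis by (intro bexI[of _ "Inf C"]) (auto simp: A_def R_def intro: Inf_lower)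
    qed
  qed
  then obtain m where m: "m \<le> F" "m \<noteq> bot" and max: "\<And>G. G \<le> m \<Longrightarrow> G \<noteq> bot \<Longrightarrow> G = m"
    by (auto simp: A_def R_def)
  have "eventually P m \<or> eventually (\<lambda>x. \<not> P x) m" for P
  proof (rule disjCI)
    assume "\<not> eventually (\<lambda>x. \<not> P x) m"
    then have "inf m (principal {x. P x}) \<noteq> bot"
      by (auto simp: trivial_limit_def eventually_inf_principal)
    then have "inf m (principal {x. P x}) = m" by (intro max) auto
    then show "eventually P m"
      using eventually_inf_principal[of P m "{x. P x}"] by simp
  qed
  with m have "ultrafilter m" unfolding ultrafilter_def by blast
  with m show ?thesis by blast
qed

text \<open>Compactness of the interval gives a cluster point, and for an ultrafilter a cluster
  point is a limit: a neighbourhood that is not eventually hit is eventually avoided.\<close>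

lemma ultrafilter_bounded_converges:
  fixes f :: "'i \<Rightarrow> real"
  assumes U: "ultrafilter U" and B: "\<And>i. \<bar>f i\<bar> \<le> B"
  shows "\<exists>l. (f \<longlongrightarrow> l) U"
proof -
  have "f i \<in> {-B..B}" for i
    using B[of i] by (simp add: abs_le_iff minus_le_iff[of "f i"])
  then have "eventually (\<lambda>x. x \<in> {-B..B}) (filtermap f U)"
    by (simp add: eventually_filtermap del: atLeastAtMost_iff)
  moreover have "filtermap f U \<noteq> bot"
    using U by (simp add: ultrafilter_def filtermap_bot_iff)
  ultimately obtain l where l: "inf (nhds l) (filtermap f U) \<noteq> bot"
    using compact_Icc[of "-B" B, unfolded compact_filter, rule_format, of "filtermap f U"] by blast
  have "eventually (\<lambda>i. f i \<in> S) U" if "open S" "l \<in> S" for S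
  proof (rule ccontr)
    assume "\<not> eventually (\<lambda>i. f i \<in> S) U"
    then have "eventually (\<lambda>i. f i \<notin> S) U" using U by (auto simp: ultrafilter_def)
    then have "eventually (\<lambda>x. x \<notin> S) (filtermap f U)" by (simp add: eventually_filtermap)
    moreover have "eventually (\<lambda>x. x \<in> S) (nhds l)" using that by (auto simp: eventually_nhds)
    ultimately have "eventually (\<lambda>x. False) (inf (nhds l) (filtermap f U))"
      unfolding eventually_inf by blast
    then show False using l by (simp add: trivial_limit_def)
  qed
  then show ?thesis by (auto intro: topological_tendstoI)
qed

lemma ultrafilter_Lim:
  fixes f :: "'i \<Rightarrow> real"
  assumes "ultrafilter U" "\<And>i. \<bar>f i\<bar> \<le> B"
  shows "(f \<longlongrightarrow> Lim U f) U"
  using ultrafilter_bounded_converges[OF assms] assms(1) tendsto_Lim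
  by (fastforce simp: ultrafilter_def)

section \<open>Dual spaces seen through the pairing with the predual\<close>

locale dual_space =
  fixes T :: "'e::banach \<Rightarrow> 'f::banach \<Rightarrow>\<^sub>L real"
  assumes linear_T: "linear T" and surj_T: "surj T" and norm_T: "\<And>x. norm (T x) = norm x"
begin

definition pair :: "'e \<Rightarrow> 'f \<Rightarrow> real" where "pair x v = blinfun_apply (T x) v"

lemma linear_pair_left: "linear (\<lambda>x. pair x v)"
  unfolding pair_def
  by (intro linearI) (auto simp: linear_add[OF linear_T] linear_scale[OF linear_T] blinfun.add_left
      blinfun.scaleR_left)

lemma pair_diff_left: "pair (x - y) v = pair x v - pair y v"
  using linear_diff[OF linear_pair_left] .

lemma abs_pair_le: "\<bar>pair x v\<bar> \<le> norm x * norm v"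
  unfolding pair_def norm_T[symmetric] real_norm_def[symmetric] by (rule norm_blinfun)

lemma norm_le_pair: "0 \<le> R \<Longrightarrow> (\<And>v. \<bar>pair x v\<bar> \<le> R * norm v) \<Longrightarrow> norm x \<le> R"
  unfolding pair_def norm_T[symmetric] real_norm_def[symmetric] by (rule norm_blinfun_bound)

lemma pair_eqI: "(\<And>v. pair x v = pair y v) \<Longrightarrow> x = y"
  using norm_le_pair[of 0 "x - y"] by (simp add: pair_diff_left)

text \<open>Banach-Alaoglu along an ultrafilter: the pointwise limits of the pairings form a bounded
  functional, and \<open>surj_T\<close> represents it by a vector.\<close>

lemma weak_star_limit:
  assumes U: "ultrafilter U" and x: "\<And>i. norm (x i) \<le> R"
  shows "\<exists>e. \<forall>v. ((\<lambda>i. pair (x i) v) \<longlongrightarrow> pair e v) U"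
proof -
  define L where "L v = Lim U (\<lambda>i. pair (x i) v)" for v
  have U0: "U \<noteq> bot" using U by (simp add: ultrafilter_def)
  have b: "\<bar>pair (x i) v\<bar> \<le> R * norm v" for i v
    using order_trans[OF abs_pair_le mult_right_mono[OF x norm_ge_zero]] .
  have L: "((\<lambda>i. pair (x i) v) \<longlongrightarrow> L v) U" for v
    unfolding L_def using b by (rule ultrafilter_Lim[OF U])
  have "bounded_linear L"
  proof (rule bounded_linear_intro)
    fix v w
    have "((\<lambda>i. pair (x i) (v + w)) \<longlongrightarrow> L v + L w) U"
      using tendsto_add[OF L L] by (simp add: pair_def blinfun.add_right)
    then show "L (v + w) = L v + L w" using tendsto_unique[OF U0 L] by blast
  next
    fix r v
    have "((\<lambda>i. pair (x i) (r *\<^sub>R v)) \<longlongrightarrow> r *\<^sub>R L v) U"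
      using tendsto_scaleR[OF tendsto_const L] by (simp add: pair_def blinfun.scaleR_right)
    then show "L (r *\<^sub>R v) = r *\<^sub>R L v" using tendsto_unique[OF U0 L] by blast
  next
    fix v
    show "norm (L v) \<le> norm v * R"
      using tendsto_upperbound[OF tendsto_norm[OF L] _ U0, of v "norm v * R"] b
      by (auto simp: mult.commute intro!: always_eventually)
  qed
  then obtain e where "T e = Blinfun L" "\<And>v. blinfun_apply (Blinfun L) v = L v"
    using surj_T by (metis bounded_linear_Blinfun_apply surjD)
  then have "pair e v = L v" for v by (simp add: pair_def)
  then show ?thesis using L by (intro exI[of _ e]) simp
qed

definition wlim :: "'i filter \<Rightarrow> ('i \<Rightarrow> 'e) \<Rightarrow> 'e"
  where "wlim U x = (SOME e. \<forall>v. ((\<lambda>i. pair (x i) v) \<longlongrightarrow> pair e v) U)"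

lemma wlim_tendsto:
  assumes "ultrafilter U" "\<And>i. norm (x i) \<le> R"
  shows "((\<lambda>i. pair (x i) v) \<longlongrightarrow> pair (wlim U x) v) U"
  unfolding wlim_def by (rule someI_ex[OF weak_star_limit[of U x, OF assms], rule_format])

lemma wlim_eqI:
  assumes "ultrafilter U" "\<And>v. ((\<lambda>i. pair (x i) v) \<longlongrightarrow> pair e v) U"
  shows "wlim U x = e"
proof (rule pair_eqI)
  fix v
  have "\<forall>v. ((\<lambda>i. pair (x i) v) \<longlongrightarrow> pair (wlim U x) v) U"
    unfolding wlim_def by (rule someI[of _ e]) (use assms in blast)
  then show "pair (wlim U x) v = pair e v"
    using assms tendsto_unique unfolding ultrafilter_def by blast
qed

text \<open>Weak-* lower semicontinuity of the norm. The bound \<open>R\<close> for all indices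
  secures existence of the limit; the possibly smaller \<open>r\<close> has to hold only
  eventually.\<close>

lemma norm_wlim_le:
  assumes U: "ultrafilter U" and x: "\<And>i. norm (x i) \<le> R"
    and r: "0 \<le> r" "eventually (\<lambda>i. norm (x i) \<le> r) U"
  shows "norm (wlim U x) \<le> r"
proof (rule norm_le_pair[OF r(1)])
  fix v
  have "eventually (\<lambda>i. \<bar>pair (x i) v\<bar> \<le> r * norm v) U"
    using r(2)
  proof eventually_elim
    case (elim i)
    show ?case using abs_pair_le[of "x i" v] mult_right_mono[OF elim, of "norm v"] by simp
  qed
  then show "\<bar>pair (wlim U x) v\<bar> \<le> r * norm v"
    using tendsto_upperbound[OF tendsto_rabs[OF wlim_tendsto[OF U x]]] U
    by (auto simp: ultrafilter_def)
qed

text \<open>The adjoint \<open>A'\<close> on the predual expresses weak-* continuity of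
  \<open>A\<close>; for a dual module it comes from the contragredient action.\<close>

lemma wlim_linear:
  assumes U: "ultrafilter U" and x: "\<And>i. norm (x i) \<le> R"
    and A: "\<And>y v. pair (A y) v = pair y (A' v)"
  shows "wlim U (\<lambda>i. A (x i)) = A (wlim U x)"
  by (rule wlim_eqI[OF U]) (use wlim_tendsto[OF U x] in \<open>simp add: A\<close>)

lemma wlim_diff:
  assumes U: "ultrafilter U" and x: "\<And>i. norm (x i) \<le> R" and y: "\<And>i. norm (y i) \<le> R'"
  shows "wlim U (\<lambda>i. x i - y i) = wlim U x - wlim U y"
  by (rule wlim_eqI[OF U])
    (use tendsto_diff[OF wlim_tendsto[OF U x] wlim_tendsto[OF U y]] in \<open>simp add: pair_diff_left\<close>)

lemma wlim_cong:
  assumes U: "ultrafilter U" and x: "\<And>i. norm (x i) \<le> R" and ev: "eventually (\<lambda>i. x i = y i) U"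
  shows "wlim U y = wlim U x"
proof (rule wlim_eqI[OF U])
  fix v
  show "((\<lambda>i. pair (y i) v) \<longlongrightarrow> pair (wlim U x) v) U"
    by (rule Lim_transform_eventually[OF wlim_tendsto[OF U x]])
      (use ev in eventually_elim, simp)
qed

lemma wlim_const: "ultrafilter U \<Longrightarrow> wlim U (\<lambda>_. e) = e"
  by (rule wlim_eqI) auto

lemma list_coboundary_wlim:
  assumes U: "ultrafilter U" and R: "\<And>i l. norm (b i l) \<le> R"
  shows "list_coboundary (\<lambda>l. wlim U (\<lambda>i. b i l)) xs = wlim U (\<lambda>i. list_coboundary (b i) xs)"
  using R
proof (induction xs arbitrary: b)
  case Nil
  then show ?case using wlim_const[OF U, of 0] by simp
next
  case (Cons x xs)
  have bd: "norm (list_coboundary c l) \<le> length l * R" if "\<And>l. norm (c l) \<le> R"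
    for c :: "'b list \<Rightarrow> 'e" and l
    using that
  proof (induction l arbitrary: c)
    case (Cons y l)
    have "norm (list_coboundary (\<lambda>l. c (y # l)) l) \<le> length l * R"
      by (rule Cons.IH) (rule Cons.prems)
    then show ?case
      using norm_triangle_ineq4[of "c l" "list_coboundary (\<lambda>l. c (y # l)) l"] Cons.prems[of l]
      by (simp add: algebra_simps)
  qed simp
  have "wlim U (\<lambda>i. list_coboundary (b i) (x # xs))
      = wlim U (\<lambda>i. b i xs) - wlim U (\<lambda>i. list_coboundary (\<lambda>l. b i (x # l)) xs)"
    using wlim_diff[OF U, of "\<lambda>i. b i xs" R "\<lambda>i. list_coboundary (\<lambda>l. b i (x # l)) xs"
        "length xs * R"] Cons.prems bd by simp
  also have "\<dots> = list_coboundary (\<lambda>l. wlim U (\<lambda>i. b i l)) (x # xs)"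
    using Cons.IH[of "\<lambda>i l. b i (x # l)"] Cons.prems by simp
  finally show ?case by simp
qed

end

section \<open>Fragmentability of bounded sets in separable dual spaces\<close>

lemma separable_dense_sequence:
  assumes "separable_space (euclidean :: 'e::metric_space topology)"
  obtains d :: "nat \<Rightarrow> 'e::metric_space" where "\<And>x \<epsilon>. 0 < \<epsilon> \<Longrightarrow> \<exists>i. dist x (d i) < \<epsilon>"
proof -
  obtain C :: "'e set" where C: "countable C" "closure C = UNIV"
    using assms unfolding separable_space_def by auto
  then have "C \<noteq> {}" by auto
  show ?thesis
  proof (rule that)
    fix x :: 'e and \<epsilon> :: real assume "0 < \<epsilon>"
    then obtain y where "y \<in> C" "dist y x < \<epsilon>"
      using C(2) closure_approachable by (metis UNIV_I)
    moreover obtain i where "from_nat_into C i = y"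
      using \<open>y \<in> C\<close> from_nat_into_surj[OF C(1)] by blast
    ultimately show "\<exists>i. dist x (from_nat_into C i) < \<epsilon>"
      by (auto simp: dist_commute)
  qed
qed

lemma finite_positive_lower_bound:
  fixes h :: "'v \<Rightarrow> real"
  assumes "finite V" "\<And>v. v \<in> V \<Longrightarrow> 0 < h v"
  shows "\<exists>\<delta>>0. \<forall>v\<in>V. \<delta> \<le> h v"
  using assms
proof (induction V)
  case empty
  show ?case by (rule exI[of _ 1]) simp
next
  case (insert v V)
  then obtain \<delta> where "\<delta> > 0" "\<forall>v\<in>V. \<delta> \<le> h v" by auto
  then show ?case using insert.prems by (intro exI[of _ "min \<delta> (h v)"]) force
qed

context dual_space
begin

text \<open>Bounded subsets of a separable dual space are weak-* fragmentable. Otherwise one could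
  choose nested weak-* closed neighbourhoods that avoid balls around each member of a dense
  sequence in turn, and their intersection contains a weak-* limit point.\<close>

lemma weak_star_fragmentable:
  assumes sep: "separable_space (euclidean :: 'e topology)"
    and K: "K \<noteq> {}" "\<And>k. k \<in> K \<Longrightarrow> norm k \<le> R" and \<epsilon>: "\<epsilon> > 0"
  shows "\<exists>k\<in>K. \<exists>V \<delta>. finite V \<and> \<delta> > 0 \<and>
    (\<forall>k'\<in>K. (\<forall>v\<in>V. \<bar>pair (k' - k) v\<bar> < \<delta>) \<longrightarrow> norm (k' - k) \<le> \<epsilon>)"
proof (rule ccontr)
  assume "\<not> ?thesis"
  then have H: "\<exists>k'\<in>K. (\<forall>v\<in>V. \<bar>pair (k' - k) v\<bar> < \<delta>) \<and> norm (k' - k) > \<epsilon>"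
    if "k \<in> K" "finite V" "\<delta> > 0" for k V \<delta>
    using that by (metis not_le)
  obtain d :: "nat \<Rightarrow> 'e" where d: "\<And>x \<epsilon>. 0 < \<epsilon> \<Longrightarrow> \<exists>i. dist x (d i) < \<epsilon>"
    using separable_dense_sequence[OF sep] by blast
  \<comment> \<open>Non-strict inequalities make these neighbourhoods weak-* closed, so the limit of
    the centres stays inside all of them.\<close>
  define N where "N = (\<lambda>(k, V, \<delta>). {e. \<forall>v\<in>V. \<bar>pair (e - k) v\<bar> \<le> \<delta>})"
  define good where "good = (\<lambda>(k, V :: 'f set, \<delta>::real). k \<in> K \<and> finite V \<and> \<delta> > 0)"
  have step: "\<exists>t. good t \<and> (N t \<subseteq> N s \<and> (\<forall>e\<in>N t. norm (e - d i) \<ge> \<epsilon> / 2))"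
    if s: "good s" for s i
  proof -
    obtain k V \<delta> where s': "s = (k, V, \<delta>)" and k: "k \<in> K" and V: "finite V" and \<delta>: "\<delta> > 0"
      using s by (cases s) (auto simp: good_def)
    obtain k' where k': "k' \<in> K" "\<And>v. v \<in> V \<Longrightarrow> \<bar>pair (k' - k) v\<bar> < \<delta>" "norm (k' - k) > \<epsilon>"
      using H[OF k V \<delta>] by blast
    \<comment> \<open>Two points at distance more than \<open>\<epsilon>\<close> cannot both lie
      within \<open>\<epsilon> / 2\<close> of \<open>d i\<close>; the one outside becomes the next
      centre \<open>l\<close>.\<close>
    have "norm (k' - k) \<le> norm (k' - d i) + norm (k - d i)"
      using norm_triangle_ineq4[of "k' - d i" "k - d i"] by simp
    then have "norm (k' - d i) > \<epsilon> / 2 \<or> norm (k - d i) > \<epsilon> / 2"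
      using k'(3) by auto
    then obtain l where l: "l \<in> K" "norm (l - d i) > \<epsilon> / 2" "\<And>v. v \<in> V \<Longrightarrow> \<bar>pair (l - k) v\<bar> < \<delta>"
      using k k' \<delta> by (auto simp: pair_diff_left)
    then obtain w where w: "\<bar>pair (l - d i) w\<bar> > \<epsilon> / 2 * norm w"
      using norm_le_pair[of "\<epsilon> / 2" "l - d i"] \<epsilon> by (metis half_gt_zero less_imp_le not_le)
    obtain \<eta> where \<eta>: "\<eta> > 0" "\<And>v. v \<in> V \<Longrightarrow> \<eta> \<le> \<delta> - \<bar>pair (l - k) v\<bar>"
      using finite_positive_lower_bound[OF V, of "\<lambda>v. \<delta> - \<bar>pair (l - k) v\<bar>"] l(3) by auto
    \<comment> \<open>Small enough for two purposes: the new neighbourhood stays inside the old one,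
      and the test vector \<open>w\<close> keeps all of it away from the ball around
      \<open>d i\<close>.\<close>
    define \<zeta> where "\<zeta> = min \<eta> (\<bar>pair (l - d i) w\<bar> - \<epsilon> / 2 * norm w)"
    have "\<zeta> > 0" using \<eta> w by (simp add: \<zeta>_def)
    then have "good (l, insert w V, \<zeta>)" using l V by (simp add: good_def)
    moreover have "N (l, insert w V, \<zeta>) \<subseteq> N s"
    proof
      fix e assume e: "e \<in> N (l, insert w V, \<zeta>)"
      have "\<bar>pair (e - k) v\<bar> \<le> \<delta>" if "v \<in> V" for v
      proof -
        have "\<bar>pair (e - l) v\<bar> \<le> \<delta> - \<bar>pair (l - k) v\<bar>"
          using e that \<eta>(2)[OF that] by (auto simp: N_def \<zeta>_def)
        then show ?thesis by (simp add: pair_diff_left)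
      qed
      then show "e \<in> N s" by (simp add: N_def s')
    qed
    moreover have "norm (e - d i) \<ge> \<epsilon> / 2" if e: "e \<in> N (l, insert w V, \<zeta>)" for e
    proof -
      have "\<bar>pair (e - l) w\<bar> \<le> \<bar>pair (l - d i) w\<bar> - \<epsilon> / 2 * norm w"
        using e by (auto simp: N_def \<zeta>_def)
      then have "\<epsilon> / 2 * norm w \<le> \<bar>pair (e - d i) w\<bar>"
        unfolding pair_diff_left by linarith
      also have "\<dots> \<le> norm (e - d i) * norm w" by (rule abs_pair_le)
      finally have "\<epsilon> / 2 * norm w \<le> norm (e - d i) * norm w" .
      moreover have "norm w > 0" using w \<epsilon> by (auto simp: pair_def)
      ultimately show ?thesis by simp
    qed
    ultimately show ?thesis by blast
  qed
  obtain k0 where "k0 \<in> K" using K by blast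
  then have "good (k0, {}, 1)" by (simp add: good_def)
  then obtain s where s: "\<And>n. good (s n)" "\<And>n. N (s (Suc n)) \<subseteq> N (s n)"
    "\<And>n e. e \<in> N (s (Suc n)) \<Longrightarrow> norm (e - d n) \<ge> \<epsilon> / 2"
    using dependent_nat_choice[of "\<lambda>_. good" "\<lambda>i s t. N t \<subseteq> N s \<and> (\<forall>e\<in>N t. norm (e - d i) \<ge> \<epsilon> / 2)"] step
    by metis
  define k where "k n = fst (s n)" for n
  have kK: "k n \<in> K" for n using s(1)[of n] by (auto simp: good_def k_def split: prod.splits)
  have kN: "k n \<in> N (s n)" for n
    using s(1)[of n] by (auto simp: good_def k_def N_def pair_diff_left)
  have "N (s m) \<subseteq> N (s n)" if "n \<le> m" for m n
    using lift_Suc_antimono_le[of "\<lambda>n. N (s n)", OF s(2) that] .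
  with kN have kN': "k m \<in> N (s n)" if "n \<le> m" for m n using that by blast
  obtain U :: "nat filter" where U: "U \<le> sequentially" "ultrafilter U"
    using ultrafilter_exists[of sequentially] by auto
  define e where "e = wlim U k"
  have "e \<in> N (s n)" for n
  proof -
    obtain c V \<delta> where sn: "s n = (c, V, \<delta>)" by (cases "s n")
    have "\<bar>pair (e - c) v\<bar> \<le> \<delta>" if v: "v \<in> V" for v
    proof (rule tendsto_upperbound)
      show "((\<lambda>m. \<bar>pair (k m - c) v\<bar>) \<longlongrightarrow> \<bar>pair (e - c) v\<bar>) U"
        unfolding pair_diff_left e_def
        by (intro tendsto_intros wlim_tendsto[OF U(2), where R = R] K(2) kK)
      show "\<forall>\<^sub>F m in U. \<bar>pair (k m - c) v\<bar> \<le> \<delta>"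
        using filter_leD[OF U(1) eventually_ge_at_top[of n]]
      proof eventually_elim
        case (elim m)
        then show ?case using kN'[OF elim] v by (simp add: sn N_def)
      qed
      show "U \<noteq> bot" using U by (simp add: ultrafilter_def)
    qed
    then show ?thesis by (simp add: sn N_def)
  qed
  then have "norm (e - d n) \<ge> \<epsilon> / 2" for n using s(3) by blast
  moreover obtain i where "dist e (d i) < \<epsilon> / 2" using d[of "\<epsilon> / 2" e] \<epsilon> by auto
  ultimately show False by (metis dist_norm not_le)
qed

end

section \<open>Cylinder densities\<close>

lemma inj_on_extends_to_permutation:
  assumes "finite S" "D \<subseteq> S" "g ` D \<subseteq> S" "inj_on g D"
  shows "\<exists>p. p permutes S \<and> (\<forall>x\<in>D. p x = g x)"
proof -
  have "card (S - D) = card (S - g ` D)"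
    using assms by (simp add: card_Diff_subset finite_subset card_image)
  then obtain h where h: "bij_betw h (S - D) (S - g ` D)"
    using finite_same_card_bij[of "S - D" "S - g ` D"] assms(1) by blast
  define p where "p x = (if x \<in> D then g x else if x \<in> S then h x else x)" for x
  have "bij_betw p D (g ` D)"
    using assms(4) by (auto simp: bij_betw_def p_def inj_on_def)
  moreover have "bij_betw p (S - D) (S - g ` D)"
    using h by (rule bij_betw_cong[THEN iffD1, rotated]) (simp add: p_def)
  ultimately have "bij_betw p (D \<union> (S - D)) (g ` D \<union> (S - g ` D))"
    by (rule bij_betw_combine) auto
  moreover have "D \<union> (S - D) = S" "g ` D \<union> (S - g ` D) = S" using assms(2,3) by blast+
  ultimately have "bij_betw p S S" by simp
  then have "p permutes S" by (rule bij_imp_permutes) (use assms(2) in \<open>auto simp: p_def\<close>)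
  then show ?thesis by (auto simp: p_def)
qed

definition finitary_perms :: "(nat \<Rightarrow> nat) set"
  where "finitary_perms = {p. \<exists>N. p permutes {..<N}}"

lemma permutes_finite_finitary: "p permutes S \<Longrightarrow> finite S \<Longrightarrow> p \<in> finitary_perms"
proof -
  assume "p permutes S" "finite S"
  then obtain N where "S \<subseteq> {..<N}" using finite_nat_bounded by blast
  with \<open>p permutes S\<close> show ?thesis
    unfolding finitary_perms_def using permutes_subset by blast
qed

text \<open>Density, relative to the uniform measure, of conditioning on the event that
  \<open>u\<close> agrees with \<open>y\<close> on \<open>D\<close>; each factor
  \<open>card Y\<close> is the inverse of the probability of one such agreement.\<close>

definition cylinder_density :: "'y set \<Rightarrow> 'i set \<Rightarrow> ('i \<Rightarrow> 'y) \<Rightarrow> ('i \<Rightarrow> 'y) \<Rightarrow> real"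
  where "cylinder_density Y D y u = (\<Prod>i\<in>D. if u i = y i then real (card Y) else 0)"

lemma cylinder_density_nonneg: "0 \<le> cylinder_density Y D y u"
  by (auto simp: cylinder_density_def intro!: prod_nonneg)

lemma cylinder_density_le: "cylinder_density Y D y u \<le> real (card Y) ^ card D"
  using prod_mono[of D "\<lambda>i. if u i = y i then real (card Y) else 0" "\<lambda>_. real (card Y)"]
  by (auto simp: cylinder_density_def)

lemma cylinder_density_union:
  assumes "finite D" "finite D'" "D \<inter> D' = {}"
  shows "cylinder_density Y D y u * cylinder_density Y D' y' u
    = cylinder_density Y (D \<union> D') (\<lambda>i. if i \<in> D then y i else y' i) u"
proof -
  have "cylinder_density Y D y u = cylinder_density Y D (\<lambda>i. if i \<in> D then y i else y' i) u"
    "cylinder_density Y D' y' u = cylinder_density Y D' (\<lambda>i. if i \<in> D then y i else y' i) u"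
    using assms(3) by (auto simp: cylinder_density_def intro!: prod.cong)
  then show ?thesis
    using assms by (simp add: cylinder_density_def prod.union_disjoint)
qed

lemma cylinder_density_compose:
  assumes "bij p"
  shows "cylinder_density Y D y (u \<circ> p) = cylinder_density Y (p ` D) (y \<circ> Hilbert_Choice.inv p) u"
  unfolding cylinder_density_def using assms
  by (subst prod.reindex) (auto simp: bij_is_inj inv_f_f intro: inj_on_subset[OF bij_is_inj])

lemma avg_cylinder_density:
  fixes I :: "'i set"
  assumes Y: "finite Y" "Y \<noteq> {}" and I: "finite I" "D \<subseteq> I" and y: "\<And>i. i \<in> D \<Longrightarrow> y i \<in> Y"
  shows "avg (PiE I (\<lambda>_. Y)) (cylinder_density Y D y) = 1"
proof -
  have Y0: "card Y > 0" using Y by (simp add: card_gt_0_iff)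
  \<comment> \<open>The factor 1 outside \<open>D\<close> turns the density into a product over all
    of \<open>I\<close>, so that the sum over functions factorises.\<close>
  define h where "h i x = (if i \<in> D then if x = y i then real (card Y) else 0 else 1)" for i x
  have "sum (cylinder_density Y D y) (PiE I (\<lambda>_. Y)) = (\<Sum>u\<in>PiE I (\<lambda>_. Y). \<Prod>i\<in>I. h i (u i))"
  proof (rule sum.cong)
    fix u
    show "cylinder_density Y D y u = (\<Prod>i\<in>I. h i (u i))"
      unfolding cylinder_density_def
      by (subst prod.subset_diff[OF I(2,1)]) (auto simp: h_def intro!: prod.cong)
  qed simp
  also have "\<dots> = (\<Prod>i\<in>I. \<Sum>x\<in>Y. h i x)"
    using Y I by (intro prod_sum_PiE[symmetric]) auto
  also have "\<dots> = (\<Prod>i\<in>I. real (card Y))"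
  proof (rule prod.cong)
    fix i
    show "(\<Sum>x\<in>Y. h i x) = real (card Y)"
      using Y(1) y by (cases "i \<in> D") (auto simp: h_def sum.delta)
  qed simp
  finally show ?thesis
    using Y0 I by (simp add: avg_def card_PiE)
qed

lemma avg_mult_left:
  fixes f :: "'i \<Rightarrow> real"
  shows "avg A (\<lambda>i. a * f i) = a * avg A f"
  using avg_scaleR[of A a f] by simp

text \<open>The variance of the absolute value of \<open>X\<close> is nonnegative.\<close>

lemma avg_abs_le_sqrt:
  fixes X :: "'i \<Rightarrow> real"
  assumes "avg A (\<lambda>u. (X u)\<^sup>2) \<le> B" "finite A" "A \<noteq> {}"
  shows "avg A (\<lambda>u. \<bar>X u\<bar>) \<le> sqrt B"
proof (rule real_le_rsqrt)
  let ?a = "avg A (\<lambda>u. \<bar>X u\<bar>)"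
  have "0 \<le> avg A (\<lambda>u. (\<bar>X u\<bar> - ?a)\<^sup>2)"
    unfolding avg_def by (auto intro!: divide_nonneg_nonneg sum_nonneg)
  also have "\<dots> = avg A (\<lambda>u. ((X u)\<^sup>2 - (2 * ?a) *\<^sub>R \<bar>X u\<bar>) + ?a\<^sup>2)"
    by (intro avg_cong) (simp add: power2_eq_square algebra_simps)
  also have "\<dots> = avg A (\<lambda>u. (X u)\<^sup>2) - 2 * ?a * ?a + ?a\<^sup>2"
    unfolding avg_add avg_diff avg_scaleR using avg_const[OF assms(2,3), of "?a\<^sup>2"] by simp
  finally show "?a\<^sup>2 \<le> B" using assms(1) by (simp add: power2_eq_square)
qed

text \<open>Densities of cylinders over disjoint sets of coordinates are uncorrelated.\<close>

lemma avg_abs_sum_centred_densities_le: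
  fixes D :: "'l \<Rightarrow> 'i set"
  assumes Y: "finite Y" "Y \<noteq> {}" and I: "finite I" and L: "finite L"
    and D: "\<And>l. l \<in> L \<Longrightarrow> D l \<subseteq> I" "\<And>l i. l \<in> L \<Longrightarrow> i \<in> D l \<Longrightarrow> y l i \<in> Y"
    and disj: "disjoint_family_on D L" and n: "\<And>l. l \<in> L \<Longrightarrow> card (D l) \<le> n"
    and e: "\<And>l. l \<in> L \<Longrightarrow> \<bar>e l\<bar> \<le> (1::real)"
  shows "avg (PiE I (\<lambda>_. Y)) (\<lambda>u. \<bar>\<Sum>l\<in>L. e l * (cylinder_density Y (D l) (y l) u - 1)\<bar>)
    \<le> sqrt (card L * card Y ^ n)"
proof (rule avg_abs_le_sqrt)
  define Q where "Q = PiE I (\<lambda>_. Y)"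
  show "finite (PiE I (\<lambda>_. Y))" "PiE I (\<lambda>_. Y) \<noteq> {}"
    using Y I by (auto intro!: finite_PiE simp: PiE_eq_empty_iff)
  then have Q: "finite Q" "Q \<noteq> {}" by (simp_all add: Q_def)
  have cY: "1 \<le> real (card Y)" using Y by (simp add: Suc_leI card_gt_0_iff)
  define X where "X l u = cylinder_density Y (D l) (y l) u - 1" for l u
  have fin: "finite (D l)" if "l \<in> L" for l using D(1)[OF that] I finite_subset by blast
  have one: "avg Q (cylinder_density Y (D l) (y l)) = 1" if "l \<in> L" for l
    unfolding Q_def by (rule avg_cylinder_density[OF Y I D(1)[OF that] D(2)[OF that]])
  have c1: "avg Q (\<lambda>_. 1 :: real) = 1" using avg_const[OF Q] .
  have corr: "avg Q (\<lambda>u. X l u * X l' u) = avg Q (\<lambda>u. cylinder_density Y (D l) (y l) u * cylinder_density Y (D l') (y l') u) - 1"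
    if "l \<in> L" "l' \<in> L" for l l'
  proof -
    have "avg Q (\<lambda>u. X l u * X l' u)
      = avg Q (\<lambda>u. (cylinder_density Y (D l) (y l) u * cylinder_density Y (D l') (y l') u
          - cylinder_density Y (D l) (y l) u) - (cylinder_density Y (D l') (y l') u - 1))"
      by (intro avg_cong) (simp add: X_def algebra_simps)
    also have "\<dots> = avg Q (\<lambda>u. cylinder_density Y (D l) (y l) u * cylinder_density Y (D l') (y l') u) - 1"
      unfolding avg_diff using one that c1 by simp
    finally show ?thesis .
  qed
  \<comment> \<open>For disjoint coordinate sets the product of the densities is the density of the
    joint cylinder, whose mean is again 1.\<close>
  have off: "avg Q (\<lambda>u. X l u * X l' u) = 0" if l: "l \<in> L" "l' \<in> L" "l \<noteq> l'" for l l'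
  proof -
    have "D l \<inter> D l' = {}" using disj l by (auto simp: disjoint_family_on_def)
    moreover have "avg Q (cylinder_density Y (D l \<union> D l') (\<lambda>i. if i \<in> D l then y l i else y l' i)) = 1"
      unfolding Q_def
      by (rule avg_cylinder_density[OF Y I]) (use D l in auto)
    ultimately show ?thesis
      by (simp add: corr[OF l(1,2)] cylinder_density_union[OF fin[OF l(1)] fin[OF l(2)]])
  qed
  \<comment> \<open>In the square of a density one factor is bounded by \<open>card Y ^ n\<close>
    and the other has mean 1.\<close>
  have diag: "avg Q (\<lambda>u. X l u * X l u) \<le> card Y ^ n" if l: "l \<in> L" for l
  proof -
    have "real (card Y) ^ card (D l) \<le> card Y ^ n"
      using power_increasing[OF n[OF l] cY] by simp
    then have "cylinder_density Y (D l) (y l) u * cylinder_density Y (D l) (y l) u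
        \<le> (card Y ^ n) *\<^sub>R cylinder_density Y (D l) (y l) u" for u
      using cylinder_density_le[of Y "D l" "y l" u] cylinder_density_nonneg[of Y "D l" "y l" u]
      by (auto intro!: mult_right_mono)
    then have "avg Q (\<lambda>u. cylinder_density Y (D l) (y l) u * cylinder_density Y (D l) (y l) u)
        \<le> avg Q (\<lambda>u. (card Y ^ n) *\<^sub>R cylinder_density Y (D l) (y l) u)"
      by (intro avg_mono)
    then show ?thesis
      unfolding avg_scaleR corr[OF l l] one[OF l] by simp
  qed
  have "avg Q (\<lambda>u. (\<Sum>l\<in>L. e l * X l u)\<^sup>2)
      = avg Q (\<lambda>u. \<Sum>l\<in>L. \<Sum>l'\<in>L. (e l * e l') * (X l u * X l' u))"
    by (intro avg_cong) (simp add: power2_eq_square sum_product algebra_simps)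
  also have "\<dots> = (\<Sum>l\<in>L. \<Sum>l'\<in>L. (e l * e l') * avg Q (\<lambda>u. X l u * X l' u))"
    unfolding avg_sum by (simp add: avg_mult_left)
  also have "\<dots> = (\<Sum>l\<in>L. (e l)\<^sup>2 * avg Q (\<lambda>u. X l u * X l u))"
  proof (rule sum.cong)
    fix l assume l: "l \<in> L"
    have "(\<Sum>l'\<in>L. (e l * e l') * avg Q (\<lambda>u. X l u * X l' u))
        = (\<Sum>l'\<in>L. if l' = l then (e l)\<^sup>2 * avg Q (\<lambda>u. X l u * X l u) else 0)"
      using l off by (intro sum.cong) (auto simp: power2_eq_square)
    then show "(\<Sum>l'\<in>L. (e l * e l') * avg Q (\<lambda>u. X l u * X l' u)) = (e l)\<^sup>2 * avg Q (\<lambda>u. X l u * X l u)"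
      using L l by simp
  qed simp
  also have "\<dots> \<le> (\<Sum>l\<in>L. real (card Y ^ n))"
  proof (rule sum_mono)
    fix l assume l: "l \<in> L"
    have "0 \<le> avg Q (\<lambda>u. X l u * X l u)"
      unfolding avg_def by (auto intro!: divide_nonneg_nonneg sum_nonneg)
    moreover have "(e l)\<^sup>2 \<le> 1" using e[OF l] by (simp add: abs_square_le_1)
    ultimately have "(e l)\<^sup>2 * avg Q (\<lambda>u. X l u * X l u) \<le> avg Q (\<lambda>u. X l u * X l u)"
      by (intro mult_left_le_one_le) auto
    then show "(e l)\<^sup>2 * avg Q (\<lambda>u. X l u * X l u) \<le> real (card Y ^ n)"
      using diag[OF l] by simp
  qed
  also have "\<dots> = card L * card Y ^ n" by simp
  finally show "avg (PiE I (\<lambda>_. Y)) (\<lambda>u. (\<Sum>l\<in>L. e l * (cylinder_density Y (D l) (y l) u - 1))\<^sup>2)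
      \<le> card L * card Y ^ n"
    by (simp add: Q_def X_def)
qed

section \<open>Equivariant families of functions\<close>

text \<open>Isolates what the limit argument needs from the averaged cocycle. The operators
  \<open>A p\<close> preserve norms, but not pairings with a fixed vector; their adjoints
  \<open>A' p\<close> let them pass through weak-* limits and also yield linearity.\<close>

locale equivariant_family = dual_space T for T :: "'e::banach \<Rightarrow> 'f::banach \<Rightarrow>\<^sub>L real" +
  fixes Y :: "'y set" and f :: "nat \<Rightarrow> (nat \<Rightarrow> 'y) \<Rightarrow> 'e" and C :: real
    and A :: "(nat \<Rightarrow> nat) \<Rightarrow> 'e \<Rightarrow> 'e" and A' :: "(nat \<Rightarrow> nat) \<Rightarrow> 'f \<Rightarrow> 'f" and U :: "nat filter"
  assumes Y: "finite Y" "Y \<noteq> {}"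
    and U: "ultrafilter U" "U \<le> sequentially"
    and norm_f: "\<And>N u. u \<in> PiE {..<N} (\<lambda>_. Y) \<Longrightarrow> norm (f N u) \<le> C"
    and equivariant: "\<And>N u p. p permutes {..<N} \<Longrightarrow> u \<in> PiE {..<N} (\<lambda>_. Y) \<Longrightarrow> f N (u \<circ> p) = A p (f N u)"
    and isometric: "\<And>p x. p \<in> finitary_perms \<Longrightarrow> norm (A p x) = norm x"
    and adjoint: "\<And>p x v. p \<in> finitary_perms \<Longrightarrow> pair (A p x) v = pair x (A' p v)"
    and separable: "separable_space (euclidean :: 'e topology)"
begin

abbreviation Q :: "nat \<Rightarrow> (nat \<Rightarrow> 'y) set" where "Q N \<equiv> PiE {..<N} (\<lambda>_. Y)"
abbreviation "dens \<equiv> cylinder_density Y"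

lemma finite_Q: "finite (Q N)" and Q_nonempty: "Q N \<noteq> {}"
  using Y by (auto intro!: finite_PiE simp: PiE_eq_empty_iff)

lemma C_nonneg: "0 \<le> C"
proof -
  obtain u where "u \<in> Q 0" using Q_nonempty by blast
  from norm_f[OF this] show ?thesis using norm_ge_zero order_trans by blast
qed

lemma linear_A: assumes "p \<in> finitary_perms" shows "linear (A p)"
proof (rule linearI)
  show "A p (x + y) = A p x + A p y" for x y
    by (rule pair_eqI) (simp add: adjoint[OF assms] linear_add[OF linear_pair_left])
  show "A p (r *\<^sub>R x) = r *\<^sub>R A p x" for r x
    by (rule pair_eqI) (simp add: adjoint[OF assms] linear_scale[OF linear_pair_left])
qed

text \<open>The same test function is integrated for every \<open>N\<close>, so the bound is asked
  on all functions and not only on one \<open>Q N\<close>.\<close>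

definition bdd :: "((nat \<Rightarrow> 'y) \<Rightarrow> real) \<Rightarrow> bool"
  where "bdd \<Theta> \<longleftrightarrow> (\<exists>B. \<forall>u. \<bar>\<Theta> u\<bar> \<le> B)"

lemma bddI: "(\<And>u. \<bar>\<Theta> u\<bar> \<le> B) \<Longrightarrow> bdd \<Theta>"
  by (auto simp: bdd_def)

lemma bdd_dens: "bdd (dens D y)"
  using cylinder_density_le[of Y D y] cylinder_density_nonneg[of Y D y]
  by (intro bddI[of _ "card Y ^ card D"]) auto

lemma bdd_const: "bdd (\<lambda>_. c)"
  by (auto simp: bdd_def)

lemma bdd_mult: "bdd \<Theta> \<Longrightarrow> bdd \<Theta>' \<Longrightarrow> bdd (\<lambda>u. \<Theta> u * \<Theta>' u)"
proof -
  assume "bdd \<Theta>" "bdd \<Theta>'"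
  then obtain B B' where "\<And>u. \<bar>\<Theta> u\<bar> \<le> B" "\<And>u. \<bar>\<Theta>' u\<bar> \<le> B'"
    by (auto simp: bdd_def)
  then show ?thesis by (intro bddI[of _ "B * B'"]) (auto simp: abs_mult intro!: mult_mono' )
qed

lemma bdd_diff: "bdd \<Theta> \<Longrightarrow> bdd \<Theta>' \<Longrightarrow> bdd (\<lambda>u. \<Theta> u - \<Theta>' u)"
proof -
  assume "bdd \<Theta>" "bdd \<Theta>'"
  then obtain B B' where B: "\<And>u. \<bar>\<Theta> u\<bar> \<le> B" "\<And>u. \<bar>\<Theta>' u\<bar> \<le> B'"
    by (auto simp: bdd_def)
  show ?thesis
    by (rule bddI[of _ "B + B'"]) (use abs_triangle_ineq4 add_mono[OF B] in \<open>blast intro: order_trans\<close>)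
qed

lemma bdd_sum: "(\<And>i. i \<in> I \<Longrightarrow> bdd (\<Theta> i)) \<Longrightarrow> bdd (\<lambda>u. \<Sum>i\<in>I. \<Theta> i u)"
proof -
  assume "\<And>i. i \<in> I \<Longrightarrow> bdd (\<Theta> i)"
  then obtain B where "\<And>i u. i \<in> I \<Longrightarrow> \<bar>\<Theta> i u\<bar> \<le> B i"
    unfolding bdd_def by metis
  then show ?thesis by (intro bddI[of _ "sum B I"]) (auto intro!: order_trans[OF sum_abs] sum_mono)
qed

lemmas bdd_intros = bdd_sum bdd_mult bdd_diff bdd_dens bdd_const

text \<open>The weak-* limit of the vector measures with densities \<open>f N\<close> on \<open>Y\<^sup>N\<close>.\<close>

definition m :: "((nat \<Rightarrow> 'y) \<Rightarrow> real) \<Rightarrow> 'e"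
  where "m \<Theta> = wlim U (\<lambda>N. avg (Q N) (\<lambda>u. \<Theta> u *\<^sub>R f N u))"

lemma norm_avg_le_C: "norm (avg (Q N) (\<lambda>u. \<Theta> u *\<^sub>R f N u)) \<le> C * avg (Q N) (\<lambda>u. \<bar>\<Theta> u\<bar>)"
proof -
  have "norm (avg (Q N) (\<lambda>u. \<Theta> u *\<^sub>R f N u)) \<le> avg (Q N) (\<lambda>u. C * \<bar>\<Theta> u\<bar>)"
    using norm_f by (intro order_trans[OF norm_avg_le_avg] avg_mono)
      (auto simp: mult.commute[of C] intro!: mult_left_mono)
  then show ?thesis by (simp add: avg_mult_left)
qed

lemma norm_avg_bdd:
  assumes "\<And>u. \<bar>\<Theta> u\<bar> \<le> B"
  shows "norm (avg (Q N) (\<lambda>u. \<Theta> u *\<^sub>R f N u)) \<le> C * B"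
proof -
  have "avg (Q N) (\<lambda>u. \<bar>\<Theta> u\<bar>) \<le> avg (Q N) (\<lambda>_. B)"
    using assms by (rule avg_mono)
  then have "avg (Q N) (\<lambda>u. \<bar>\<Theta> u\<bar>) \<le> B"
    using avg_const[OF finite_Q Q_nonempty, of N B] by simp
  then show ?thesis
    using norm_avg_le_C[of N \<Theta>] mult_left_mono[OF _ C_nonneg] order_trans by blast
qed

lemma m_tendsto:
  assumes "bdd \<Theta>"
  shows "((\<lambda>N. pair (avg (Q N) (\<lambda>u. \<Theta> u *\<^sub>R f N u)) v) \<longlongrightarrow> pair (m \<Theta>) v) U"
proof -
  obtain B where "\<And>u. \<bar>\<Theta> u\<bar> \<le> B" using assms by (auto simp: bdd_def)
  then show ?thesis unfolding m_def
    by (intro wlim_tendsto[OF U(1), where R = "C * B"] norm_avg_bdd)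
qed

lemma m_diff:
  assumes "bdd \<Theta>" "bdd \<Theta>'"
  shows "m (\<lambda>u. \<Theta> u - \<Theta>' u) = m \<Theta> - m \<Theta>'"
proof -
  have "((\<lambda>N. pair (avg (Q N) (\<lambda>u. (\<Theta> u - \<Theta>' u) *\<^sub>R f N u)) v) \<longlongrightarrow> pair (m \<Theta> - m \<Theta>') v) U" for v
    using tendsto_diff[OF m_tendsto[OF assms(1)] m_tendsto[OF assms(2)]]
    by (simp add: scaleR_diff_left avg_diff pair_diff_left)
  then show ?thesis unfolding m_def[of "\<lambda>u. \<Theta> u - \<Theta>' u"] by (rule wlim_eqI[OF U(1)])
qed

lemma m_sum:
  assumes "\<And>i. i \<in> I \<Longrightarrow> bdd (\<Theta> i)"
  shows "m (\<lambda>u. \<Sum>i\<in>I. a i * \<Theta> i u) = (\<Sum>i\<in>I. a i *\<^sub>R m (\<Theta> i))"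
proof -
  have "((\<lambda>N. pair (avg (Q N) (\<lambda>u. (\<Sum>i\<in>I. a i * \<Theta> i u) *\<^sub>R f N u)) v)
      \<longlongrightarrow> pair (\<Sum>i\<in>I. a i *\<^sub>R m (\<Theta> i)) v) U" for v
  proof -
    have "((\<lambda>N. \<Sum>i\<in>I. a i * pair (avg (Q N) (\<lambda>u. \<Theta> i u *\<^sub>R f N u)) v)
        \<longlongrightarrow> (\<Sum>i\<in>I. a i * pair (m (\<Theta> i)) v)) U"
      using assms by (intro tendsto_intros m_tendsto)
    moreover have "avg (Q N) (\<lambda>u. (\<Sum>i\<in>I. a i * \<Theta> i u) *\<^sub>R f N u)
        = (\<Sum>i\<in>I. a i *\<^sub>R avg (Q N) (\<lambda>u. \<Theta> i u *\<^sub>R f N u))" for N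
      by (simp add: scaleR_left.sum avg_sum avg_scaleR flip: scaleR_scaleR)
    ultimately show ?thesis
      by (simp add: linear_sum[OF linear_pair_left] linear_scale[OF linear_pair_left])
  qed
  then show ?thesis unfolding m_def[of "\<lambda>u. \<Sum>i\<in>I. a i * \<Theta> i u"] by (rule wlim_eqI[OF U(1)])
qed

text \<open>The functions \<open>f N\<close> are bounded by \<open>C\<close>, so the L1 norm of the
  density controls \<open>m\<close>. Large \<open>N\<close> suffice, which leaves room for all
  coordinates on which a cylinder depends.\<close>

lemma norm_m_le:
  assumes "bdd \<Theta>" "0 \<le> b" "\<And>N. N0 \<le> N \<Longrightarrow> avg (Q N) (\<lambda>u. \<bar>\<Theta> u\<bar>) \<le> b"
  shows "norm (m \<Theta>) \<le> C * b"
proof -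
  obtain B where B: "\<And>u. \<bar>\<Theta> u\<bar> \<le> B" using assms by (auto simp: bdd_def)
  have "eventually (\<lambda>N. norm (avg (Q N) (\<lambda>u. \<Theta> u *\<^sub>R f N u)) \<le> C * b) U"
    using filter_leD[OF U(2) eventually_ge_at_top[of N0]]
  proof eventually_elim
    case (elim N)
    then show ?case
      using norm_avg_le_C[of N \<Theta>] mult_left_mono[OF assms(3)[OF elim] C_nonneg] by simp
  qed
  then show ?thesis
    unfolding m_def using norm_avg_bdd[OF B] C_nonneg assms(2) by (intro norm_wlim_le[OF U(1)]) auto
qed

text \<open>Substituting \<open>u \<circ> p\<close> for \<open>u\<close> in the average over
  \<open>Q N\<close> and applying equivariance. This is possible as soon as \<open>p\<close>
  permutes \<open>{..<N}\<close>, hence eventually along \<open>U\<close>.\<close>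

lemma m_compose:
  assumes p: "p \<in> finitary_perms" and bdd: "bdd \<Theta>"
  shows "m \<Theta> = A p (m (\<lambda>u. \<Theta> (u \<circ> p)))"
proof -
  obtain N0 where N0: "p permutes {..<N0}" using p by (auto simp: finitary_perms_def)
  obtain B where B: "\<And>u. \<bar>\<Theta> u\<bar> \<le> B" using bdd by (auto simp: bdd_def)
  have eq: "avg (Q N) (\<lambda>u. \<Theta> u *\<^sub>R f N u) = A p (avg (Q N) (\<lambda>u. \<Theta> (u \<circ> p) *\<^sub>R f N u))"
    if "N0 \<le> N" for N
  proof -
    have pN: "p permutes {..<N}" using permutes_subset[OF N0] that by auto
    have c: "u \<circ> q \<in> Q N" if u: "u \<in> Q N" and q: "q permutes {..<N}" for u q
      using u permutes_in_image[OF q] permutes_not_in[OF q]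
      by (auto simp: PiE_iff extensional_def)
    have "bij_betw (\<lambda>u. u \<circ> p) (Q N) (Q N)"
      by (rule bij_betw_byWitness[where f' = "\<lambda>u. u \<circ> Hilbert_Choice.inv p"])
        (use c pN permutes_inv[OF pN] in \<open>auto simp: comp_assoc permutes_inv_o[OF pN]\<close>)
    from avg_bij_betw[OF this]
    have "avg (Q N) (\<lambda>u. \<Theta> u *\<^sub>R f N u) = avg (Q N) (\<lambda>u. \<Theta> (u \<circ> p) *\<^sub>R f N (u \<circ> p))" .
    also have "\<dots> = avg (Q N) (\<lambda>u. A p (\<Theta> (u \<circ> p) *\<^sub>R f N u))"
      using equivariant[OF pN] linear_scale[OF linear_A[OF p]] by (intro avg_cong) simp
    finally show ?thesis by (simp add: avg_linear[OF linear_A[OF p]])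
  qed
  have "m \<Theta> = wlim U (\<lambda>N. A p (avg (Q N) (\<lambda>u. \<Theta> (u \<circ> p) *\<^sub>R f N u)))"
    unfolding m_def
  proof (rule wlim_cong[OF U(1)])
    show "norm (A p (avg (Q N) (\<lambda>u. \<Theta> (u \<circ> p) *\<^sub>R f N u))) \<le> C * B" for N
      unfolding isometric[OF p] by (rule norm_avg_bdd) (rule B)
    show "\<forall>\<^sub>F N in U. A p (avg (Q N) (\<lambda>u. \<Theta> (u \<circ> p) *\<^sub>R f N u)) = avg (Q N) (\<lambda>u. \<Theta> u *\<^sub>R f N u)"
      using filter_leD[OF U(2) eventually_ge_at_top[of N0]] by eventually_elim (simp add: eq)
  qed
  also have "\<dots> = A p (m (\<lambda>u. \<Theta> (u \<circ> p)))"
    unfolding m_def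
    by (rule wlim_linear[OF U(1) norm_avg_bdd, of _ B]) (auto intro: B adjoint[OF p])
  finally show ?thesis .
qed

lemma norm_m_compose:
  assumes "p \<in> finitary_perms" "bdd \<Theta>"
  shows "norm (m (\<lambda>u. \<Theta> (u \<circ> p))) = norm (m \<Theta>)"
  using m_compose[OF assms] isometric[OF assms(1)] by simp

text \<open>A Bessel-type argument. With \<open>M\<close> bad coordinates, the sum of the centred
  densities with suitable signs has pairing at least \<open>M * \<delta>\<close>, whereas its L1
  norm is only of order \<open>sqrt M\<close> because the densities are uncorrelated.\<close>

lemma bad_coordinates_finite:
  assumes D: "finite D" "\<And>i. i \<in> D \<Longrightarrow> y i \<in> Y" and z: "z \<in> Y" and \<delta>: "\<delta> > 0"
  shows "finite {j. j \<notin> D \<and> \<delta> \<le> \<bar>pair (m (\<lambda>u. dens D y u * (dens {j} (\<lambda>_. z) u - 1))) v\<bar>}"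
    (is "finite ?J")
proof (rule ccontr)
  define \<alpha> where "\<alpha> j = pair (m (\<lambda>u. dens D y u * (dens {j} (\<lambda>_. z) u - 1))) v" for j
  define K where "K = C * (real (card Y) ^ card D * sqrt (card Y)) * norm v"
  assume "infinite ?J"
  \<comment> \<open>Chosen so that \<open>sqrt M * \<delta>\<close> exceeds \<open>K\<close>, which
    contradicts the comparison of the two growth rates.\<close>
  obtain M :: nat where M: "K\<^sup>2 / \<delta>\<^sup>2 < real M" using reals_Archimedean2 by blast
  obtain J where J: "finite J" "J \<subseteq> ?J" "card J = M"
    using infinite_arbitrarily_large[OF \<open>infinite ?J\<close>] by blast
  define \<Theta> where "\<Theta> u = (\<Sum>j\<in>J. sgn (\<alpha> j) * (dens D y u * (dens {j} (\<lambda>_. z) u - 1)))" for u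
  have \<Theta>_eq: "\<Theta> u = dens D y u * (\<Sum>j\<in>J. sgn (\<alpha> j) * (dens {j} (\<lambda>_. z) u - 1))" for u
    unfolding \<Theta>_def sum_distrib_left by (intro sum.cong) auto
  have bdd: "bdd \<Theta>" unfolding \<Theta>_def by (intro bdd_intros)
  have "norm (m \<Theta>) \<le> C * (real (card Y) ^ card D * sqrt (card J * card Y ^ 1))"
  proof (rule norm_m_le[OF bdd])
    fix N assume N: "Max (insert 0 J) + 1 \<le> N"
    have JN: "J \<subseteq> {..<N}"
    proof
      fix j assume "j \<in> J"
      then have "j \<le> Max (insert 0 J)" using J(1) by simp
      then show "j \<in> {..<N}" using N by simp
    qed
    have "avg (Q N) (\<lambda>u. \<bar>\<Theta> u\<bar>)
      \<le> avg (Q N) (\<lambda>u. real (card Y) ^ card D * \<bar>\<Sum>j\<in>J. sgn (\<alpha> j) * (dens {j} (\<lambda>_. z) u - 1)\<bar>)"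
      unfolding \<Theta>_eq abs_mult using cylinder_density_le[of Y D y] cylinder_density_nonneg[of Y D y]
      by (intro avg_mono mult_right_mono) auto
    also have "\<dots> = real (card Y) ^ card D * avg (Q N) (\<lambda>u. \<bar>\<Sum>j\<in>J. sgn (\<alpha> j) * (dens {j} (\<lambda>_. z) u - 1)\<bar>)"
      by (rule avg_mult_left)
    also have "\<dots> \<le> real (card Y) ^ card D * sqrt (card J * card Y ^ 1)"
      using JN J(1) Y z
      by (intro mult_left_mono avg_abs_sum_centred_densities_le)
        (auto simp: disjoint_family_on_def abs_sgn_eq)
    finally show "avg (Q N) (\<lambda>u. \<bar>\<Theta> u\<bar>) \<le> \<dots>" .
  qed auto
  then have "norm (m \<Theta>) * norm v \<le> C * (real (card Y) ^ card D * sqrt (card J * card Y ^ 1)) * norm v"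
    by (rule mult_right_mono) simp
  also have "\<dots> = K * sqrt M" by (simp add: K_def J(3) real_sqrt_mult)
  finally have "pair (m \<Theta>) v \<le> K * sqrt M"
    using abs_pair_le[of "m \<Theta>" v] by simp
  moreover have "pair (m \<Theta>) v = (\<Sum>j\<in>J. \<bar>\<alpha> j\<bar>)"
  proof -
    have "m \<Theta> = (\<Sum>j\<in>J. sgn (\<alpha> j) *\<^sub>R m (\<lambda>u. dens D y u * (dens {j} (\<lambda>_. z) u - 1)))"
      unfolding \<Theta>_def by (rule m_sum) (intro bdd_intros)
    then show ?thesis
      by (simp add: linear_sum[OF linear_pair_left] linear_scale[OF linear_pair_left] \<alpha>_def[symmetric]
          abs_sgn mult.commute)
  qed
  moreover have "(\<Sum>j\<in>J. \<bar>\<alpha> j\<bar>) \<ge> (\<Sum>j\<in>J. \<delta>)"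
    using J(2) by (intro sum_mono) (auto simp: \<alpha>_def)
  ultimately have "real M * \<delta> \<le> K * sqrt M"
    using J(3) by simp
  then have "sqrt M * (sqrt M * \<delta>) \<le> sqrt M * K"
    unfolding mult.assoc[symmetric] by (simp add: mult.commute)
  moreover have "M > 0"
    using M by (metis divide_nonneg_nonneg of_nat_0 not_gr_zero not_less zero_le_power2)
  ultimately have "sqrt M * \<delta> \<le> K" by simp
  then have "(sqrt M * \<delta>)\<^sup>2 \<le> K\<^sup>2" using \<delta> by (intro power_mono) auto
  then show False using M \<delta> by (simp add: power_mult_distrib field_simps)
qed

text \<open>Densities of disjoint coordinates multiply, so the left side measures how far the
  additional condition at \<open>j\<close> moves the limit of the conditional expectations.\<close>

lemma m_dens_insert:
  assumes "finite D" "j \<notin> D"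
  shows "m (\<lambda>u. dens D y u * (dens {j} (\<lambda>_. z) u - 1)) = m (dens (insert j D) (y(j := z))) - m (dens D y)"
proof -
  have "dens D y u * (dens {j} (\<lambda>_. z) u - 1) = dens (insert j D) (y(j := z)) u - dens D y u" for u
  proof -
    have "dens (insert j D) (y(j := z)) u = dens {j} (\<lambda>_. z) u * dens D y u"
      using assms unfolding cylinder_density_def by (auto intro!: prod.cong)
    then show ?thesis by (simp add: algebra_simps)
  qed
  then show ?thesis by (simp add: m_diff bdd_dens)
qed

theorem conditioning_on_coordinate:
  assumes z: "z \<in> Y"
  shows "m (dens {0} (\<lambda>_. z)) = m (\<lambda>_. 1)"
proof -
  define \<psi> :: "(nat \<Rightarrow> 'y) \<Rightarrow> real" where "\<psi> u = dens {0} (\<lambda>_. z) u - 1" for u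
  have bdd_\<psi>: "bdd \<psi>" unfolding \<psi>_def by (intro bdd_intros)
  have \<psi>_le: "\<bar>\<psi> u\<bar> \<le> real (card Y)" for u
  proof -
    have "1 \<le> real (card Y)" using Y by (simp add: Suc_leI card_gt_0_iff)
    then show ?thesis
      using cylinder_density_le[of Y "{0}" "\<lambda>_. z" u] cylinder_density_nonneg[of Y "{0}" "\<lambda>_. z" u]
      by (auto simp: \<psi>_def abs_le_iff)
  qed
  have "norm (m \<psi>) \<le> \<epsilon>" if \<epsilon>: "\<epsilon> > 0" for \<epsilon>
  proof -
    \<comment> \<open>The limits of conditional expectations given finitely many coordinates.
      Densities have mean 1, so all of them lie in the ball of radius \<open>C\<close>.\<close>
    define K where "K = {m (dens D y) | D y. finite D \<and> (\<forall>i\<in>D. y i \<in> Y)}"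
    have "norm k \<le> C" if k: "k \<in> K" for k
    proof -
      obtain D y where kD: "k = m (dens D y)" "finite D" "\<And>i. i \<in> D \<Longrightarrow> y i \<in> Y"
        using k by (auto simp: K_def)
      obtain N0 where N0: "D \<subseteq> {..<N0}" using kD(2) finite_nat_bounded by blast
      have "norm (m (dens D y)) \<le> C * 1"
      proof (rule norm_m_le[OF bdd_dens])
        fix N assume "N0 \<le> N"
        then have "avg (Q N) (dens D y) = 1"
          using N0 kD(3) by (intro avg_cylinder_density[OF Y]) auto
        then show "avg (Q N) (\<lambda>u. \<bar>dens D y u\<bar>) \<le> 1"
          by (simp add: cylinder_density_nonneg)
      qed auto
      then show ?thesis by (simp add: kD)
    qed
    moreover have "K \<noteq> {}" unfolding K_def by (auto intro!: exI[of _ "{}"])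
    ultimately obtain k V \<delta> where k: "k \<in> K" and V: "finite V" "\<delta> > 0"
      and near: "\<And>k'. k' \<in> K \<Longrightarrow> \<forall>v\<in>V. \<bar>pair (k' - k) v\<bar> < \<delta> \<Longrightarrow> norm (k' - k) \<le> \<epsilon>"
      using weak_star_fragmentable[OF separable, of K C \<epsilon>] \<epsilon> by metis
    obtain D y where kD: "k = m (dens D y)" and D: "finite D" "\<And>i. i \<in> D \<Longrightarrow> y i \<in> Y"
      using k by (auto simp: K_def)
    \<comment> \<open>Each of the finitely many test vectors has finitely many bad coordinates. Any
      other coordinate moves \<open>k\<close> within its weak-* neighbourhood, and therefore by at
      most \<open>\<epsilon>\<close> in norm.\<close>
    have fin: "finite (D \<union> (\<Union>v\<in>V. {j. j \<notin> D \<and> \<delta> \<le> \<bar>pair (m (\<lambda>u. dens D y u * (dens {j} (\<lambda>_. z) u - 1))) v\<bar>}))"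
      (is "finite ?J")
      using V D bad_coordinates_finite[OF D z] by auto
    obtain j where "j \<notin> ?J"
      using ex_new_if_finite[OF infinite_UNIV_nat fin] by blast
    then have j: "j \<notin> D"
      "v \<in> V \<Longrightarrow> \<bar>pair (m (\<lambda>u. dens D y u * (dens {j} (\<lambda>_. z) u - 1))) v\<bar> < \<delta>" for v
      by (auto simp: not_le)
    have jle: "norm (m (\<lambda>u. dens D y u * (dens {j} (\<lambda>_. z) u - 1))) \<le> \<epsilon>"
      unfolding m_dens_insert[OF D(1) j(1)] kD[symmetric]
    proof (rule near)
      show "m (dens (insert j D) (y(j := z))) \<in> K"
        using D z unfolding K_def by (auto intro!: exI[of _ "insert j D"] exI[of _ "y(j := z)"])
      show "\<forall>v\<in>V. \<bar>pair (m (dens (insert j D) (y(j := z))) - k) v\<bar> < \<delta>"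
        using j(2) unfolding m_dens_insert[OF D(1) j(1)] kD[symmetric] by blast
    qed
    define n where "n = card D"
    \<comment> \<open>Disjoint consecutive intervals with as many elements as \<open>D\<close>; the
      shift by 1 keeps coordinate 0 free for \<open>\<psi>\<close>.\<close>
    define B where "B l = {1 + l * n..<1 + Suc l * n}" for l
    have B: "finite (B l)" "card (B l) = n" "0 \<notin> B l" for l by (auto simp: B_def)
    have disj: "disjoint_family B"
      unfolding disjoint_family_on_def
    proof (intro ballI impI)
      have *: "B l \<inter> B l' = {}" if "l < l'" for l l'
      proof -
        have "Suc l * n \<le> l' * n" using that by (intro mult_right_mono) auto
        then show ?thesis by (auto simp: B_def)
      qed
      fix l l' :: nat assume "l \<noteq> l'"
      then show "B l \<inter> B l' = {}" using *[of l l'] *[of l' l] by (cases "l < l'") auto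
    qed
    have "\<exists>y'. (\<forall>i\<in>B l. y' i \<in> Y) \<and> norm (m (\<lambda>u. dens (B l) y' u * \<psi> u)) \<le> \<epsilon>" for l
    proof -
      obtain g where g: "bij_betw g D (B l)"
        using finite_same_card_bij[OF D(1) B(1)] B(2) n_def by metis
      \<comment> \<open>Sends \<open>D\<close> onto the block \<open>B l\<close> and the good
        coordinate \<open>j\<close> to 0; its extension to a finitary permutation transports the
        estimate.\<close>
      define g' where "g' = g(j := 0)"
      have gD: "g' ` D = B l" using g j(1) by (auto simp: g'_def bij_betw_def image_def)
      define S where "S = insert j D \<union> insert 0 (B l)"
      have "inj_on g' D"
        using g j(1) by (auto simp: g'_def bij_betw_def inj_on_def)
      moreover have "g' j \<notin> g' ` (D - {j})"
        using gD B(3)[of l] j(1) by (simp add: g'_def)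
      ultimately have "inj_on g' (insert j D)" by simp
      moreover have "insert j D \<subseteq> S" "g' ` insert j D \<subseteq> S"
        using gD by (auto simp: S_def g'_def)
      moreover have "finite S" using D B by (simp add: S_def)
      ultimately obtain p where p: "p permutes S" "\<And>x. x \<in> insert j D \<Longrightarrow> p x = g' x"
        using inj_on_extends_to_permutation[of S "insert j D" g'] by metis
      have pf: "p \<in> finitary_perms" using permutes_finite_finitary[OF p(1) \<open>finite S\<close>] .
      have bp: "bij p" using permutes_bij[OF p(1)] .
      have pD: "p ` D = B l" "p ` {j} = {0}" using p(2) gD by (auto simp: g'_def image_def)
      define y' where "y' = y \<circ> Hilbert_Choice.inv p"
      have "(\<lambda>u. dens (B l) y' u * \<psi> u) = (\<lambda>u. dens D y (u \<circ> p) * (dens {j} (\<lambda>_. z) (u \<circ> p) - 1))"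
        unfolding cylinder_density_compose[OF bp] pD y'_def \<psi>_def by (simp add: comp_def)
      \<comment> \<open>The isometry behind \<open>p\<close> preserves this norm estimate, whereas
        the weak-* estimates it came from would be carried to other test vectors.\<close>
      then have "norm (m (\<lambda>u. dens (B l) y' u * \<psi> u)) \<le> \<epsilon>"
        using norm_m_compose[OF pf, of "\<lambda>u. dens D y u * (dens {j} (\<lambda>_. z) u - 1)"] jle
        by (simp add: bdd_intros)
      moreover have "\<forall>i\<in>B l. y' i \<in> Y"
        unfolding pD(1)[symmetric] y'_def using D(2) bp by (auto simp: inv_f_f bij_is_inj)
      ultimately show ?thesis by blast
    qed
    then obtain y' where y': "\<And>l i. i \<in> B l \<Longrightarrow> y' l i \<in> Y"
      "\<And>l. norm (m (\<lambda>u. dens (B l) (y' l) u * \<psi> u)) \<le> \<epsilon>"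
      by metis
    define c where "c = C * (card Y * sqrt (card Y ^ n))"
    have bound: "norm (m \<psi>) \<le> \<epsilon> + c / sqrt M" if M: "M > 0" for M :: nat
    proof -
      \<comment> \<open>The sum of \<open>m\<close> over the \<open>M\<close> weighted copies of
        \<open>\<psi>\<close> differs from \<open>M\<close> times \<open>m \<psi>\<close> by
        \<open>m \<Theta>\<close>, which grows only like \<open>sqrt M\<close>. The coefficients
        \<open>1 *\<close> match \<open>m_sum\<close> and
        \<open>avg_abs_sum_centred_densities_le\<close>.\<close>
      define \<Theta> where "\<Theta> u = \<psi> u * (\<Sum>l<M. 1 * (dens (B l) (y' l) u - 1))" for u
      have "bdd \<Theta>" unfolding \<Theta>_def by (intro bdd_intros bdd_\<psi>)
      have \<Theta>_eq: "\<Theta> u = (\<Sum>l<M. 1 * (dens (B l) (y' l) u * \<psi> u)) - (\<Sum>l<M. 1 * \<psi> u)" for u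
        by (simp add: \<Theta>_def sum_distrib_left sum_subtractf algebra_simps)
      have "m \<Theta> = m (\<lambda>u. \<Sum>l<M. 1 * (dens (B l) (y' l) u * \<psi> u)) - m (\<lambda>u. \<Sum>l<M. 1 * \<psi> u)"
        unfolding \<Theta>_eq by (intro m_diff bdd_intros bdd_\<psi>)
      also have "\<dots> = (\<Sum>l<M. 1 *\<^sub>R m (\<lambda>u. dens (B l) (y' l) u * \<psi> u)) - (\<Sum>l<M. 1 *\<^sub>R m \<psi>)"
        by (intro arg_cong2[where f = minus] m_sum bdd_intros bdd_\<psi>)
      finally have "real M *\<^sub>R m \<psi> = (\<Sum>l<M. m (\<lambda>u. dens (B l) (y' l) u * \<psi> u)) - m \<Theta>"
        by (simp add: sum_constant_scaleR)
      then have "real M * norm (m \<psi>) = norm ((\<Sum>l<M. m (\<lambda>u. dens (B l) (y' l) u * \<psi> u)) - m \<Theta>)"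
        by (metis abs_of_nat norm_scaleR)
      also have "\<dots> \<le> (\<Sum>l<M. norm (m (\<lambda>u. dens (B l) (y' l) u * \<psi> u))) + norm (m \<Theta>)"
        by (rule order_trans[OF norm_triangle_ineq4 add_right_mono[OF norm_sum]])
      also have "\<dots> \<le> (\<Sum>l<M. \<epsilon>) + norm (m \<Theta>)"
        using y'(2) by (intro add_right_mono sum_mono)
      also have "norm (m \<Theta>) \<le> C * (card Y * sqrt (M * card Y ^ n))"
      proof (rule norm_m_le[OF \<open>bdd \<Theta>\<close>])
        fix N assume N: "1 + M * n \<le> N"
        have BN: "B l \<subseteq> {..<N}" if "l < M" for l
        proof -
          have "Suc l * n \<le> M * n" using that by (intro mult_right_mono) auto
          then show ?thesis using N by (auto simp: B_def)
        qed
        have "avg (Q N) (\<lambda>u. \<bar>\<Theta> u\<bar>)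
            \<le> avg (Q N) (\<lambda>u. card Y * \<bar>\<Sum>l<M. 1 * (dens (B l) (y' l) u - 1)\<bar>)"
          unfolding \<Theta>_def abs_mult using \<psi>_le by (intro avg_mono mult_right_mono) auto
        also have "\<dots> = card Y * avg (Q N) (\<lambda>u. \<bar>\<Sum>l<M. 1 * (dens (B l) (y' l) u - 1)\<bar>)"
          by (rule avg_mult_left)
        also have "\<dots> \<le> card Y * sqrt (card {..<M} * card Y ^ n)"
          using Y BN y'(1) B(2) disjoint_family_on_mono[OF _ disj]
          by (intro mult_left_mono avg_abs_sum_centred_densities_le) auto
        finally show "avg (Q N) (\<lambda>u. \<bar>\<Theta> u\<bar>) \<le> card Y * sqrt (M * card Y ^ n)" by simp
      qed auto
      finally have "real M * norm (m \<psi>) \<le> real M * \<epsilon> + c * sqrt M"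
        by (simp add: c_def real_sqrt_mult algebra_simps)
      then have "norm (m \<psi>) \<le> \<epsilon> + c * (sqrt M / M)"
        using M by (simp add: field_simps)
      then show ?thesis using sqrt_divide_self_eq[of "real M"] by (simp add: divide_inverse)
    qed
    have "filterlim (\<lambda>M. sqrt (real M)) at_infinity sequentially"
      by (rule filterlim_at_top_imp_at_infinity[OF filterlim_compose[OF sqrt_at_top filterlim_real_sequentially]])
    then have "(\<lambda>M. c / sqrt (real M)) \<longlonglongrightarrow> 0"
      by (rule tendsto_divide_0[OF tendsto_const])
    from tendsto_add[OF tendsto_const this, of \<epsilon>]
    have "(\<lambda>M. \<epsilon> + c / sqrt (real M)) \<longlonglongrightarrow> \<epsilon>" by simp
    moreover have "\<exists>N. \<forall>M\<ge>N. norm (m \<psi>) \<le> \<epsilon> + c / sqrt (real M)"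
      using bound by (intro exI[of _ 1]) auto
    ultimately show ?thesis by (rule LIMSEQ_le_const)
  qed
  then have "norm (m \<psi>) \<le> 0"
    using field_le_epsilon[of "norm (m \<psi>)" 0] by simp
  then show ?thesis unfolding \<psi>_def by (simp add: m_diff bdd_dens bdd_const)
qed

end

section \<open>Commuting conjugates\<close>

lemma finitary_perms_comp: "p \<in> finitary_perms \<Longrightarrow> q \<in> finitary_perms \<Longrightarrow> p \<circ> q \<in> finitary_perms"
proof -
  assume "p \<in> finitary_perms" "q \<in> finitary_perms"
  then obtain M N where "p permutes {..<M}" "q permutes {..<N}" by (auto simp: finitary_perms_def)
  then have "p permutes {..<max M N}" "q permutes {..<max M N}"
    by (auto elim: permutes_subset)
  then show ?thesis unfolding finitary_perms_def using permutes_compose by blast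
qed

lemma finitary_perms_transpose: "Transposition.transpose i j \<in> finitary_perms"
  by (rule permutes_finite_finitary[of _ "{i, j}"]) (auto intro: permutes_swap_id)

lemma finitary_perms_id: "id \<in> finitary_perms"
  unfolding finitary_perms_def using permutes_id by blast

lemma finitary_perms_bij: "p \<in> finitary_perms \<Longrightarrow> bij p"
  unfolding finitary_perms_def using permutes_bij by blast

text \<open>A set \<open>S\<close> together with infinitely many conjugates of it, all commuting with each other and
  permuted by a copy of the finitary symmetric group; \<open>S\<close> is the conjugate with index 0.\<close>

locale commuting_conjugates = group G for G (structure) +
  fixes S :: "'g set" and \<tau> :: "(nat \<Rightarrow> nat) \<Rightarrow> 'g"
  assumes S_subset: "S \<subseteq> carrier G"
    and \<tau>_closed: "p \<in> finitary_perms \<Longrightarrow> \<tau> p \<in> carrier G"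
    and \<tau>_comp: "p \<in> finitary_perms \<Longrightarrow> q \<in> finitary_perms \<Longrightarrow> \<tau> (p \<circ> q) = \<tau> p \<otimes> \<tau> q"
    and \<tau>_stabilizer: "p \<in> finitary_perms \<Longrightarrow> p 0 = 0 \<Longrightarrow> s \<in> S \<Longrightarrow> \<tau> p \<otimes> s = s \<otimes> \<tau> p"
    and conjugates_commute: "j \<noteq> 0 \<Longrightarrow> s \<in> S \<Longrightarrow> t \<in> S \<Longrightarrow>
      s \<otimes> (\<tau> (Transposition.transpose 0 j) \<otimes> t \<otimes> inv \<tau> (Transposition.transpose 0 j))
      = (\<tau> (Transposition.transpose 0 j) \<otimes> t \<otimes> inv \<tau> (Transposition.transpose 0 j)) \<otimes> s"
begin

definition cj :: "nat \<Rightarrow> 'g \<Rightarrow> 'g"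
  where "cj j s = \<tau> (Transposition.transpose 0 j) \<otimes> s \<otimes> inv \<tau> (Transposition.transpose 0 j)"

lemma S_closed: "s \<in> S \<Longrightarrow> s \<in> carrier G" using S_subset by blast

lemma cj_closed: "s \<in> S \<Longrightarrow> cj j s \<in> carrier G"
  unfolding cj_def using \<tau>_closed finitary_perms_transpose S_closed by simp

lemma \<tau>_id: "\<tau> id = \<one>"
proof -
  have "\<tau> id \<otimes> \<tau> id = \<tau> id" using \<tau>_comp[OF finitary_perms_id finitary_perms_id] by simp
  then show ?thesis using \<tau>_closed[OF finitary_perms_id] by (metis r_cancel_one)
qed

lemma cj_0: "s \<in> S \<Longrightarrow> cj 0 s = s"
  using S_closed by (simp add: cj_def \<tau>_id)

text \<open>Conjugating \<open>p\<close> with two transpositions gives a permutation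
  \<open>q\<close> fixing 0, and \<open>\<tau> q\<close> commutes with \<open>S\<close>. So a
  conjugate depends only on the index to which 0 is sent.\<close>

lemma \<tau>_cj:
  assumes p: "p \<in> finitary_perms" and s: "s \<in> S"
  shows "\<tau> p \<otimes> cj j s = cj (p j) s \<otimes> \<tau> p"
proof -
  let ?a = "Transposition.transpose 0 j" and ?b = "Transposition.transpose 0 (p j)"
  define q where "q = ?b \<circ> p \<circ> ?a"
  have q: "q \<in> finitary_perms" "q 0 = 0"
    unfolding q_def using p finitary_perms_comp finitary_perms_transpose by auto
  have "p = ?b \<circ> q \<circ> ?a" by (simp add: q_def fun_eq_iff)
  then have "\<tau> p = \<tau> (?b \<circ> q \<circ> ?a)" by simp
  also have "\<dots> = \<tau> ?b \<otimes> \<tau> q \<otimes> \<tau> ?a"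
    using q(1) by (simp add: \<tau>_comp finitary_perms_comp finitary_perms_transpose)
  finally have pe: "\<tau> p = \<tau> ?b \<otimes> \<tau> q \<otimes> \<tau> ?a" .
  have cl: "\<tau> ?a \<in> carrier G" "\<tau> ?b \<in> carrier G" "\<tau> q \<in> carrier G" "s \<in> carrier G"
    using \<tau>_closed finitary_perms_transpose q(1) S_closed s by auto
  have "\<tau> ?a \<otimes> \<tau> ?a = \<one>"
    using \<tau>_comp[of ?a ?a] \<tau>_id finitary_perms_transpose by (simp add: comp_def id_def[symmetric])
  then have ia: "inv \<tau> ?a = \<tau> ?a" using cl inv_equality by blast
  have aa: "\<tau> ?a \<otimes> (\<tau> ?a \<otimes> x) = x" if "x \<in> carrier G" for x
    using \<open>\<tau> ?a \<otimes> \<tau> ?a = \<one>\<close> cl that by (metis l_one m_assoc)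
  have bb: "inv \<tau> ?b \<otimes> (\<tau> ?b \<otimes> x) = x" if "x \<in> carrier G" for x
    using cl that by (metis l_inv l_one m_assoc inv_closed)
  have "\<tau> p \<otimes> cj j s = \<tau> ?b \<otimes> (\<tau> q \<otimes> s) \<otimes> \<tau> ?a"
    unfolding pe cj_def ia using cl by (simp add: m_assoc aa)
  also have "\<dots> = \<tau> ?b \<otimes> (s \<otimes> \<tau> q) \<otimes> \<tau> ?a"
    using \<tau>_stabilizer[OF q s] by simp
  also have "\<dots> = cj (p j) s \<otimes> \<tau> p"
    unfolding pe cj_def using cl by (simp add: m_assoc bb)
  finally show ?thesis .
qed

text \<open>The transposition of 0 and \<open>i\<close> reduces the claim to the case where one
  index is 0, which is \<open>conjugates_commute\<close>.\<close>

lemma cj_commute: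
  assumes "i \<noteq> j" and st: "s \<in> S" "t \<in> S"
  shows "cj i s \<otimes> cj j t = cj j t \<otimes> cj i s"
proof -
  let ?a = "Transposition.transpose 0 i"
  define j' where "j' = ?a j"
  have j': "j' \<noteq> 0" "?a j' = j" using assms(1) by (auto simp: j'_def Transposition.transpose_def)
  have cl: "\<tau> ?a \<in> carrier G" using \<tau>_closed finitary_perms_transpose by blast
  have 1: "\<tau> ?a \<otimes> s = cj i s \<otimes> \<tau> ?a"
    using \<tau>_cj[OF finitary_perms_transpose st(1), of 0 i 0] cj_0[OF st(1)] by simp
  have 2: "\<tau> ?a \<otimes> cj j' t = cj j t \<otimes> \<tau> ?a"
    using \<tau>_cj[OF finitary_perms_transpose st(2), of 0 i j'] j'(2) by simp
  have c: "s \<otimes> cj j' t = cj j' t \<otimes> s"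
    using conjugates_commute[OF j'(1) st] by (simp add: cj_def)
  note cls = cl cj_closed[OF st(1)] cj_closed[OF st(2)] S_closed[OF st(1)]
  have "cj i s \<otimes> cj j t \<otimes> \<tau> ?a = \<tau> ?a \<otimes> (s \<otimes> cj j' t)"
    using cls 1 2 by (simp add: m_assoc[symmetric]) (simp add: m_assoc)
  also have "\<dots> = cj j t \<otimes> cj i s \<otimes> \<tau> ?a"
    unfolding c using cls 1 2 by (simp add: m_assoc[symmetric]) (simp add: m_assoc)
  finally show ?thesis using cls by (simp add: m_closed)
qed

fun cj_prod :: "(nat \<times> 'g) list \<Rightarrow> 'g" where
  "cj_prod [] = \<one>"
| "cj_prod ((j, s) # ps) = cj j s \<otimes> cj_prod ps"

lemma cj_prod_closed: "snd ` set ps \<subseteq> S \<Longrightarrow> cj_prod ps \<in> carrier G"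
  by (induction ps rule: cj_prod.induct) (auto simp: cj_closed)

lemma cj_prod_Cons_middle:
  assumes "snd ` set (ps @ (j, s) # qs) \<subseteq> S" "j \<notin> fst ` set ps"
  shows "cj_prod (ps @ (j, s) # qs) = cj j s \<otimes> cj_prod (ps @ qs)"
  using assms
proof (induction ps rule: cj_prod.induct)
  case (2 i t ps)
  then have "cj i t \<otimes> (cj j s \<otimes> cj_prod (ps @ qs)) = cj j s \<otimes> (cj i t \<otimes> cj_prod (ps @ qs))"
    using cj_commute[of i j t s] cj_closed cj_prod_closed[of "ps @ qs"]
    by (simp add: image_Un flip: m_assoc)
  with 2 show ?case by simp
qed simp

text \<open>Letters with equal index need not commute, hence the distinctness assumption. The lemma
  frees \<open>block_prod\<close> from the order of its sorted list.\<close>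

lemma cj_prod_mset_eq:
  assumes "mset ps = mset qs" "distinct (map fst ps)" "snd ` set ps \<subseteq> S"
  shows "cj_prod ps = cj_prod qs"
  using assms
proof (induction ps arbitrary: qs)
  case (Cons x ps)
  obtain j s where x: "x = (j, s)" by (cases x)
  have "x \<in> set qs" using Cons.prems(1) by (metis list.set_intros(1) mset_eq_setD)
  then obtain qs1 qs2 where qs: "qs = qs1 @ x # qs2" by (meson split_list)
  have "mset ps = mset (qs1 @ qs2)" using Cons.prems(1) by (simp add: qs)
  then have IH: "cj_prod ps = cj_prod (qs1 @ qs2)" using Cons.IH Cons.prems by simp
  have "set ps = set (qs1 @ qs2)" using \<open>mset ps = mset (qs1 @ qs2)\<close> mset_eq_setD by blast
  moreover have "set (x # ps) = set qs" using Cons.prems(1) mset_eq_setD by blast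
  ultimately show ?case
    unfolding qs x using Cons.prems cj_prod_Cons_middle[of qs1 j s qs2] IH
    by (auto simp: x qs image_Un)
qed simp

lemma \<tau>_cj_prod:
  assumes "p \<in> finitary_perms" "snd ` set ps \<subseteq> S"
  shows "\<tau> p \<otimes> cj_prod ps = cj_prod (map (\<lambda>(i, s). (p i, s)) ps) \<otimes> \<tau> p"
  using assms(2)
proof (induction ps rule: cj_prod.induct)
  case 1
  then show ?case using \<tau>_closed[OF assms(1)] by simp
next
  case (2 j s ps)
  have "y \<in> S" if "(x, y) \<in> set ps" for x y using 2(2) that by force
  then have cl: "\<tau> p \<in> carrier G" "cj j s \<in> carrier G" "cj (p j) s \<in> carrier G"
    "cj_prod ps \<in> carrier G" "cj_prod (map (\<lambda>(i, s). (p i, s)) ps) \<in> carrier G"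
    using 2 assms(1) by (auto simp: image_subset_iff intro!: \<tau>_closed cj_closed cj_prod_closed)
  have "\<tau> p \<otimes> cj_prod ((j, s) # ps) = (\<tau> p \<otimes> cj j s) \<otimes> cj_prod ps"
    using cl by (simp add: m_assoc)
  also have "\<dots> = (cj (p j) s \<otimes> \<tau> p) \<otimes> cj_prod ps"
    using \<tau>_cj[OF assms(1), of s j] 2 by simp
  also have "\<dots> = cj (p j) s \<otimes> (\<tau> p \<otimes> cj_prod ps)"
    using cl by (simp add: m_assoc)
  also have "\<tau> p \<otimes> cj_prod ps = cj_prod (map (\<lambda>(i, s). (p i, s)) ps) \<otimes> \<tau> p"
    using 2 by simp
  finally show ?case using cl by (simp add: m_assoc)
qed

definition block_prod :: "nat set \<Rightarrow> (nat \<Rightarrow> 'g) \<Rightarrow> 'g"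
  where "block_prod I u = cj_prod (map (\<lambda>j. (j, u j)) (sorted_list_of_set I))"

lemma block_prod_closed: "finite I \<Longrightarrow> (\<And>i. i \<in> I \<Longrightarrow> u i \<in> S) \<Longrightarrow> block_prod I u \<in> carrier G"
  unfolding block_prod_def by (rule cj_prod_closed) auto

text \<open>Index 0 comes first in the sorted list and its conjugation is trivial; this later lets
  an argument from \<open>S\<close> play the letter of block 0.\<close>

lemma block_prod_0:
  assumes "u 0 \<in> S"
  shows "0 < N \<Longrightarrow> block_prod {..<N} u = u 0 \<otimes> block_prod {1..<N} u"
  using assms unfolding block_prod_def lessThan_atLeast0 sorted_list_of_set_range
  by (subst upt_rec) (simp add: cj_0)

text \<open>The source of equivariance: moving \<open>\<tau> p\<close> through the product renames
  the indices, and the permuted product can be sorted back because its factors commute.\<close>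

lemma \<tau>_block_prod:
  assumes p: "p permutes {..<N}" and u: "\<And>i. i < N \<Longrightarrow> u i \<in> S"
  shows "\<tau> p \<otimes> block_prod {..<N} (u \<circ> p) = block_prod {..<N} u \<otimes> \<tau> p"
proof -
  have pf: "p \<in> finitary_perms" using p by (auto simp: finitary_perms_def)
  let ?js = "sorted_list_of_set {..<N}"
  have js: "set ?js = {..<N}" "distinct ?js" by auto
  have pN: "\<And>j. j < N \<Longrightarrow> p j < N" using permutes_in_image[OF p] by auto
  have "mset (map p ?js) = mset ?js"
  proof -
    have "mset (map p ?js) = image_mset p (mset_set {..<N})" by (metis js mset_map mset_set_set)
    also have "\<dots> = mset_set {..<N}"
      using p by (simp add: image_mset_mset_set permutes_inj_on permutes_image)
    finally show ?thesis using js by (metis mset_set_set)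
  qed
  then have "image_mset (\<lambda>j. (j, u j)) (mset (map p ?js)) = image_mset (\<lambda>j. (j, u j)) (mset ?js)"
    by simp
  then have m: "mset (map (\<lambda>j. (p j, u (p j))) ?js) = mset (map (\<lambda>j. (j, u j)) ?js)"
    by (simp add: comp_def image_mset.compositionality)
  have "\<tau> p \<otimes> block_prod {..<N} (u \<circ> p) = cj_prod (map (\<lambda>j. (p j, u (p j))) ?js) \<otimes> \<tau> p"
    unfolding block_prod_def using u pN js by (subst \<tau>_cj_prod[OF pf]) (auto simp: comp_def)
  also have "cj_prod (map (\<lambda>j. (p j, u (p j))) ?js) = cj_prod (map (\<lambda>j. (j, u j)) ?js)"
  proof (rule cj_prod_mset_eq[OF m])
    show "distinct (map fst (map (\<lambda>j. (p j, u (p j))) ?js))"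
      using js p by (simp add: comp_def distinct_map permutes_inj_on)
    show "snd ` set (map (\<lambda>j. (p j, u (p j))) ?js) \<subseteq> S" using u pN js by auto
  qed
  finally show ?thesis by (simp add: block_prod_def)
qed

end

section \<open>Averaging a cocycle over commuting conjugates\<close>

lemma map2_map_left: "map2 z (map h gs) ws = map2 (\<lambda>g w. z (h g) w) gs ws"
  by (simp add: map_zip_map case_prod_unfold)

lemma avg_swap: "avg A (\<lambda>a. avg B (f a)) = avg B (\<lambda>b. avg A (\<lambda>a. f a b))"
  unfolding avg_def scaleR_sum_right[symmetric] by (subst sum.swap) (simp add: mult.commute)

text \<open>Transposition of a matrix: letters grouped by argument are regrouped by block. The
  restriction to \<open>I\<close> supplies the value \<open>undefined\<close> elsewhere that
  \<open>PiE\<close> demands.\<close>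

lemma avg_transpose_words:
  "avg (words_of_length (PiE I (\<lambda>_. S)) n) F
   = avg (PiE I (\<lambda>_. words_of_length S n)) (\<lambda>u. F (map (\<lambda>i. \<lambda>j\<in>I. u j ! i) [0..<n]))"
proof (rule avg_bij_betw, rule bij_betw_byWitness[where f' = "\<lambda>ws. \<lambda>j\<in>I. map (\<lambda>w. w j) ws"])
  show "\<forall>u\<in>PiE I (\<lambda>_. words_of_length S n).
      (\<lambda>j\<in>I. map (\<lambda>w. w j) (map (\<lambda>i. \<lambda>j\<in>I. u j ! i) [0..<n])) = u"
  proof
    fix u assume u: "u \<in> PiE I (\<lambda>_. words_of_length S n)"
    show "(\<lambda>j\<in>I. map (\<lambda>w. w j) (map (\<lambda>i. \<lambda>j\<in>I. u j ! i) [0..<n])) = u"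
    proof
      fix j
      show "(\<lambda>j\<in>I. map (\<lambda>w. w j) (map (\<lambda>i. \<lambda>j\<in>I. u j ! i) [0..<n])) j = u j"
      proof (cases "j \<in> I")
        case True
        then have "length (u j) = n" using u by (auto simp: words_of_length_def PiE_iff)
        then show ?thesis using True by (auto intro!: nth_equalityI)
      next
        case False
        then show ?thesis using u by (auto simp: PiE_iff extensional_def)
      qed
    qed
  qed
  show "\<forall>ws\<in>words_of_length (PiE I (\<lambda>_. S)) n.
      map (\<lambda>i. \<lambda>j\<in>I. (\<lambda>j\<in>I. map (\<lambda>w. w j) ws) j ! i) [0..<n] = ws"
  proof
    fix ws assume ws: "ws \<in> words_of_length (PiE I (\<lambda>_. S)) n"
    show "map (\<lambda>i. \<lambda>j\<in>I. (\<lambda>j\<in>I. map (\<lambda>w. w j) ws) j ! i) [0..<n] = ws"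
    proof (rule nth_equalityI)
      fix i assume i: "i < length (map (\<lambda>i. \<lambda>j\<in>I. (\<lambda>j\<in>I. map (\<lambda>w. w j) ws) j ! i) [0..<n])"
      then have "i < length ws" and ws': "set ws \<subseteq> PiE I (\<lambda>_. S)" "length ws = n"
        using ws by (auto simp: words_of_length_def)
      then have "ws ! i \<in> PiE I (\<lambda>_. S)" using nth_mem by blast
      then show "map (\<lambda>i. \<lambda>j\<in>I. (\<lambda>j\<in>I. map (\<lambda>w. w j) ws) j ! i) [0..<n] ! i = ws ! i"
        using i ws'(2) by (auto simp: PiE_iff extensional_def fun_eq_iff restrict_def)
    qed (use ws in \<open>simp add: words_of_length_def\<close>)
  qed
  show "(\<lambda>u. map (\<lambda>i. \<lambda>j\<in>I. u j ! i) [0..<n]) ` PiE I (\<lambda>_. words_of_length S n)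
      \<subseteq> words_of_length (PiE I (\<lambda>_. S)) n"
    by (fastforce simp: words_of_length_def PiE_iff extensional_def subset_iff)
  show "(\<lambda>ws. \<lambda>j\<in>I. map (\<lambda>w. w j) ws) ` words_of_length (PiE I (\<lambda>_. S)) n
      \<subseteq> PiE I (\<lambda>_. words_of_length S n)"
    by (fastforce simp: words_of_length_def PiE_iff subset_iff)
qed

text \<open>Only the value \<open>z\<close> at index 0 survives, and its factor
  \<open>card Y\<close> cancels the uniform weight. The update in \<open>u(0 := z)\<close> fills the
  index absent from \<open>{1..<N}\<close>.\<close>

lemma avg_cylinder_conditioning:
  fixes h :: "(nat \<Rightarrow> 'y) \<Rightarrow> 'e::real_vector"
  assumes Y: "finite Y" "z \<in> Y" and N: "0 < N"
  shows "avg (PiE {..<N} (\<lambda>_. Y)) (\<lambda>u. cylinder_density Y {0} (\<lambda>_. z) u *\<^sub>R h u)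
    = avg (PiE {1..<N} (\<lambda>_. Y)) (\<lambda>u. h (u(0 := z)))"
proof -
  have I: "{..<N} = insert 0 {1..<N}" using N by auto
  have b: "bij_betw (\<lambda>(y, u). u(0 := y)) (Y \<times> PiE {1..<N} (\<lambda>_. Y)) (PiE {..<N} (\<lambda>_. Y))"
    unfolding bij_betw_def I PiE_insert_eq using inj_combinator[of 0 "{1..<N}" "\<lambda>_. Y"] by auto
  have "avg (PiE {..<N} (\<lambda>_. Y)) (\<lambda>u. cylinder_density Y {0} (\<lambda>_. z) u *\<^sub>R h u)
    = avg (Y \<times> PiE {1..<N} (\<lambda>_. Y)) (\<lambda>(y, u). (if y = z then real (card Y) else 0) *\<^sub>R h (u(0 := y)))"
    by (subst avg_bij_betw[OF b]) (auto simp: cylinder_density_def intro!: avg_cong)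
  also have "\<dots> = avg Y (\<lambda>y. if y = z then real (card Y) *\<^sub>R avg (PiE {1..<N} (\<lambda>_. Y)) (\<lambda>u. h (u(0 := z))) else 0)"
    unfolding avg_Times
  proof (rule avg_cong)
    fix y
    show "avg (PiE {1..<N} (\<lambda>_. Y)) (\<lambda>u. (if y = z then real (card Y) else 0) *\<^sub>R h (u(0 := y)))
      = (if y = z then real (card Y) *\<^sub>R avg (PiE {1..<N} (\<lambda>_. Y)) (\<lambda>u. h (u(0 := z))) else 0)"
      by (cases "y = z") (simp_all add: avg_scaleR, simp add: avg_def)
  qed
  also have "\<dots> = avg (PiE {1..<N} (\<lambda>_. Y)) (\<lambda>u. h (u(0 := z)))"
    unfolding avg_def[of Y] using Y card_gt_0_iff[of Y] by (auto simp: sum.delta)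
  finally show ?thesis .
qed

text \<open>A cocycle of degree \<open>k\<close> on lists of \<open>k + 1\<close> elements. The
  bound can be asked for all lists because cochains vanish off the tuples, and \<open>\<rho>\<close>
  enters as the predual adjoint that makes \<open>\<pi>\<close> weak-* continuous.\<close>

locale bounded_cocycle = group G + dual_space T
  for G (structure) and T :: "'e::banach \<Rightarrow> 'f::banach \<Rightarrow>\<^sub>L real" +
  fixes \<pi> :: "'g \<Rightarrow> 'e \<Rightarrow> 'e" and \<rho> :: "'g \<Rightarrow> 'f \<Rightarrow> 'f" and k :: nat and c :: "'g list \<Rightarrow> 'e" and C :: real
  assumes linear_\<pi>: "g \<in> carrier G \<Longrightarrow> linear (\<pi> g)"
    and norm_\<pi>: "g \<in> carrier G \<Longrightarrow> norm (\<pi> g x) = norm x"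
    and pair_\<pi>: "g \<in> carrier G \<Longrightarrow> pair (\<pi> g x) v = pair x (\<rho> (inv g) v)"
    and separable: "separable_space (euclidean :: 'e topology)"
    and norm_c: "norm (c xs) \<le> C"
    and c_translate: "g \<in> carrier G \<Longrightarrow> set xs \<subseteq> carrier G \<Longrightarrow> length xs = Suc k \<Longrightarrow>
      c (map ((\<otimes>) g) xs) = \<pi> g (c xs)"
    and cocycle: "set xs \<subseteq> carrier G \<Longrightarrow> length xs = Suc (Suc k) \<Longrightarrow> list_coboundary c xs = 0"
begin

lemma C_nonneg: "0 \<le> C"
  using norm_c[of "[]"] norm_ge_zero order_trans by blast

lemma prism_translate:
  assumes "g \<in> carrier G" "set (map fst zs) \<subseteq> carrier G" "set (map snd zs) \<subseteq> carrier G" "length zs = k"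
  shows "prism c (map (map_prod ((\<otimes>) g) ((\<otimes>) g)) zs) = \<pi> g (prism c zs)"
  unfolding prism_map prism_linear[OF linear_\<pi>[OF assms(1)]]
  by (rule prism_cong) (use assms in \<open>auto intro!: c_translate\<close>)

end

locale cocycle_and_conjugates = bounded_cocycle G T \<pi> \<rho> k c C + commuting_conjugates G S \<tau>
  for G (structure) and T :: "'e::banach \<Rightarrow> 'f::banach \<Rightarrow>\<^sub>L real" and \<pi> :: "'g \<Rightarrow> 'e \<Rightarrow> 'e" and \<rho> k c C S \<tau> +
  fixes U :: "nat filter"
  assumes finite_S: "finite S" and S_nonempty: "S \<noteq> {}"
    and U: "ultrafilter U" "U \<le> sequentially"
begin

definition perms :: "nat \<Rightarrow> (nat \<Rightarrow> nat) set" where "perms N = {p. p permutes {..<N}}"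

definition \<Omega> :: "nat \<Rightarrow> (nat \<Rightarrow> 'g) set" where "\<Omega> N = PiE {1..<N} (\<lambda>_. S)"

text \<open>Block 0 is left empty, to be filled by the arguments themselves when these lie in
  \<open>S\<close>.\<close>

definition X :: "nat \<Rightarrow> (nat \<Rightarrow> nat) \<Rightarrow> (nat \<Rightarrow> 'g) \<Rightarrow> 'g"
  where "X N p \<omega> = block_prod {1..<N} \<omega> \<otimes> \<tau> p"

text \<open>The prism joins each argument to its random translate. The default 0 makes the norm
  bound hold for every list, as the weak-* limit requires.\<close>

definition b :: "nat \<Rightarrow> 'g list \<Rightarrow> 'e"
  where "b N gs = (if set gs \<subseteq> carrier G \<and> length gs = k
     then avg (perms N) (\<lambda>p. smear (\<Omega> N) (\<lambda>g \<omega>. (g, g \<otimes> X N p \<omega>)) (prism c) gs) else 0)"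

definition c' :: "nat \<Rightarrow> 'g list \<Rightarrow> 'e"
  where "c' N gs = avg (perms N) (\<lambda>p. smear (\<Omega> N) (\<lambda>g \<omega>. g \<otimes> X N p \<omega>) c gs)"

lemma finite_perms: "finite (perms N)" and perms_nonempty: "perms N \<noteq> {}"
  unfolding perms_def using finite_permutations[of "{..<N}"] permutes_id[of "{..<N}"] by blast+

lemma finite_\<Omega>: "finite (\<Omega> N)" and \<Omega>_nonempty: "\<Omega> N \<noteq> {}"
  unfolding \<Omega>_def using finite_S S_nonempty by (auto intro!: finite_PiE simp: PiE_eq_empty_iff)

lemma perms_finitary: "p \<in> perms N \<Longrightarrow> p \<in> finitary_perms"
  by (auto simp: perms_def finitary_perms_def)

lemma X_closed: "p \<in> perms N \<Longrightarrow> \<omega> \<in> \<Omega> N \<Longrightarrow> X N p \<omega> \<in> carrier G"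
  unfolding X_def \<Omega>_def by (intro m_closed block_prod_closed \<tau>_closed) (auto dest: perms_finitary)

lemma norm_b_le: "norm (b N gs) \<le> k * C"
proof (cases "set gs \<subseteq> carrier G \<and> length gs = k")
  case True
  have "norm (smear (\<Omega> N) (\<lambda>g \<omega>. (g, g \<otimes> X N p \<omega>)) (prism c) gs) \<le> k * C" for p
    unfolding smear_def
  proof (rule norm_avg_le)
    fix ws assume "ws \<in> words_of_length (\<Omega> N) (length gs)"
    then have "length (map2 (\<lambda>g \<omega>. (g, g \<otimes> X N p \<omega>)) gs ws) = k"
      using True by (simp add: words_of_length_def)
    with norm_prism_le[of "map2 (\<lambda>g \<omega>. (g, g \<otimes> X N p \<omega>)) gs ws" c C, OF norm_c]
    show "norm (prism c (map2 (\<lambda>g \<omega>. (g, g \<otimes> X N p \<omega>)) gs ws)) \<le> k * C"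
      by simp
  qed (simp_all add: finite_\<Omega> \<Omega>_nonempty)
  then show ?thesis
    using True unfolding b_def by (auto intro!: norm_avg_le finite_perms perms_nonempty)
next
  case False
  then show ?thesis using C_nonneg by (auto simp: b_def)
qed

lemma norm_c'_le: "norm (c' N gs) \<le> C"
  unfolding c'_def smear_def
  by (intro norm_avg_le finite_perms perms_nonempty finite_words_of_length words_of_length_nonempty
      finite_\<Omega> \<Omega>_nonempty norm_c)

text \<open>Translation acts from the left and randomisation from the right, so they commute; the
  distribution of \<open>X\<close> does not depend on the arguments.\<close>

lemma b_translate:
  assumes g: "g \<in> carrier G" and gs: "set gs \<subseteq> carrier G" "length gs = k"
  shows "b N (map ((\<otimes>) g) gs) = \<pi> g (b N gs)"
proof -
  have *: "prism c (map2 (\<lambda>x \<omega>. (g \<otimes> x, g \<otimes> x \<otimes> X N p \<omega>)) gs ws)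
      = \<pi> g (prism c (map2 (\<lambda>x \<omega>. (x, x \<otimes> X N p \<omega>)) gs ws))"
    if p: "p \<in> perms N" and ws: "ws \<in> words_of_length (\<Omega> N) k" for p ws
  proof -
    have zs: "x \<in> carrier G" "X N p \<omega> \<in> carrier G" if "(x, \<omega>) \<in> set (zip gs ws)" for x \<omega>
      using set_zip_leftD[OF that] set_zip_rightD[OF that] gs ws X_closed[OF p]
      by (auto simp: words_of_length_def)
    have "map2 (\<lambda>x \<omega>. (g \<otimes> x, g \<otimes> x \<otimes> X N p \<omega>)) gs ws
        = map (map_prod ((\<otimes>) g) ((\<otimes>) g)) (map2 (\<lambda>x \<omega>. (x, x \<otimes> X N p \<omega>)) gs ws)"
      using zs g by (auto simp: m_assoc)
    also have "prism c \<dots> = \<pi> g (prism c (map2 (\<lambda>x \<omega>. (x, x \<otimes> X N p \<omega>)) gs ws))"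
    proof (rule prism_translate[OF g])
      show "set (map fst (map2 (\<lambda>x \<omega>. (x, x \<otimes> X N p \<omega>)) gs ws)) \<subseteq> carrier G"
        using zs by auto
      show "set (map snd (map2 (\<lambda>x \<omega>. (x, x \<otimes> X N p \<omega>)) gs ws)) \<subseteq> carrier G"
        using zs by auto
      show "length (map2 (\<lambda>x \<omega>. (x, x \<otimes> X N p \<omega>)) gs ws) = k"
        using gs ws by (simp add: words_of_length_def)
    qed
    finally show ?thesis .
  qed
  have "set (map ((\<otimes>) g) gs) \<subseteq> carrier G" using g gs by auto
  then show ?thesis
    using gs * unfolding b_def smear_def
    by (auto simp: map2_map_left avg_linear[OF linear_\<pi>[OF g]] intro!: avg_cong)
qed

lemma coboundary_b:
  assumes gs: "set gs \<subseteq> carrier G" "length gs = Suc k"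
  shows "list_coboundary (b N) gs = c' N gs - c gs"
proof -
  have "list_coboundary (b N) gs
      = list_coboundary (\<lambda>l. avg (perms N) (\<lambda>p. smear (\<Omega> N) (\<lambda>g \<omega>. (g, g \<otimes> X N p \<omega>)) (prism c) l)) gs"
    by (rule list_coboundary_cong) (use gs in \<open>auto simp: b_def\<close>)
  also have "\<dots> = avg (perms N) (\<lambda>p. smear (\<Omega> N) (\<lambda>g \<omega>. (g, g \<otimes> X N p \<omega>)) (list_coboundary (prism c)) gs)"
    by (simp add: list_coboundary_avg list_coboundary_smear finite_\<Omega> \<Omega>_nonempty)
  also have "\<dots> = avg (perms N) (\<lambda>p. smear (\<Omega> N) (\<lambda>g \<omega>. g \<otimes> X N p \<omega>) c gs - c gs)"
  proof (rule avg_cong)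
    fix p assume p: "p \<in> perms N"
    have "smear (\<Omega> N) (\<lambda>g \<omega>. (g, g \<otimes> X N p \<omega>)) (list_coboundary (prism c)) gs
      = avg (words_of_length (\<Omega> N) (length gs)) (\<lambda>ws. c (map2 (\<lambda>g \<omega>. g \<otimes> X N p \<omega>) gs ws) - c gs)"
      unfolding smear_def
    proof (rule avg_cong)
      fix ws assume ws: "ws \<in> words_of_length (\<Omega> N) (length gs)"
      let ?zs = "map2 (\<lambda>g \<omega>. (g, g \<otimes> X N p \<omega>)) gs ws"
      have zs: "x \<in> carrier G" "X N p \<omega> \<in> carrier G" if "(x, \<omega>) \<in> set (zip gs ws)" for x \<omega>
        using set_zip_leftD[OF that] set_zip_rightD[OF that] gs ws X_closed[OF p]
        by (auto simp: words_of_length_def)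
      \<comment> \<open>The cocycle identity removes the first term of the homotopy formula, leaving
        the difference of the end points.\<close>
      have "prism (list_coboundary c) ?zs = 0"
        by (rule prism_zero, rule cocycle) (use gs ws zs in \<open>auto simp: words_of_length_def\<close>)
      moreover have "?zs \<noteq> []" using gs ws by (auto simp: words_of_length_def)
      moreover have "map fst ?zs = gs" "map snd ?zs = map2 (\<lambda>g \<omega>. g \<otimes> X N p \<omega>) gs ws"
        using gs ws by (auto simp: words_of_length_def comp_def case_prod_unfold map_fst_zip)
      ultimately show "list_coboundary (prism c) ?zs = c (map2 (\<lambda>g \<omega>. g \<otimes> X N p \<omega>) gs ws) - c gs"
        using prism_homotopy[of c ?zs] by simp
    qed
    then show "smear (\<Omega> N) (\<lambda>g \<omega>. (g, g \<otimes> X N p \<omega>)) (list_coboundary (prism c)) gs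
        = smear (\<Omega> N) (\<lambda>g \<omega>. g \<otimes> X N p \<omega>) c gs - c gs"
      by (simp add: avg_diff avg_const smear_def finite_\<Omega> \<Omega>_nonempty)
  qed
  also have "\<dots> = c' N gs - c gs"
    by (simp add: avg_diff avg_const c'_def finite_perms perms_nonempty)
  finally show ?thesis .
qed

text \<open>Here \<open>u j ! i\<close> is the letter of block \<open>j\<close> in argument
  \<open>i\<close>. Grouping letters by block turns a permutation of blocks into a permutation of
  the coordinates of \<open>u\<close>.\<close>

definition f :: "nat \<Rightarrow> (nat \<Rightarrow> 'g list) \<Rightarrow> 'e"
  where "f N u = avg (perms N) (\<lambda>p. c (map (\<lambda>i. block_prod {..<N} (\<lambda>j. u j ! i) \<otimes> \<tau> p) [0..<Suc k]))"

abbreviation "Y \<equiv> words_of_length S (Suc k)"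

lemma nth_Y: "y \<in> Y \<Longrightarrow> i \<le> k \<Longrightarrow> y ! i \<in> S"
  unfolding words_of_length_def using nth_mem by fastforce

text \<open>Left multiplication by \<open>y ! i\<close> fills the block missing from
  \<open>X\<close> in argument \<open>i\<close>. So averaging over the other blocks is averaging
  over all blocks under the condition that block 0 has the value \<open>y\<close>.\<close>

lemma c'_eq:
  assumes N: "0 < N" and y: "y \<in> Y"
  shows "c' N y = avg (PiE {..<N} (\<lambda>_. Y)) (\<lambda>u. cylinder_density Y {0} (\<lambda>_. y) u *\<^sub>R f N u)"
proof -
  have ly: "length y = Suc k" using y by (simp add: words_of_length_def)
  have "avg (PiE {..<N} (\<lambda>_. Y)) (\<lambda>u. cylinder_density Y {0} (\<lambda>_. y) u *\<^sub>R f N u)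
      = avg (PiE {1..<N} (\<lambda>_. Y)) (\<lambda>u. f N (u(0 := y)))"
    by (rule avg_cylinder_conditioning) (use finite_S N y in auto)
  also have "\<dots> = avg (PiE {1..<N} (\<lambda>_. Y)) (\<lambda>u. avg (perms N) (\<lambda>p.
      c (map2 (\<lambda>g \<omega>. g \<otimes> X N p \<omega>) y (map (\<lambda>i. \<lambda>j\<in>{1..<N}. u j ! i) [0..<Suc k]))))"
    unfolding f_def
  proof (intro avg_cong arg_cong[where f = c])
    fix u p assume u: "u \<in> PiE {1..<N} (\<lambda>_. Y)" and p: "p \<in> perms N"
    show "map (\<lambda>i. block_prod {..<N} (\<lambda>j. (u(0 := y)) j ! i) \<otimes> \<tau> p) [0..<Suc k]
        = map2 (\<lambda>g \<omega>. g \<otimes> X N p \<omega>) y (map (\<lambda>i. \<lambda>j\<in>{1..<N}. u j ! i) [0..<Suc k])"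
    proof (rule nth_equalityI)
      fix i assume "i < length (map (\<lambda>i. block_prod {..<N} (\<lambda>j. (u(0 := y)) j ! i) \<otimes> \<tau> p) [0..<Suc k])"
      then have i: "i < Suc k" by simp
      have uS: "u j ! i \<in> S" if "j \<in> {1..<N}" for j
        using u that nth_Y i by (auto simp: PiE_iff)
      have yS: "y ! i \<in> S" using nth_Y y i by simp
      have eq: "block_prod {1..<N} (\<lambda>j. (u(0 := y)) j ! i) = block_prod {1..<N} (\<lambda>j\<in>{1..<N}. u j ! i)"
        unfolding block_prod_def by (intro arg_cong[where f = cj_prod] map_cong) auto
      have "block_prod {1..<N} (\<lambda>j\<in>{1..<N}. u j ! i) \<in> carrier G"
        using uS by (intro block_prod_closed) auto
      then have "block_prod {..<N} (\<lambda>j. (u(0 := y)) j ! i) \<otimes> \<tau> p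
          = y ! i \<otimes> X N p (\<lambda>j\<in>{1..<N}. u j ! i)"
        using block_prod_0[OF _ N, of "\<lambda>j. (u(0 := y)) j ! i"] yS eq S_closed \<tau>_closed[OF perms_finitary[OF p]]
        by (simp add: X_def m_assoc)
      then show "map (\<lambda>i. block_prod {..<N} (\<lambda>j. (u(0 := y)) j ! i) \<otimes> \<tau> p) [0..<Suc k] ! i
          = map2 (\<lambda>g \<omega>. g \<otimes> X N p \<omega>) y (map (\<lambda>i. \<lambda>j\<in>{1..<N}. u j ! i) [0..<Suc k]) ! i"
        using i ly by (simp del: upt_Suc)
    qed (simp add: ly)
  qed
  also have "\<dots> = avg (words_of_length (\<Omega> N) (Suc k)) (\<lambda>ws. avg (perms N) (\<lambda>p.
      c (map2 (\<lambda>g \<omega>. g \<otimes> X N p \<omega>) y ws)))"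
    unfolding \<Omega>_def by (rule avg_transpose_words[symmetric])
  also have "\<dots> = c' N y"
    unfolding c'_def smear_def ly by (rule avg_swap)
  finally show ?thesis by simp
qed

text \<open>Permuting blocks multiplies every product by \<open>inv (\<tau> p)\<close> on the left
  and \<open>\<tau> p\<close> on the right. The left factor is common to all arguments and leaves
  \<open>c\<close> by \<open>c_translate\<close>; the right factor disappears when
  \<open>p \<circ> q\<close> is substituted in the average over permutations.\<close>

sublocale equivariant_family T Y f C "\<lambda>p. \<pi> (inv (\<tau> p))" "\<lambda>p. \<rho> (\<tau> p)" U
proof
  show "finite Y" "Y \<noteq> {}" using finite_S S_nonempty by auto
  show "ultrafilter U" "U \<le> sequentially" using U by auto
  show "separable_space (euclidean :: 'e topology)" using separable .
  show "norm (f N u) \<le> C" for N u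
    unfolding f_def by (rule norm_avg_le[OF norm_c finite_perms perms_nonempty])
  show "norm (\<pi> (inv (\<tau> p)) x) = norm x" if "p \<in> finitary_perms" for p x
    using norm_\<pi> \<tau>_closed[OF that] by simp
  show "pair (\<pi> (inv (\<tau> p)) x) v = pair x (\<rho> (\<tau> p) v)" if "p \<in> finitary_perms" for p x v
    using pair_\<pi>[of "inv (\<tau> p)"] \<tau>_closed[OF that] by simp
next
  fix N :: nat and u p assume p: "p permutes {..<N}" and u: "u \<in> PiE {..<N} (\<lambda>_. Y)"
  have pf: "p \<in> finitary_perms" using p by (auto simp: finitary_perms_def)
  have cl: "\<tau> p \<in> carrier G" using \<tau>_closed[OF pf] .
  have uS: "u j ! i \<in> S" if "j < N" "i \<le> k" for i j
    using u nth_Y that by (auto simp: PiE_iff)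
  have up: "block_prod {..<N} (\<lambda>j. (u \<circ> p) j ! i) = inv (\<tau> p) \<otimes> (block_prod {..<N} (\<lambda>j. u j ! i) \<otimes> \<tau> p)"
    if i: "i \<le> k" for i
  proof -
    have B': "block_prod {..<N} (\<lambda>j. (u \<circ> p) j ! i) \<in> carrier G"
      using uS[OF _ i] permutes_in_image[OF p] by (intro block_prod_closed) auto
    have "\<tau> p \<otimes> block_prod {..<N} (\<lambda>j. (u \<circ> p) j ! i) = block_prod {..<N} (\<lambda>j. u j ! i) \<otimes> \<tau> p"
      using \<tau>_block_prod[OF p, of "\<lambda>j. u j ! i"] uS[OF _ i] by (simp add: comp_def)
    from arg_cong[OF this, of "\<lambda>x. inv (\<tau> p) \<otimes> x"] show ?thesis
      using B' cl by (simp add: m_assoc[symmetric])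
  qed
  have bij: "bij_betw (\<lambda>q. p \<circ> q) (perms N) (perms N)"
    by (rule bij_betw_byWitness[where f' = "\<lambda>q. Hilbert_Choice.inv p \<circ> q"])
      (use p permutes_inv[OF p] permutes_compose in
        \<open>auto simp: perms_def permutes_inv_o[OF p] simp flip: comp_assoc\<close>)
  have "f N (u \<circ> p) = avg (perms N) (\<lambda>q. \<pi> (inv (\<tau> p))
      (c (map (\<lambda>i. block_prod {..<N} (\<lambda>j. u j ! i) \<otimes> \<tau> (p \<circ> q)) [0..<Suc k])))"
    unfolding f_def
  proof (rule avg_cong)
    fix q assume q: "q \<in> perms N"
    have qf: "q \<in> finitary_perms" using perms_finitary[OF q] .
    let ?xs = "map (\<lambda>i. block_prod {..<N} (\<lambda>j. u j ! i) \<otimes> \<tau> (p \<circ> q)) [0..<Suc k]"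
    have B: "block_prod {..<N} (\<lambda>j. u j ! i) \<in> carrier G" if "i \<le> k" for i
      using uS[OF _ that] by (intro block_prod_closed) auto
    have "map (\<lambda>i. block_prod {..<N} (\<lambda>j. (u \<circ> p) j ! i) \<otimes> \<tau> q) [0..<Suc k] = map ((\<otimes>) (inv (\<tau> p))) ?xs"
      using B cl \<tau>_closed[OF qf]
      by (auto simp: up[unfolded comp_apply] less_Suc_eq_le \<tau>_comp[OF pf qf] m_assoc simp del: upt_Suc)
    then show "c (map (\<lambda>i. block_prod {..<N} (\<lambda>j. (u \<circ> p) j ! i) \<otimes> \<tau> q) [0..<Suc k])
        = \<pi> (inv (\<tau> p)) (c ?xs)"
      using B cl \<tau>_closed[OF finitary_perms_comp[OF pf qf]]
      by (simp only:) (rule c_translate, auto simp del: upt_Suc)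
  qed
  also have "\<dots> = \<pi> (inv (\<tau> p)) (f N u)"
    unfolding f_def avg_linear[OF linear_\<pi>[OF inv_closed[OF cl]], symmetric]
    using avg_bij_betw[OF bij, symmetric] by (rule arg_cong)
  finally show "f N (u \<circ> p) = \<pi> (inv (\<tau> p)) (f N u)" .
qed

lemma wlim_c':
  assumes "y \<in> Y"
  shows "wlim U (\<lambda>N. c' N y) = m (\<lambda>_. 1)"
proof -
  have "wlim U (\<lambda>N. c' N y) = m (cylinder_density Y {0} (\<lambda>_. y))"
    unfolding m_def
  proof (rule wlim_cong[OF U(1)])
    show "norm (avg (Q N) (\<lambda>u. dens {0} (\<lambda>_. y) u *\<^sub>R f N u)) \<le> C * real (card Y) ^ card {0::nat}" for N
      using cylinder_density_le[of Y "{0::nat}" "\<lambda>_. y"] cylinder_density_nonneg[of Y "{0::nat}" "\<lambda>_. y"]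
      by (intro norm_avg_bdd) simp
    show "\<forall>\<^sub>F N in U. avg (Q N) (\<lambda>u. dens {0} (\<lambda>_. y) u *\<^sub>R f N u) = c' N y"
      using filter_leD[OF U(2) eventually_gt_at_top[of 0]] by eventually_elim (simp add: c'_eq[OF _ assms])
  qed
  then show ?thesis using conditioning_on_coordinate[OF assms] by simp
qed

text \<open>The primitive is the weak-* limit of \<open>b N\<close>, the constant is the limiting
  mean \<open>m (\<lambda>_. 1)\<close>. Neither bound mentions \<open>S\<close>, on which the later
  limit over finite sets relies.\<close>

lemma constant_on_S:
  "\<exists>\<beta> v. (\<forall>gs. norm (\<beta> gs) \<le> k * C) \<and> norm v \<le> C
    \<and> (\<forall>g\<in>carrier G. \<forall>gs. set gs \<subseteq> carrier G \<longrightarrow> length gs = k \<longrightarrow> \<beta> (map ((\<otimes>) g) gs) = \<pi> g (\<beta> gs))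
    \<and> (\<forall>y\<in>Y. c y + list_coboundary \<beta> y = v)"
proof (intro exI conjI allI ballI impI)
  let ?\<beta> = "\<lambda>gs. wlim U (\<lambda>N. b N gs)"
  show "norm (?\<beta> gs) \<le> k * C" for gs
    using C_nonneg norm_b_le by (intro norm_wlim_le[OF U(1) norm_b_le]) auto
  show "norm (m (\<lambda>_. 1)) \<le> C"
    using norm_m_le[OF bdd_const, of 1 0 1] avg_const[OF finite_Q Q_nonempty, of _ "1::real"] by simp
  show "?\<beta> (map ((\<otimes>) g) gs) = \<pi> g (?\<beta> gs)"
    if "g \<in> carrier G" "set gs \<subseteq> carrier G" "length gs = k" for g gs
    using wlim_linear[OF U(1) norm_b_le pair_\<pi>[OF that(1)]] b_translate[OF that] by simp
  fix y assume y: "y \<in> Y"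
  then have "set y \<subseteq> carrier G" "length y = Suc k"
    using S_subset by (auto simp: words_of_length_def)
  then have "list_coboundary ?\<beta> y = wlim U (\<lambda>N. c' N y - c y)"
    by (simp add: list_coboundary_wlim[OF U(1) norm_b_le] coboundary_b)
  also have "\<dots> = m (\<lambda>_. 1) - c y"
    using wlim_diff[OF U(1), of "\<lambda>N. c' N y" C "\<lambda>_. c y" C] norm_c'_le norm_c
      wlim_c'[OF y] wlim_const[OF U(1)] by simp
  finally show "c y + list_coboundary ?\<beta> y = m (\<lambda>_. 1)" by simp
qed

end

section \<open>A vanishing criterion\<close>

definition has_commuting_conjugates :: "('g, 'b) monoid_scheme \<Rightarrow> bool"
  where "has_commuting_conjugates G \<longleftrightarrow>
    (\<forall>S. finite S \<and> S \<subseteq> carrier G \<longrightarrow> (\<exists>\<tau>. commuting_conjugates G S \<tau>))"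

context bounded_cocycle
begin

lemma constant_on_finite_subset:
  assumes "has_commuting_conjugates G" "finite S" "S \<subseteq> carrier G"
  shows "\<exists>\<beta> v. (\<forall>gs. norm (\<beta> gs) \<le> k * C) \<and> norm v \<le> C
    \<and> (\<forall>g\<in>carrier G. \<forall>gs. set gs \<subseteq> carrier G \<longrightarrow> length gs = k \<longrightarrow> \<beta> (map ((\<otimes>) g) gs) = \<pi> g (\<beta> gs))
    \<and> (\<forall>y\<in>words_of_length S (Suc k). c y + list_coboundary \<beta> y = v)"
proof -
  \<comment> \<open>Adding \<open>\<one>\<close> guarantees a nonempty set to average over.\<close>
  obtain \<tau> where "commuting_conjugates G (insert \<one> S) \<tau>"
    using assms unfolding has_commuting_conjugates_def by (metis finite_insert insert_subset one_closed)
  then interpret B: commuting_conjugates G "insert \<one> S" \<tau> .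
  obtain U :: "nat filter" where "U \<le> sequentially" "ultrafilter U"
    using ultrafilter_exists[of sequentially] by auto
  then interpret K: cocycle_and_conjugates G T \<pi> \<rho> k c C "insert \<one> S" \<tau> U
    using assms(2) by unfold_locales auto
  have "words_of_length S (Suc k) \<subseteq> words_of_length (insert \<one> S) (Suc k)"
    by (auto simp: words_of_length_def)
  then show ?thesis using K.constant_on_S by (metis (no_types, lifting) subsetD)
qed

lemma constant_up_to_coboundary:
  assumes "has_commuting_conjugates G"
  shows "\<exists>\<beta> v. (\<forall>gs. norm (\<beta> gs) \<le> k * C)
    \<and> (\<forall>g\<in>carrier G. \<forall>gs. set gs \<subseteq> carrier G \<longrightarrow> length gs = k \<longrightarrow> \<beta> (map ((\<otimes>) g) gs) = \<pi> g (\<beta> gs))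
    \<and> (\<forall>gs. set gs \<subseteq> carrier G \<longrightarrow> length gs = Suc k \<longrightarrow> c gs + list_coboundary \<beta> gs = v)"
proof -
  \<comment> \<open>The choice runs over all sets \<open>S\<close>, and the limit needs bounds and
    equivariance for each of them; zero serves where \<open>S\<close> is infinite or leaves the
    group.\<close>
  have "\<exists>\<beta> v. (\<forall>gs. norm (\<beta> gs) \<le> k * C) \<and> norm v \<le> C
    \<and> (\<forall>g\<in>carrier G. \<forall>gs. set gs \<subseteq> carrier G \<longrightarrow> length gs = k \<longrightarrow> \<beta> (map ((\<otimes>) g) gs) = \<pi> g (\<beta> gs))
    \<and> (finite S \<and> S \<subseteq> carrier G \<longrightarrow> (\<forall>y\<in>words_of_length S (Suc k). c y + list_coboundary \<beta> y = v))"
    for S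
  proof (cases "finite S \<and> S \<subseteq> carrier G")
    case True
    then show ?thesis using constant_on_finite_subset[OF assms, of S] by simp
  next
    case False
    then show ?thesis
      using C_nonneg linear_0[OF linear_\<pi>] by (intro exI[of _ "\<lambda>_. 0"] exI[of _ 0]) auto
  qed
  then obtain \<beta> v where \<beta>: "\<And>S gs. norm (\<beta> S gs) \<le> k * C" and v: "\<And>S. norm (v S) \<le> C"
    and trans: "\<And>S g gs. g \<in> carrier G \<Longrightarrow> set gs \<subseteq> carrier G \<Longrightarrow> length gs = k \<Longrightarrow>
      \<beta> S (map ((\<otimes>) g) gs) = \<pi> g (\<beta> S gs)"
    and const: "\<And>S y. finite S \<Longrightarrow> S \<subseteq> carrier G \<Longrightarrow> y \<in> words_of_length S (Suc k) \<Longrightarrow>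
      c y + list_coboundary (\<beta> S) y = v S"
    by metis
  \<comment> \<open>Along this filter the entries of any given tuple eventually belong to
    \<open>S\<close>.\<close>
  obtain U where U: "U \<le> finite_subsets_at_top (carrier G)" "ultrafilter U"
    using ultrafilter_exists[OF finite_subsets_at_top_neq_bot] by blast
  let ?\<beta> = "\<lambda>gs. wlim U (\<lambda>S. \<beta> S gs)"
  show ?thesis
  proof (intro exI conjI allI ballI impI)
    show "norm (?\<beta> gs) \<le> k * C" for gs
      using C_nonneg \<beta> by (intro norm_wlim_le[OF U(2) \<beta>]) auto
    show "?\<beta> (map ((\<otimes>) g) gs) = \<pi> g (?\<beta> gs)"
      if "g \<in> carrier G" "set gs \<subseteq> carrier G" "length gs = k" for g gs
      using wlim_linear[OF U(2) \<beta> pair_\<pi>[OF that(1)]] trans[OF that] by simp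
    fix gs assume gs: "set gs \<subseteq> carrier G" "length gs = Suc k"
    have ev: "eventually (\<lambda>S. v S - c gs = list_coboundary (\<beta> S) gs) U"
    proof (rule filter_leD[OF U(1)])
      show "eventually (\<lambda>S. v S - c gs = list_coboundary (\<beta> S) gs) (finite_subsets_at_top (carrier G))"
        unfolding eventually_finite_subsets_at_top
      proof (intro exI[of _ "set gs"] conjI allI impI)
        fix S assume "finite S \<and> set gs \<subseteq> S \<and> S \<subseteq> carrier G"
        then show "v S - c gs = list_coboundary (\<beta> S) gs"
          using const[of S gs] gs(2) by (simp add: words_of_length_def algebra_simps)
      qed (use gs in auto)
    qed
    have "norm (v S - c gs) \<le> C + C" for S
      using norm_triangle_ineq4[of "v S" "c gs"] v[of S] norm_c[of gs] by simp
    then have "wlim U (\<lambda>S. list_coboundary (\<beta> S) gs) = wlim U (\<lambda>S. v S - c gs)"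
      by (rule wlim_cong[OF U(2) _ ev])
    also have "\<dots> = wlim U v - c gs"
      using wlim_diff[OF U(2), of v C "\<lambda>_. c gs" C] v norm_c wlim_const[OF U(2)] by simp
    finally show "c gs + list_coboundary ?\<beta> gs = wlim U v"
      by (simp add: list_coboundary_wlim[OF U(2) \<beta>])
  qed
qed

lemma cocycle_is_coboundary:
  assumes "has_commuting_conjugates G" "1 \<le> k"
  shows "\<exists>\<beta> B. (\<forall>gs. norm (\<beta> gs) \<le> B)
    \<and> (\<forall>g\<in>carrier G. \<forall>gs. set gs \<subseteq> carrier G \<longrightarrow> length gs = k \<longrightarrow> \<beta> (map ((\<otimes>) g) gs) = \<pi> g (\<beta> gs))
    \<and> (\<forall>gs. set gs \<subseteq> carrier G \<longrightarrow> length gs = Suc k \<longrightarrow> c gs = list_coboundary \<beta> gs)"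
proof -
  obtain \<beta> v where \<beta>: "\<And>gs. norm (\<beta> gs) \<le> k * C"
    and trans: "\<And>g gs. g \<in> carrier G \<Longrightarrow> set gs \<subseteq> carrier G \<Longrightarrow> length gs = k \<Longrightarrow>
      \<beta> (map ((\<otimes>) g) gs) = \<pi> g (\<beta> gs)"
    and const: "\<And>gs. set gs \<subseteq> carrier G \<Longrightarrow> length gs = Suc k \<Longrightarrow> c gs + list_coboundary \<beta> gs = v"
    using constant_up_to_coboundary[OF assms(1)] by metis
  \<comment> \<open>The left side of \<open>const\<close> is equivariant, so comparing a tuple with
    its translate shows that \<open>v\<close> is fixed by the group.\<close>
  have v_inv: "\<pi> g v = v" if g: "g \<in> carrier G" for g
  proof -
    define gs where "gs = replicate (Suc k) \<one>"
    have gs: "set gs \<subseteq> carrier G" "length gs = Suc k" by (auto simp: gs_def)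
    have ggs: "set (map ((\<otimes>) g) gs) \<subseteq> carrier G" "length (map ((\<otimes>) g) gs) = Suc k"
      using g gs by auto
    have "list_coboundary \<beta> (map ((\<otimes>) g) gs) = \<pi> g (list_coboundary \<beta> gs)"
      unfolding list_coboundary_map list_coboundary_linear[OF linear_\<pi>[OF g]]
      by (rule list_coboundary_cong) (use gs in \<open>auto intro!: trans[OF g]\<close>)
    then have "v = \<pi> g (c gs) + \<pi> g (list_coboundary \<beta> gs)"
      using const[OF ggs] c_translate[OF g gs] by simp
    also have "\<dots> = \<pi> g v" using const[OF gs] linear_add[OF linear_\<pi>[OF g]] by metis
    finally show ?thesis by simp
  qed
  \<comment> \<open>The alternating sum of the odd number \<open>k + 2\<close> of copies of
    \<open>v\<close> is \<open>v\<close>, while the coboundary of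
    \<open>c + list_coboundary \<beta>\<close> vanishes.\<close>
  have v_odd: "v = 0" if "odd k"
  proof -
    define gs where "gs = replicate (Suc (Suc k)) \<one>"
    have gs: "set gs \<subseteq> carrier G" "length gs = Suc (Suc k)" by (auto simp: gs_def)
    have "v = list_coboundary (\<lambda>_. v) gs" using gs that by (simp add: list_coboundary_const)
    also have "\<dots> = list_coboundary (\<lambda>l. c l - (- 1) *\<^sub>R list_coboundary \<beta> l) gs"
      by (rule list_coboundary_cong) (use gs const in \<open>auto simp: subset_iff\<close>)
    also have "\<dots> = 0"
      unfolding list_coboundary_diff list_coboundary_scaleR using cocycle[OF gs] by simp
    finally show ?thesis .
  qed
  show ?thesis
  \<comment> \<open>For even \<open>k\<close> the constant \<open>v\<close> is the coboundary of a
    constant, for odd \<open>k\<close> it is zero. Invariance of \<open>v\<close> keeps the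
    corrected primitive equivariant.\<close>
  proof (intro exI[of _ "\<lambda>gs. v - \<beta> gs"] exI[of _ "norm v + k * C"] conjI allI ballI impI)
    show "norm (v - \<beta> gs) \<le> norm v + k * C" for gs
      using norm_triangle_ineq4[of v "\<beta> gs"] \<beta>[of gs] by simp
    show "v - \<beta> (map ((\<otimes>) g) gs) = \<pi> g (v - \<beta> gs)"
      if "g \<in> carrier G" "set gs \<subseteq> carrier G" "length gs = k" for g gs
      using trans[OF that] v_inv[OF that(1)] linear_diff[OF linear_\<pi>[OF that(1)]] by simp
    show "c gs = list_coboundary (\<lambda>gs. v - \<beta> gs) gs"
      if gs: "set gs \<subseteq> carrier G" "length gs = Suc k" for gs
    proof -
      have "list_coboundary (\<lambda>_. v) gs = v" using v_odd gs by (auto simp: list_coboundary_const)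
      then have "list_coboundary (\<lambda>gs. v - \<beta> gs) gs = v - list_coboundary \<beta> gs"
        by (simp add: list_coboundary_diff)
      then show ?thesis using const[OF gs] by (metis add_diff_cancel_right')
    qed
  qed
qed

end

section \<open>Passage from list cochains to the bounded cochain complex\<close>

lemma tuples_iff: "xs \<in> tuples G k \<longleftrightarrow> set xs \<subseteq> carrier G \<and> length xs = Suc k"
  by (auto simp: tuples_def lists_eq_set)

lemma coboundary_eq:
  "coboundary G k f xs = (if xs \<in> tuples G (Suc k) then list_coboundary f xs else 0)"
  unfolding coboundary_def list_coboundary_eq_sum tuples_iff
  by (auto simp: lessThan_Suc_atMost)

lemma bounded_cochains_iff:
  "f \<in> bounded_cochains G k \<longleftrightarrow> (\<exists>C. \<forall>xs. norm (f xs) \<le> C) \<and> (\<forall>xs. xs \<notin> tuples G k \<longrightarrow> f xs = 0)"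
proof -
  have "(\<exists>C. \<forall>xs. norm (f xs) \<le> C)"
    if C: "\<forall>xs\<in>tuples G k. norm (f xs) \<le> C" and 0: "\<forall>xs. xs \<notin> tuples G k \<longrightarrow> f xs = 0" for C
  proof (intro exI allI)
    show "norm (f xs) \<le> max C 0" for xs using C 0 by (cases "xs \<in> tuples G k") auto
  qed
  then show ?thesis by (auto simp: bounded_cochains_def bounded_iff)
qed

lemma (in group) invariant_cochains_iff:
  "f \<in> invariant_cochains G \<pi> k \<longleftrightarrow> f \<in> bounded_cochains G k \<and>
    (\<forall>g\<in>carrier G. \<forall>xs\<in>tuples G k. f (map ((\<otimes>) g) xs) = \<pi> g (f xs))"
proof -
  have *: "map ((\<otimes>) g) xs \<in> tuples G k" if "g \<in> carrier G" "xs \<in> tuples G k" for g xs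
    using that by (auto simp: tuples_iff)
  have 1: "map (\<lambda>x. inv g \<otimes> x) (map ((\<otimes>) g) xs) = xs" "map ((\<otimes>) g) (map (\<lambda>x. inv g \<otimes> x) xs) = xs"
    if "g \<in> carrier G" "xs \<in> tuples G k" for g xs
    using that by (auto simp: tuples_iff subset_iff comp_def m_assoc[symmetric] intro!: map_idI)
  have "f (map ((\<otimes>) g) xs) = \<pi> g (f xs)"
    if "\<forall>g\<in>carrier G. \<forall>xs\<in>tuples G k. \<pi> g (f (map (\<lambda>x. inv g \<otimes> x) xs)) = f xs"
      "g \<in> carrier G" "xs \<in> tuples G k" for g xs
    using that(1)[rule_format, OF that(2) *[OF that(2,3)]] 1(1)[OF that(2,3)] by simp
  moreover have "\<pi> g (f (map (\<lambda>x. inv g \<otimes> x) xs)) = f xs"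
    if "\<forall>g\<in>carrier G. \<forall>xs\<in>tuples G k. f (map ((\<otimes>) g) xs) = \<pi> g (f xs)"
      "g \<in> carrier G" "xs \<in> tuples G k" for g xs
  proof -
    have "map (\<lambda>x. inv g \<otimes> x) xs \<in> tuples G k" using *[of "inv g"] that by simp
    from that(1)[rule_format, OF that(2) this] show ?thesis using 1(2)[OF that(2,3)] by simp
  qed
  ultimately show ?thesis
    unfolding invariant_cochains_def cochain_action_def by blast
qed

lemma (in group) coboundary_invariant:
  assumes \<pi>: "banach_module G \<pi>" and h: "h \<in> invariant_cochains G \<pi> k"
  shows "coboundary G k h \<in> bounded_cocycles G \<pi> (Suc k)"
proof -
  have lin: "linear (\<pi> g)" if "g \<in> carrier G" for g using \<pi> that by (auto simp: banach_module_def)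
  have hb: "h \<in> bounded_cochains G k"
    and ht: "\<And>g xs. g \<in> carrier G \<Longrightarrow> xs \<in> tuples G k \<Longrightarrow> h (map ((\<otimes>) g) xs) = \<pi> g (h xs)"
    using h unfolding invariant_cochains_iff by auto
  obtain C where C: "\<And>xs. norm (h xs) \<le> C" using hb unfolding bounded_cochains_iff by blast
  have "coboundary G k h \<in> bounded_cochains G (Suc k)"
    unfolding bounded_cochains_iff
  proof (intro conjI exI allI impI)
    show "norm (coboundary G k h xs) \<le> (\<Sum>i\<le>Suc k. C)" for xs
    proof (cases "xs \<in> tuples G (Suc k)")
      case True
      have "norm (\<Sum>i\<le>Suc k. (- 1) ^ i *\<^sub>R h (take i xs @ drop (Suc i) xs)) \<le> (\<Sum>i\<le>Suc k. C)"
        by (rule sum_norm_le) (simp add: C)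
      then show ?thesis unfolding coboundary_def using True by simp
    next
      case False
      have "0 \<le> C" using C[of "[]"] norm_ge_zero order_trans by blast
      then show ?thesis using False by (simp add: coboundary_def)
    qed
  qed (simp add: coboundary_def)
  moreover have "coboundary G k h (map ((\<otimes>) g) xs) = \<pi> g (coboundary G k h xs)"
    if g: "g \<in> carrier G" and xs: "xs \<in> tuples G (Suc k)" for g xs
  proof -
    have gxs: "map ((\<otimes>) g) xs \<in> tuples G (Suc k)" using g xs by (auto simp: tuples_iff)
    have "list_coboundary h (map ((\<otimes>) g) xs) = \<pi> g (list_coboundary h xs)"
      unfolding list_coboundary_map list_coboundary_linear[OF lin[OF g]]
      by (rule list_coboundary_cong) (use xs in \<open>auto simp: tuples_iff intro!: ht[OF g]\<close>)
    then show ?thesis using xs gxs by (simp add: coboundary_eq)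
  qed
  moreover have "coboundary G (Suc k) (coboundary G k h) xs = 0" for xs
  proof -
    have "list_coboundary (coboundary G k h) xs = list_coboundary (list_coboundary h) xs"
      if "xs \<in> tuples G (Suc (Suc k))"
      by (rule list_coboundary_cong) (use that in \<open>auto simp: coboundary_eq tuples_iff\<close>)
    then show ?thesis by (simp add: coboundary_eq[of G "Suc k"])
  qed
  ultimately show ?thesis
    unfolding bounded_cocycles_def invariant_cochains_iff by blast
qed

text \<open>Commutativity makes subgroups normal, so \<open>trivial_group_Mod_carrier\<close>
  applies once the coboundaries exhaust the cocycles.\<close>

lemma (in group) comm_group_cocycle_group:
  assumes \<pi>: "banach_module G \<pi>"
  shows "comm_group (cocycle_group G \<pi> k)"
proof (rule comm_groupI)
  have lin: "linear (\<pi> g)" if "g \<in> carrier G" for g using \<pi> that by (auto simp: banach_module_def)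
  have Z: "f \<in> bounded_cocycles G \<pi> k \<longleftrightarrow> (\<exists>C. \<forall>xs. norm (f xs) \<le> C) \<and> (\<forall>xs. xs \<notin> tuples G k \<longrightarrow> f xs = 0)
      \<and> (\<forall>g\<in>carrier G. \<forall>xs\<in>tuples G k. f (map ((\<otimes>) g) xs) = \<pi> g (f xs))
      \<and> (\<forall>xs\<in>tuples G (Suc k). list_coboundary f xs = 0)" for f :: "'a list \<Rightarrow> 'e::banach"
    and \<pi> :: "'a \<Rightarrow> 'e \<Rightarrow> 'e"
    unfolding bounded_cocycles_def invariant_cochains_iff bounded_cochains_iff coboundary_eq by auto
  have diff: "(\<lambda>xs. f xs - h xs) \<in> bounded_cocycles G \<pi> k"
    if f: "f \<in> bounded_cocycles G \<pi> k" and h: "h \<in> bounded_cocycles G \<pi> k" for f h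
  proof -
    obtain C C' where C: "\<And>xs. norm (f xs) \<le> C" "\<And>xs. norm (h xs) \<le> C'"
      using f h unfolding Z by blast
    have "norm (f xs - h xs) \<le> C + C'" for xs
      using norm_triangle_ineq4[of "f xs" "h xs"] C(1)[of xs] C(2)[of xs] by simp
    then show ?thesis
      using f h unfolding Z by (auto simp: list_coboundary_diff linear_diff[OF lin])
  qed
  have zero: "(\<lambda>_. 0) \<in> bounded_cocycles G \<pi> k"
    unfolding Z by (auto simp: list_coboundary_const linear_0[OF lin])
  have neg: "(\<lambda>xs. - f xs) \<in> bounded_cocycles G \<pi> k" if "f \<in> bounded_cocycles G \<pi> k" for f
    using diff[OF zero that] by simp
  show "x \<otimes>\<^bsub>cocycle_group G \<pi> k\<^esub> y \<in> carrier (cocycle_group G \<pi> k)"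
    if "x \<in> carrier (cocycle_group G \<pi> k)" "y \<in> carrier (cocycle_group G \<pi> k)" for x y
    using diff[OF _ neg, of x y] that by (simp add: cocycle_group_def)
  show "\<one>\<^bsub>cocycle_group G \<pi> k\<^esub> \<in> carrier (cocycle_group G \<pi> k)"
    using zero by (simp add: cocycle_group_def)
  show "\<exists>y\<in>carrier (cocycle_group G \<pi> k). y \<otimes>\<^bsub>cocycle_group G \<pi> k\<^esub> x = \<one>\<^bsub>cocycle_group G \<pi> k\<^esub>"
    if "x \<in> carrier (cocycle_group G \<pi> k)" for x
    using neg[of x] that by (auto simp: cocycle_group_def intro!: bexI[of _ "\<lambda>xs. - x xs"])
qed (auto simp: cocycle_group_def algebra_simps)

lemma (in comm_group) trivial_group_Mod_carrier: "trivial_group (G Mod carrier G)"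
proof -
  interpret N: normal "carrier G" G
    using subgroup_imp_normal[OF subgroup_self] .
  have "carrier G #> x = carrier G" if "x \<in> carrier G" for x
    using coset_join2[OF that subgroup_self that] .
  then have "carrier (G Mod carrier G) = {carrier G}"
    unfolding carrier_FactGroup by force
  then show ?thesis
    using N.factorgroup_is_group by (simp add: trivial_group_def)
qed

theorem has_commuting_conjugates_imp_Xsep_boundedly_acyclic:
  assumes "group G" and conj: "has_commuting_conjugates G"
  shows "Xsep_boundedly_acyclic TYPE('e::banach) TYPE('f::banach) G"
  unfolding Xsep_boundedly_acyclic_def
proof (intro allI impI, elim conjE)
  interpret group G by fact
  fix n :: nat and \<pi> :: "'a \<Rightarrow> 'e \<Rightarrow> 'e"
  assume n: "1 \<le> n" and dual: "dual_banach_module TYPE('f) G \<pi>"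
    and sep: "separable_space (euclidean :: 'e topology)"
  have \<pi>: "banach_module G \<pi>" using dual by (simp add: dual_banach_module_def)
  obtain \<rho> :: "'a \<Rightarrow> 'f \<Rightarrow> 'f" and T :: "'e \<Rightarrow> 'f \<Rightarrow>\<^sub>L real" where \<rho>: "banach_module G \<rho>"
    and T: "linear T" "surj T" "\<And>x. norm (T x) = norm x"
    and eqv: "\<And>g x. g \<in> carrier G \<Longrightarrow> T (\<pi> g x) = contragredient G \<rho> g (T x)"
    using dual unfolding dual_banach_module_def by blast
  interpret dual_space T by (rule dual_space.intro[OF T])
  have pair_\<pi>: "pair (\<pi> g x) v = pair x (\<rho> (inv\<^bsub>G\<^esub> g) v)" if g: "g \<in> carrier G" for g x v
  proof -
    have "linear (\<rho> (inv\<^bsub>G\<^esub> g))" "\<And>x. norm (\<rho> (inv\<^bsub>G\<^esub> g) x) = norm x"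
      using \<rho> inv_closed[OF g] unfolding banach_module_def by blast+
    then have "bounded_linear (\<rho> (inv\<^bsub>G\<^esub> g))"
      by (intro bounded_linear_intro[of _ 1]) (auto simp: linear_add linear_scale)
    then show ?thesis by (simp add: pair_def eqv[OF g] contragredient_def bounded_linear_Blinfun_apply)
  qed
  obtain j where j: "n = Suc j" using n by (cases n) auto
  have sub: "bounded_coboundaries G \<pi> n \<subseteq> bounded_cocycles G \<pi> n"
    using coboundary_invariant[OF \<pi>] by (auto simp: bounded_coboundaries_def j)
  have "bounded_cocycles G \<pi> n \<subseteq> bounded_coboundaries G \<pi> n"
  proof
    fix c assume c: "c \<in> bounded_cocycles G \<pi> n"
    then have cn: "c \<in> invariant_cochains G \<pi> n" and dc: "\<And>xs. coboundary G n c xs = 0"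
      by (auto simp: bounded_cocycles_def)
    obtain C where C: "\<And>xs. norm (c xs) \<le> C"
      using cn unfolding invariant_cochains_iff bounded_cochains_iff by blast
    interpret bounded_cocycle G T \<pi> \<rho> n c C
    proof (intro bounded_cocycle.intro bounded_cocycle_axioms.intro group_axioms dual_space_axioms)
      show "linear (\<pi> g)" if "g \<in> carrier G" for g
        using \<pi> that by (auto simp: banach_module_def)
      show "norm (\<pi> g x) = norm x" if "g \<in> carrier G" for g x
        using \<pi> that by (auto simp: banach_module_def)
      show "c (map ((\<otimes>\<^bsub>G\<^esub>) g) xs) = \<pi> g (c xs)"
        if "g \<in> carrier G" "set xs \<subseteq> carrier G" "length xs = Suc n" for g xs
        using cn that by (simp add: invariant_cochains_iff tuples_iff)
      show "list_coboundary c xs = 0" if "set xs \<subseteq> carrier G" "length xs = Suc (Suc n)" for xs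
        using dc[of xs] that by (simp add: coboundary_eq tuples_iff)
    qed (use pair_\<pi> sep C in auto)
    obtain \<beta> B where \<beta>: "\<And>gs. norm (\<beta> gs) \<le> B"
      and trans: "\<And>g gs. g \<in> carrier G \<Longrightarrow> set gs \<subseteq> carrier G \<Longrightarrow> length gs = n \<Longrightarrow>
        \<beta> (map ((\<otimes>\<^bsub>G\<^esub>) g) gs) = \<pi> g (\<beta> gs)"
      and eq: "\<And>gs. set gs \<subseteq> carrier G \<Longrightarrow> length gs = Suc n \<Longrightarrow> c gs = list_coboundary \<beta> gs"
      using cocycle_is_coboundary[OF conj n] by metis
    \<comment> \<open>The primitive \<open>\<beta>\<close> need not vanish outside the tuples, as a
      cochain has to.\<close>
    define h where "h gs = (if gs \<in> tuples G j then \<beta> gs else 0)" for gs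
    have "norm (h gs) \<le> \<bar>B\<bar>" for gs using \<beta>[of gs] by (auto simp: h_def)
    moreover have "h gs = 0" if "gs \<notin> tuples G j" for gs using that by (simp add: h_def)
    ultimately have "h \<in> bounded_cochains G j"
      unfolding bounded_cochains_iff by blast
    moreover have "h (map ((\<otimes>\<^bsub>G\<^esub>) g) xs) = \<pi> g (h xs)" if "g \<in> carrier G" "xs \<in> tuples G j" for g xs
    proof -
      have "map ((\<otimes>\<^bsub>G\<^esub>) g) xs \<in> tuples G j" using that by (auto simp: tuples_iff)
      then show ?thesis using that trans[of g xs] by (simp add: h_def tuples_iff j)
    qed
    ultimately have "h \<in> invariant_cochains G \<pi> j" unfolding invariant_cochains_iff by blast
    moreover have "c = coboundary G j h"
    proof
      fix xs
      show "c xs = coboundary G j h xs"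
      proof (cases "xs \<in> tuples G n")
        case True
        then have "list_coboundary \<beta> xs = list_coboundary h xs"
          by (intro list_coboundary_cong) (auto simp: h_def tuples_iff j)
        then show ?thesis using eq[of xs] True by (simp add: coboundary_eq tuples_iff j)
      next
        case False
        then show ?thesis
          using cn unfolding invariant_cochains_iff bounded_cochains_iff by (simp add: coboundary_eq j)
      qed
    qed
    ultimately show "c \<in> bounded_coboundaries G \<pi> n" by (simp add: bounded_coboundaries_def j)
  qed
  with sub have "bounded_coboundaries G \<pi> n = carrier (cocycle_group G \<pi> n)"
    by (auto simp: cocycle_group_def)
  then show "trivial_group (bounded_cohomology G \<pi> n)"
    unfolding bounded_cohomology_def
    using comm_group.trivial_group_Mod_carrier[OF comm_group_cocycle_group[OF \<pi>]] by simp
qed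

section \<open>Stable automorphisms\<close>

definition block_perm :: "nat \<Rightarrow> (nat \<Rightarrow> nat) \<Rightarrow> nat \<Rightarrow> nat"
  where "block_perm n p i = n * p (i div n) + i mod n"

lemma block_perm_div: "0 < n \<Longrightarrow> block_perm n p i div n = p (i div n)"
  by (simp add: block_perm_def)

lemma block_perm_comp: "0 < n \<Longrightarrow> block_perm n (p \<circ> q) = block_perm n p \<circ> block_perm n q"
  by (auto simp: block_perm_def fun_eq_iff)

lemma block_perm_fixed: "p (i div n) = i div n \<Longrightarrow> block_perm n p i = i"
  by (simp add: block_perm_def)

lemma bij_block_perm:
  assumes "0 < n" "bij p"
  shows "bij (block_perm n p)"
proof (rule o_bij)
  show "block_perm n (Hilbert_Choice.inv p) \<circ> block_perm n p = id"
    using assms by (auto simp: fun_eq_iff block_perm_fixed bij_is_inj inv_o_cancel simp flip: block_perm_comp)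
  show "block_perm n p \<circ> block_perm n (Hilbert_Choice.inv p) = id"
    using assms by (auto simp: fun_eq_iff block_perm_fixed bij_is_surj surj_iff[THEN iffD1] simp flip: block_perm_comp)
qed

lemma (in group) subgroup_equalizer:
  assumes "\<phi> \<in> hom G H" "\<psi> \<in> hom G H" "group H"
  shows "subgroup {x \<in> carrier G. \<phi> x = \<psi> x} G"
proof -
  interpret \<phi>: group_hom G H \<phi> using assms by (simp add: group_hom_def group_hom_axioms_def)
  interpret \<psi>: group_hom G H \<psi> using assms by (simp add: group_hom_def group_hom_axioms_def)
  show ?thesis by (rule subgroupI) auto
qed

lemma (in group) subgroup_preimage:
  assumes "\<phi> \<in> hom G H" "subgroup K H" "group H"
  shows "subgroup {x \<in> carrier G. \<phi> x \<in> K} G"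
proof -
  interpret \<phi>: group_hom G H \<phi> using assms by (simp add: group_hom_def group_hom_axioms_def)
  interpret K: subgroup K H by fact
  show ?thesis by (rule subgroupI) auto
qed

text \<open>\<open>P A\<close> is the subgroup generated by the factors with index in \<open>A\<close>, and \<open>\<alpha> p\<close> permutes the
  factors according to \<open>p\<close>.\<close>

locale permuted_factors = group U for U (structure) +
  fixes P :: "nat set \<Rightarrow> 'u set" and \<alpha> :: "(nat \<Rightarrow> nat) \<Rightarrow> 'u \<Rightarrow> 'u"
  assumes P_subgroup: "subgroup (P A) U"
    and P_UNIV: "P UNIV = carrier U"
    and P_mono: "A \<subseteq> B \<Longrightarrow> P A \<subseteq> P B"
    and P_union: "subgroup K U \<Longrightarrow> P A \<subseteq> K \<Longrightarrow> P B \<subseteq> K \<Longrightarrow> P (A \<union> B) \<subseteq> K"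
    and \<alpha>_auto: "bij p \<Longrightarrow> \<alpha> p \<in> auto U"
    and \<alpha>_comp: "bij p \<Longrightarrow> bij q \<Longrightarrow> x \<in> carrier U \<Longrightarrow> \<alpha> (p \<circ> q) x = \<alpha> p (\<alpha> q x)"
    and \<alpha>_P: "bij p \<Longrightarrow> x \<in> P A \<Longrightarrow> \<alpha> p x \<in> P (p ` A)"
    and \<alpha>_fixed: "bij p \<Longrightarrow> (\<And>i. i \<in> A \<Longrightarrow> p i = i) \<Longrightarrow> x \<in> P A \<Longrightarrow> \<alpha> p x = x"
begin

text \<open>An intrinsic form of extending an automorphism of the first \<open>n\<close> factors by
  the identity: that automorphism is recovered by restriction, so it need not be part of the
  data.\<close>

definition stage :: "nat \<Rightarrow> ('u \<Rightarrow> 'u) set"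
  where "stage n = {\<psi> \<in> auto U. \<psi> ` P {..<n} = P {..<n} \<and> (\<forall>x\<in>P {n..}. \<psi> x = x)}"

abbreviation "stable_auts \<equiv> \<Union>n. stage n"

definition Aut_inf :: "('u \<Rightarrow> 'u) monoid"
  where "Aut_inf = AutoGroup U \<lparr>carrier := stable_auts\<rparr>"

lemma P_carrier: "x \<in> P A \<Longrightarrow> x \<in> carrier U"
  using subgroup.subset[OF P_subgroup] by blast

lemma auto_hom: "\<psi> \<in> auto U \<Longrightarrow> \<psi> \<in> hom U U" by (simp add: auto_def)

lemma auto_bij: "\<psi> \<in> auto U \<Longrightarrow> bij_betw \<psi> (carrier U) (carrier U)"
  by (simp add: auto_def Bij_def)

lemma auto_closed: "\<psi> \<in> auto U \<Longrightarrow> x \<in> carrier U \<Longrightarrow> \<psi> x \<in> carrier U"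
  using auto_bij bij_betwE by blast

text \<open>The points where two automorphisms agree form a subgroup, so \<open>P_union\<close>
  applies; extensionality settles equality off the carrier.\<close>

lemma auto_eqI:
  assumes "\<phi> \<in> auto U" "\<psi> \<in> auto U" "A \<union> B = UNIV"
    and "\<And>x. x \<in> P A \<Longrightarrow> \<phi> x = \<psi> x" "\<And>x. x \<in> P B \<Longrightarrow> \<phi> x = \<psi> x"
  shows "\<phi> = \<psi>"
proof -
  have "P (A \<union> B) \<subseteq> {x \<in> carrier U. \<phi> x = \<psi> x}"
    using assms auto_hom P_carrier by (intro P_union subgroup_equalizer[of \<phi> U \<psi>]) auto
  then have "\<phi> x = \<psi> x" if "x \<in> carrier U" for x using that assms(3) P_UNIV by auto
  moreover have "\<phi> \<in> extensional (carrier U)" "\<psi> \<in> extensional (carrier U)"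
    using assms(1,2) by (auto simp: auto_def Bij_def)
  ultimately show ?thesis by (intro extensionalityI)
qed

lemma stage_auto: "\<psi> \<in> stage n \<Longrightarrow> \<psi> \<in> auto U"
  by (simp add: stage_def)

text \<open>The preimage and the image of \<open>P {..<m}\<close> are subgroups containing the
  preserved part \<open>P {..<n}\<close> and the fixed part \<open>P {n..<m}\<close>;
  \<open>P_union\<close> turns this into the two inclusions.\<close>

lemma stage_mono:
  assumes "n \<le> m"
  shows "stage n \<subseteq> stage m"
proof
  fix \<psi> assume \<psi>: "\<psi> \<in> stage n"
  have a: "\<psi> \<in> auto U" and im: "\<psi> ` P {..<n} = P {..<n}" and fx: "\<And>x. x \<in> P {n..} \<Longrightarrow> \<psi> x = x"
    using \<psi> by (auto simp: stage_def)
  interpret \<psi>: group_hom U U \<psi>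
    using auto_hom[OF a] by (simp add: group_hom_def group_hom_axioms_def)
  have m: "{..<m} = {..<n} \<union> {n..<m}" using assms by auto
  have "P {n..<m} \<subseteq> P {n..}" by (rule P_mono) auto
  then have fx': "\<psi> x = x" if "x \<in> P {n..<m}" for x
    using fx that by blast
  have sub: "P {..<n} \<subseteq> P {..<m}" "P {n..<m} \<subseteq> P {..<m}" using assms by (auto intro!: P_mono)
  have "P ({..<n} \<union> {n..<m}) \<subseteq> {x \<in> carrier U. \<psi> x \<in> P {..<m}}"
  proof (rule P_union)
    show "subgroup {x \<in> carrier U. \<psi> x \<in> P {..<m}} U"
      by (rule subgroup_preimage[OF auto_hom[OF a] P_subgroup group_axioms])
    show "P {..<n} \<subseteq> {x \<in> carrier U. \<psi> x \<in> P {..<m}}" using sub(1) im P_carrier by blast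
    show "P {n..<m} \<subseteq> {x \<in> carrier U. \<psi> x \<in> P {..<m}}" using sub(2) fx' P_carrier by auto
  qed
  moreover have "P ({..<n} \<union> {n..<m}) \<subseteq> \<psi> ` P {..<m}"
  proof (rule P_union)
    show "subgroup (\<psi> ` P {..<m}) U"
      using \<psi>.subgroup_img_is_subgroup[OF P_subgroup] .
    show "P {..<n} \<subseteq> \<psi> ` P {..<m}" using im sub(1) by blast
    show "P {n..<m} \<subseteq> \<psi> ` P {..<m}"
    proof
      fix x assume "x \<in> P {n..<m}"
      then show "x \<in> \<psi> ` P {..<m}"
        using fx'[of x] sub(2) by (intro image_eqI[of _ _ x]) auto
    qed
  qed
  ultimately have "\<psi> ` P {..<m} = P {..<m}" unfolding m[symmetric] by blast
  moreover have "P {m..} \<subseteq> P {n..}" by (rule P_mono) (use assms in auto)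
  ultimately show "\<psi> \<in> stage m" using a fx by (auto simp: stage_def)
qed

lemma mult_BijGroup:
  "\<phi> \<in> auto U \<Longrightarrow> \<psi> \<in> auto U \<Longrightarrow> \<phi> \<otimes>\<^bsub>BijGroup (carrier U)\<^esub> \<psi> = compose (carrier U) \<phi> \<psi>"
  by (simp add: BijGroup_def auto_def)

lemma stage_compose:
  assumes "\<phi> \<in> stage n" "\<psi> \<in> stage n"
  shows "compose (carrier U) \<phi> \<psi> \<in> stage n"
proof -
  have a: "\<phi> \<in> auto U" "\<psi> \<in> auto U" using assms stage_auto by auto
  have "compose (carrier U) \<phi> \<psi> \<in> auto U"
    using subgroup.m_closed[OF subgroup_auto a] mult_BijGroup[OF a] by simp
  moreover have "compose (carrier U) \<phi> \<psi> ` P {..<n} = \<phi> ` (\<psi> ` P {..<n})"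
    unfolding image_image by (rule image_cong) (auto simp: compose_def P_carrier)
  ultimately show ?thesis
    using assms by (auto simp: stage_def compose_def P_carrier)
qed

lemma stage_inverse:
  assumes "\<psi> \<in> stage n"
  shows "inv\<^bsub>BijGroup (carrier U)\<^esub> \<psi> \<in> stage n"
proof -
  have a: "\<psi> \<in> auto U" using assms stage_auto by auto
  have B: "\<psi> \<in> Bij (carrier U)" using a by (simp add: auto_def)
  have "inj_on \<psi> (carrier U)" using auto_bij[OF a] by (simp add: bij_betw_def)
  then have iv: "(inv\<^bsub>BijGroup (carrier U)\<^esub> \<psi>) (\<psi> x) = x" if "x \<in> carrier U" for x
    using that auto_closed[OF a that] by (simp add: inv_BijGroup[OF B])
  have "inv\<^bsub>BijGroup (carrier U)\<^esub> \<psi> \<in> auto U"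
    using subgroup.m_inv_closed[OF subgroup_auto a] .
  moreover have "(inv\<^bsub>BijGroup (carrier U)\<^esub> \<psi>) ` P {..<n} = P {..<n}"
  proof -
    have "(inv\<^bsub>BijGroup (carrier U)\<^esub> \<psi>) ` (\<psi> ` P {..<n}) = P {..<n}"
      unfolding image_image using iv[OF P_carrier] by force
    then show ?thesis using assms by (simp add: stage_def)
  qed
  moreover have "(inv\<^bsub>BijGroup (carrier U)\<^esub> \<psi>) x = x" if "x \<in> P {n..}" for x
    using iv[OF P_carrier[OF that]] assms that by (simp add: stage_def)
  ultimately show ?thesis by (simp add: stage_def)
qed

lemma group_Aut_inf: "group Aut_inf"
proof -
  have "subgroup stable_auts (BijGroup (carrier U))"
  proof (rule subgroup.intro)
    show "stable_auts \<subseteq> carrier (BijGroup (carrier U))"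
      using stage_auto subgroup.subset[OF subgroup_auto] by blast
    show "\<one>\<^bsub>BijGroup (carrier U)\<^esub> \<in> stable_auts"
    proof -
      have "(\<lambda>x\<in>carrier U. x) \<in> stage 0"
        using id_in_auto P_carrier by (auto simp: stage_def)
      then show ?thesis by (auto simp: BijGroup_def)
    qed
    show "\<phi> \<otimes>\<^bsub>BijGroup (carrier U)\<^esub> \<psi> \<in> stable_auts" if mem: "\<phi> \<in> stable_auts" "\<psi> \<in> stable_auts" for \<phi> \<psi>
    proof -
      obtain m n where "\<phi> \<in> stage m" "\<psi> \<in> stage n" using mem by blast
      then have "\<phi> \<in> stage (max m n)" "\<psi> \<in> stage (max m n)"
        using stage_mono[of m "max m n"] stage_mono[of n "max m n"] by auto
      then show ?thesis using stage_compose mult_BijGroup stage_auto by (metis UN_iff UNIV_I)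
    qed
    show "inv\<^bsub>BijGroup (carrier U)\<^esub> \<psi> \<in> stable_auts" if "\<psi> \<in> stable_auts" for \<psi>
      using that stage_inverse by blast
  qed
  then have "group (BijGroup (carrier U) \<lparr>carrier := stable_auts\<rparr>)"
    using subgroup.subgroup_is_group group_BijGroup by blast
  then show ?thesis by (simp add: Aut_inf_def AutoGroup_def)
qed

lemma carrier_Aut_inf: "carrier Aut_inf = stable_auts"
  by (simp add: Aut_inf_def)

lemma mult_Aut_inf:
  "\<phi> \<in> stable_auts \<Longrightarrow> \<psi> \<in> stable_auts \<Longrightarrow> \<phi> \<otimes>\<^bsub>Aut_inf\<^esub> \<psi> = compose (carrier U) \<phi> \<psi>"
  using mult_BijGroup stage_auto by (auto simp: Aut_inf_def AutoGroup_def)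

lemma one_Aut_inf: "\<one>\<^bsub>Aut_inf\<^esub> = (\<lambda>x\<in>carrier U. x)"
  by (simp add: Aut_inf_def AutoGroup_def BijGroup_def)

lemma \<alpha>_block_perm_stage:
  assumes n: "0 < n" and p: "p permutes {..<N}"
  shows "\<alpha> (block_perm n p) \<in> stage (n * N)"
proof -
  have bij: "bij (block_perm n q)" if "q permutes {..<N}" for q
    using bij_block_perm[OF n permutes_bij[OF that]] .
  have im: "block_perm n q ` {..<n * N} \<subseteq> {..<n * N}" if "q permutes {..<N}" for q
  proof -
    have "block_perm n q i < n * N" if i: "i < n * N" for i
    proof -
      have "i div n < N" using i n by (simp add: div_less_iff_less_mult mult.commute)
      then have "block_perm n q i div n < N"
        using permutes_in_image[OF \<open>q permutes {..<N}\<close>] n by (simp add: block_perm_div)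
      then show ?thesis using n by (simp add: div_less_iff_less_mult mult.commute)
    qed
    then show ?thesis by auto
  qed
  have cl: "\<alpha> (block_perm n q) x \<in> P {..<n * N}" if "q permutes {..<N}" "x \<in> P {..<n * N}" for q x
    using \<alpha>_P[OF bij[OF that(1)] that(2)] P_mono[OF im[OF that(1)]] by blast
  have "P {..<n * N} \<subseteq> \<alpha> (block_perm n p) ` P {..<n * N}"
  proof
    fix x assume x: "x \<in> P {..<n * N}"
    have q: "Hilbert_Choice.inv p permutes {..<N}" by (rule permutes_inv[OF p])
    have "block_perm n p \<circ> block_perm n (Hilbert_Choice.inv p) = id"
      using block_perm_comp[OF n, of p "Hilbert_Choice.inv p"] permutes_inv_o(1)[OF p]
      by (auto simp: fun_eq_iff block_perm_fixed)
    then have "\<alpha> (block_perm n p) (\<alpha> (block_perm n (Hilbert_Choice.inv p)) x) = x"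
      using \<alpha>_comp[OF bij[OF p] bij[OF q] P_carrier[OF x]] \<alpha>_fixed[of id UNIV x] P_carrier[OF x] P_UNIV
      by simp
    then show "x \<in> \<alpha> (block_perm n p) ` P {..<n * N}"
      using cl[OF q x] by (metis image_eqI)
  qed
  moreover have "\<alpha> (block_perm n p) x = x" if x: "x \<in> P {n * N..}" for x
  proof (rule \<alpha>_fixed[OF bij[OF p] _ x])
    fix i assume "i \<in> {n * N..}"
    then have "N \<le> i div n" using n by (simp add: less_eq_div_iff_mult_less_eq mult.commute)
    then show "block_perm n p i = i"
      using permutes_not_in[OF p] by (intro block_perm_fixed) simp
  qed
  ultimately show ?thesis
    using cl[OF p] \<alpha>_auto[OF bij[OF p]] by (auto simp: stage_def)
qed

text \<open>The given automorphisms act on block 0 only, their conjugates by a transposition on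
  block \<open>j\<close> only. Commutation is tested on the two subgroups belonging to block
  \<open>j\<close> and its complement.\<close>

lemma has_commuting_conjugates_Aut_inf: "has_commuting_conjugates Aut_inf"
  unfolding has_commuting_conjugates_def carrier_Aut_inf
proof (intro allI impI, elim conjE)
  fix S assume S: "finite S" "S \<subseteq> stable_auts"
  then have "\<exists>n. S \<subseteq> stage n"
  proof (induction S)
    case (insert s S)
    then obtain m n where "S \<subseteq> stage n" "s \<in> stage m" by auto
    then have "insert s S \<subseteq> stage (max m n)"
      using stage_mono[of m "max m n"] stage_mono[of n "max m n"] by auto
    then show ?case by blast
  qed simp
  then obtain n0 where "S \<subseteq> stage n0" by blast
  \<comment> \<open>The successor makes the block length positive, so that \<open>div\<close> and
    \<open>mod\<close> number the blocks.\<close>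
  define n where "n = Suc n0"
  have n: "0 < n" and Sn: "S \<subseteq> stage n" using \<open>S \<subseteq> stage n0\<close> stage_mono[of n0 n] by (auto simp: n_def)
  define \<tau> where "\<tau> p = \<alpha> (block_perm n p)" for p
  define B where "B j = {i. i div n = j}" for j
  have B0: "{..<n} = B 0" "{n..} = - B 0" using n by (auto simp: B_def div_eq_0_iff)
  have s: "s \<in> auto U" "s ` P (B 0) = P (B 0)" "\<And>x. x \<in> P (- B 0) \<Longrightarrow> s x = x" if "s \<in> S" for s
    using Sn that unfolding stage_def B0 by auto
  have s_stable: "s \<in> stable_auts" if "s \<in> S" for s using Sn that by blast
  have s0: "s x \<in> P (B 0)" if "s \<in> S" "x \<in> P (B 0)" for s x using s(2)[OF that(1)] that(2) by blast
  have \<tau>_stable: "\<tau> p \<in> stable_auts" if "p \<in> finitary_perms" for p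
    using that \<alpha>_block_perm_stage[OF n] by (auto simp: finitary_perms_def \<tau>_def)
  have bb: "bij (block_perm n p)" if "p \<in> finitary_perms" for p
    using bij_block_perm[OF n finitary_perms_bij[OF that]] .
  have \<tau>_P: "\<tau> p x \<in> P D" if "p \<in> finitary_perms" "x \<in> P A" "\<And>i. i \<in> A \<Longrightarrow> block_perm n p i \<in> D" for p x A D
    using \<alpha>_P[OF bb[OF that(1)] that(2)] P_mono[of "block_perm n p ` A" D] that(3) by (auto simp: \<tau>_def)
  interpret A: group Aut_inf by (rule group_Aut_inf)
  have c: "\<tau> p \<in> carrier Aut_inf" if "p \<in> finitary_perms" for p using \<tau>_stable that by (simp add: carrier_Aut_inf)
  have cs: "s' \<in> carrier Aut_inf" if "s' \<in> S" for s' using s_stable that by (simp add: carrier_Aut_inf)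
  have app: "(\<phi> \<otimes>\<^bsub>Aut_inf\<^esub> \<psi>) x = \<phi> (\<psi> x)"
    if "\<phi> \<in> carrier Aut_inf" "\<psi> \<in> carrier Aut_inf" "x \<in> carrier U" for \<phi> \<psi> x
    using that mult_Aut_inf by (simp add: carrier_Aut_inf compose_def)
  have au: "\<phi> \<in> auto U" if "\<phi> \<in> carrier Aut_inf" for \<phi> using that stage_auto by (auto simp: carrier_Aut_inf)
  have \<tau>_comp: "\<tau> (p \<circ> q) = \<tau> p \<otimes>\<^bsub>Aut_inf\<^esub> \<tau> q" if p: "p \<in> finitary_perms" and q: "q \<in> finitary_perms" for p q
  proof (rule auto_eqI[of _ _ UNIV UNIV])
    show "\<tau> (p \<circ> q) x = (\<tau> p \<otimes>\<^bsub>Aut_inf\<^esub> \<tau> q) x" if "x \<in> P UNIV" for x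
      using \<alpha>_comp[OF bb[OF p] bb[OF q] P_carrier[OF that]] app[OF c[OF p] c[OF q] P_carrier[OF that]]
      by (simp add: \<tau>_def block_perm_comp[OF n])
    then show "\<tau> (p \<circ> q) x = (\<tau> p \<otimes>\<^bsub>Aut_inf\<^esub> \<tau> q) x" if "x \<in> P UNIV" for x using that .
  qed (use p q c finitary_perms_comp[OF p q] au in auto)
  have "commuting_conjugates Aut_inf S \<tau>"
  proof
    show "S \<subseteq> carrier Aut_inf" using S carrier_Aut_inf by simp
    show "\<tau> p \<in> carrier Aut_inf" if "p \<in> finitary_perms" for p using c that .
    show "\<tau> (p \<circ> q) = \<tau> p \<otimes>\<^bsub>Aut_inf\<^esub> \<tau> q" if "p \<in> finitary_perms" "q \<in> finitary_perms" for p q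
      using \<tau>_comp that .
    show "\<tau> p \<otimes>\<^bsub>Aut_inf\<^esub> t = t \<otimes>\<^bsub>Aut_inf\<^esub> \<tau> p" if p: "p \<in> finitary_perms" "p 0 = 0" and t: "t \<in> S" for p t
    \<comment> \<open>On each of the two pieces one factor is the identity and the other preserves
      the piece.\<close>
    proof (rule auto_eqI[of _ _ "B 0" "- B 0"])
      show "(\<tau> p \<otimes>\<^bsub>Aut_inf\<^esub> t) x = (t \<otimes>\<^bsub>Aut_inf\<^esub> \<tau> p) x" if x: "x \<in> P (B 0)" for x
      proof -
        have fx: "\<tau> p y = y" if "y \<in> P (B 0)" for y
          unfolding \<tau>_def by (rule \<alpha>_fixed[OF bb[OF p(1)] _ that]) (auto simp: B_def p intro!: block_perm_fixed)
        show ?thesis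
          using app[OF c[OF p(1)] cs[OF t] P_carrier[OF x]] app[OF cs[OF t] c[OF p(1)] P_carrier[OF x]]
            fx[OF x] fx[OF s0[OF t x]] by simp
      qed
      show "(\<tau> p \<otimes>\<^bsub>Aut_inf\<^esub> t) x = (t \<otimes>\<^bsub>Aut_inf\<^esub> \<tau> p) x" if x: "x \<in> P (- B 0)" for x
      proof -
        have "p i \<noteq> 0" if "i \<noteq> 0" for i
          using p(2) that finitary_perms_bij[OF p(1)] by (metis bij_is_inj injD)
        then have "\<tau> p x \<in> P (- B 0)"
          by (intro \<tau>_P[OF p(1) x]) (auto simp: B_def block_perm_div[OF n])
        then show ?thesis
          using app[OF c[OF p(1)] cs[OF t] P_carrier[OF x]] app[OF cs[OF t] c[OF p(1)] P_carrier[OF x]]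
            s(3)[OF t] x by simp
      qed
    qed (use p t c cs in \<open>auto intro!: au\<close>)
  next
    fix j :: nat and t u assume j: "j \<noteq> 0" and t: "t \<in> S" and u: "u \<in> S"
    define r where "r = Transposition.transpose 0 j"
    define a where "a = \<tau> r"
    have r: "r \<in> finitary_perms" unfolding r_def by (rule finitary_perms_transpose)
    have ca: "a \<in> carrier Aut_inf" unfolding a_def using c[OF r] .
    have aa: "a (a x) = x" if x: "x \<in> carrier U" for x
    proof -
      have "r \<circ> r = id" by (simp add: r_def)
      then have "a \<otimes>\<^bsub>Aut_inf\<^esub> a = \<tau> id" using \<tau>_comp[OF r r] by (simp add: a_def)
      moreover have "\<tau> id x = x"
        unfolding \<tau>_def using \<alpha>_fixed[of "block_perm n id" UNIV x] bb[OF finitary_perms_id] x P_UNIV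
        by (simp add: block_perm_fixed)
      ultimately show ?thesis using app[OF ca ca x] by simp
    qed
    have "a \<otimes>\<^bsub>Aut_inf\<^esub> a = \<one>\<^bsub>Aut_inf\<^esub>"
      using aa mult_Aut_inf ca by (auto simp: carrier_Aut_inf one_Aut_inf compose_def)
    then have inv_a: "inv\<^bsub>Aut_inf\<^esub> a = a" using ca A.inv_equality by blast
    define u' where "u' = a \<otimes>\<^bsub>Aut_inf\<^esub> u \<otimes>\<^bsub>Aut_inf\<^esub> a"
    have cu': "u' \<in> carrier Aut_inf" unfolding u'_def using ca cs[OF u] by simp
    have u': "u' x = a (u (a x))" if "x \<in> carrier U" for x
      unfolding u'_def using app ca cs[OF u] that auto_closed[OF au[OF ca]] by simp
    have aP: "a x \<in> P D" if "x \<in> P A" "\<And>i. i \<in> A \<Longrightarrow> block_perm n r i \<in> D" for x A D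
      unfolding a_def using \<tau>_P[OF r] that .
    have u'_fixed: "u' x = x" if x: "x \<in> P (- B j)" for x
    proof -
      have "a x \<in> P (- B 0)"
        by (rule aP[OF x]) (auto simp: B_def block_perm_div[OF n] r_def transpose_eq_iff)
      then show ?thesis using u'[OF P_carrier[OF x]] s(3)[OF u] aa[OF P_carrier[OF x]] by simp
    qed
    have u'_j: "u' x \<in> P (B j)" if x: "x \<in> P (B j)" for x
    proof -
      have "a x \<in> P (B 0)" by (rule aP[OF x]) (auto simp: B_def block_perm_div[OF n] r_def)
      then have "u (a x) \<in> P (B 0)" using s0[OF u] by blast
      then have "a (u (a x)) \<in> P (B j)"
        by (rule aP) (auto simp: B_def block_perm_div[OF n] r_def)
      then show ?thesis using u'[OF P_carrier[OF x]] by simp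
    qed
    have "P (B j) \<subseteq> P (- B 0)" by (rule P_mono) (use j in \<open>auto simp: B_def\<close>)
    then have t_j: "t x = x" if "x \<in> P (B j)" for x
      using s(3)[OF t] that by blast
    \<comment> \<open>The complement of block \<open>j\<close> contains block 0, which
      \<open>t\<close> preserves, and otherwise only factors fixed by \<open>t\<close>.\<close>
    have t_nj: "t x \<in> P (- B j)" if "x \<in> P (- B j)" for x
    proof -
      have eq: "- B j = B 0 \<union> (- B 0 \<inter> - B j)" using j by (auto simp: B_def)
      have "P (B 0 \<union> (- B 0 \<inter> - B j)) \<subseteq> {x \<in> carrier U. t x \<in> P (- B j)}"
      proof (rule P_union)
        show "subgroup {x \<in> carrier U. t x \<in> P (- B j)} U"
          using subgroup_preimage[OF auto_hom[OF s(1)[OF t]] P_subgroup group_axioms] .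
        show "P (B 0) \<subseteq> {x \<in> carrier U. t x \<in> P (- B j)}"
        proof
          fix x assume x: "x \<in> P (B 0)"
          have "P (B 0) \<subseteq> P (- B j)" by (rule P_mono) (use eq in blast)
          then show "x \<in> {x \<in> carrier U. t x \<in> P (- B j)}" using s0[OF t x] P_carrier[OF x] by auto
        qed
        show "P (- B 0 \<inter> - B j) \<subseteq> {x \<in> carrier U. t x \<in> P (- B j)}"
        proof
          fix x assume x: "x \<in> P (- B 0 \<inter> - B j)"
          then have "x \<in> P (- B 0)" "x \<in> P (- B j)"
            using subsetD[OF P_mono[OF Int_lower1]] subsetD[OF P_mono[OF Int_lower2]] by blast+
          then show "x \<in> {x \<in> carrier U. t x \<in> P (- B j)}" using s(3)[OF t] P_carrier by simp
        qed
      qed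
      then show ?thesis using that unfolding eq[symmetric] by blast
    qed
    have "t \<otimes>\<^bsub>Aut_inf\<^esub> u' = u' \<otimes>\<^bsub>Aut_inf\<^esub> t"
    proof (rule auto_eqI[of _ _ "B j" "- B j"])
      show "(t \<otimes>\<^bsub>Aut_inf\<^esub> u') x = (u' \<otimes>\<^bsub>Aut_inf\<^esub> t) x" if x: "x \<in> P (B j)" for x
        using app[OF cs[OF t] cu' P_carrier[OF x]] app[OF cu' cs[OF t] P_carrier[OF x]]
          t_j[OF x] t_j[OF u'_j[OF x]] by simp
      show "(t \<otimes>\<^bsub>Aut_inf\<^esub> u') x = (u' \<otimes>\<^bsub>Aut_inf\<^esub> t) x" if x: "x \<in> P (- B j)" for x
        using app[OF cs[OF t] cu' P_carrier[OF x]] app[OF cu' cs[OF t] P_carrier[OF x]]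
          u'_fixed[OF x] u'_fixed[OF t_nj[OF x]] by simp
    qed (use cs[OF t] cu' in \<open>auto intro!: au\<close>)
    then show "t \<otimes>\<^bsub>Aut_inf\<^esub> (\<tau> (Transposition.transpose 0 j) \<otimes>\<^bsub>Aut_inf\<^esub> u \<otimes>\<^bsub>Aut_inf\<^esub> inv\<^bsub>Aut_inf\<^esub> \<tau> (Transposition.transpose 0 j))
        = \<tau> (Transposition.transpose 0 j) \<otimes>\<^bsub>Aut_inf\<^esub> u \<otimes>\<^bsub>Aut_inf\<^esub> inv\<^bsub>Aut_inf\<^esub> \<tau> (Transposition.transpose 0 j) \<otimes>\<^bsub>Aut_inf\<^esub> t"
      unfolding r_def[symmetric] a_def[symmetric] inv_a u'_def .
  qed
  then show "\<exists>\<tau>. commuting_conjugates Aut_inf S \<tau>" by blast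
qed

lemma Xsep_boundedly_acyclic_Aut_inf:
  "Xsep_boundedly_acyclic TYPE('e::banach) TYPE('f::banach) Aut_inf"
  by (rule has_commuting_conjugates_imp_Xsep_boundedly_acyclic[OF group_Aut_inf has_commuting_conjugates_Aut_inf])

end

section \<open>Free products, direct products and direct sums\<close>

definition permute_letters :: "('i \<Rightarrow> 'j) \<Rightarrow> ('i \<times> 'a) list \<Rightarrow> ('j \<times> 'a) list"
  where "permute_letters p = map (\<lambda>(i, g). (p i, g))"

lemma permute_letters_simps [simp]:
  "permute_letters p [] = []"
  "permute_letters p ((i, g) # w) = (p i, g) # permute_letters p w"
  by (simp_all add: permute_letters_def)

lemma permute_letters_comp: "permute_letters (p \<circ> q) w = permute_letters p (permute_letters q w)"
  by (induction w) auto

text \<open>Multiplication of words compares indices, and an injective \<open>p\<close> does not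
  change the outcome.\<close>

lemma permute_letters_letter_mult:
  assumes "inj p"
  shows "permute_letters p (letter_mult (\<lambda>_. \<Gamma>) (i, g) w) = letter_mult (\<lambda>_. \<Gamma>) (p i, g) (permute_letters p w)"
  using assms by (cases w) (auto simp: inj_eq)

lemma permute_letters_foldr:
  assumes "inj p"
  shows "permute_letters p (foldr (letter_mult (\<lambda>_. \<Gamma>)) u v)
    = foldr (letter_mult (\<lambda>_. \<Gamma>)) (permute_letters p u) (permute_letters p v)"
  by (induction u) (auto simp: permute_letters_letter_mult[OF assms])

lemma permute_letters_reduced:
  assumes "inj p" "w \<in> reduced_words A (\<lambda>_. \<Gamma>)"
  shows "permute_letters p w \<in> reduced_words (p ` A) (\<lambda>_. \<Gamma>)"
  using assms(2)
proof (induction w)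
  case (Cons x w)
  then show ?case
    using assms(1) by (cases x; cases w) (auto simp: reduced_words_Cons inj_eq)
qed simp

lemma permute_letters_fixed:
  assumes "\<And>i. i \<in> A \<Longrightarrow> p i = i" "w \<in> reduced_words A (\<lambda>_. \<Gamma>)"
  shows "permute_letters p w = w"
  using assms(2)
proof (induction w)
  case (Cons x w)
  then show ?case using assms(1) by (cases x) (auto simp: reduced_words_Cons)
qed simp

lemma reduced_words_mono: "A \<subseteq> B \<Longrightarrow> reduced_words A G \<subseteq> reduced_words B G"
  by (auto simp: reduced_words_def)

context
  fixes \<Gamma> :: "('a, 'b) monoid_scheme"
  assumes \<Gamma>: "group \<Gamma>"
begin

text \<open>Multiplication of words does not refer to the index set, so the free product over
  \<open>A\<close> is a group under the same operations; by uniqueness its inverses are those of the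
  large group.\<close>

lemma subgroup_reduced_words: "subgroup (reduced_words A (\<lambda>_. \<Gamma>)) (free_product UNIV (\<lambda>_::'i. \<Gamma>))"
proof -
  interpret U: group "free_product UNIV (\<lambda>_::'i. \<Gamma>)" using \<Gamma> by (intro group_free_product)
  interpret V: group "free_product A (\<lambda>_::'i. \<Gamma>)" using \<Gamma> by (intro group_free_product)
  have [simp]: "carrier (free_product A (\<lambda>_. \<Gamma>)) = reduced_words A (\<lambda>_. \<Gamma>)"
    "mult (free_product A (\<lambda>_. \<Gamma>)) = mult (free_product UNIV (\<lambda>_::'i. \<Gamma>))"
    "one (free_product A (\<lambda>_. \<Gamma>)) = one (free_product UNIV (\<lambda>_::'i. \<Gamma>))"
    "carrier (free_product UNIV (\<lambda>_::'i. \<Gamma>)) = reduced_words UNIV (\<lambda>_. \<Gamma>)"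
    by (simp_all add: free_product_def)
  show ?thesis
  proof (rule U.subgroupI)
    show sub: "reduced_words A (\<lambda>_. \<Gamma>) \<subseteq> carrier (free_product UNIV (\<lambda>_::'i. \<Gamma>))"
      using reduced_words_mono[of A UNIV] by simp
    show "reduced_words A (\<lambda>_. \<Gamma>) \<noteq> {}" using reduced_words_Nil by blast
    fix u v assume u: "u \<in> reduced_words A (\<lambda>_. \<Gamma>)"
    obtain w where w: "w \<in> reduced_words A (\<lambda>_. \<Gamma>)"
      "w \<otimes>\<^bsub>free_product UNIV (\<lambda>_::'i. \<Gamma>)\<^esub> u = \<one>\<^bsub>free_product UNIV (\<lambda>_::'i. \<Gamma>)\<^esub>"
      using V.l_inv_ex[of u] u by auto
    then have "inv\<^bsub>free_product UNIV (\<lambda>_::'i. \<Gamma>)\<^esub> u = w"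
      using U.inv_equality[of w u] u sub by auto
    then show "inv\<^bsub>free_product UNIV (\<lambda>_::'i. \<Gamma>)\<^esub> u \<in> reduced_words A (\<lambda>_. \<Gamma>)"
      using w by simp
    assume v: "v \<in> reduced_words A (\<lambda>_. \<Gamma>)"
    show "u \<otimes>\<^bsub>free_product UNIV (\<lambda>_::'i. \<Gamma>)\<^esub> v \<in> reduced_words A (\<lambda>_. \<Gamma>)"
      using V.m_closed[of u v] u v by simp
  qed
qed

text \<open>A reduced word is the product of its letters, because multiplying by a letter from a
  factor other than the first one merely prepends it. This supplies \<open>P_union\<close>.\<close>

lemma reduced_words_subset_subgroup:
  assumes K: "subgroup K (free_product UNIV (\<lambda>_::'i. \<Gamma>))"
    and letters: "\<And>i g. i \<in> A \<Longrightarrow> g \<in> carrier \<Gamma> \<Longrightarrow> g \<noteq> \<one>\<^bsub>\<Gamma>\<^esub> \<Longrightarrow> [(i, g)] \<in> K"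
  shows "reduced_words A (\<lambda>_. \<Gamma>) \<subseteq> K"
proof
  fix w assume "w \<in> reduced_words A (\<lambda>_. \<Gamma>)"
  then show "w \<in> K"
  proof (induction w)
    case Nil
    then show ?case using subgroup.one_closed[OF K] by (simp add: free_product_def)
  next
    case (Cons x w)
    obtain i g where x: "x = (i, g)" by (cases x)
    have ig: "i \<in> A" "g \<in> carrier \<Gamma>" "g \<noteq> \<one>\<^bsub>\<Gamma>\<^esub>" "w \<in> reduced_words A (\<lambda>_. \<Gamma>)"
      "w = [] \<or> i \<noteq> fst (hd w)"
      using Cons.prems by (auto simp: x reduced_words_Cons)
    have "[(i, g)] \<otimes>\<^bsub>free_product UNIV (\<lambda>_::'i. \<Gamma>)\<^esub> w \<in> K"
      using subgroup.m_closed[OF K letters[OF ig(1-3)] Cons.IH[OF ig(4)]] .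
    moreover have "[(i, g)] \<otimes>\<^bsub>free_product UNIV (\<lambda>_::'i. \<Gamma>)\<^esub> w = x # w"
      using ig by (cases w) (auto simp: free_product_def x)
    ultimately show ?case by simp
  qed
qed

lemma permute_letters_auto:
  assumes "bij p"
  shows "restrict (permute_letters p) (carrier (free_product UNIV (\<lambda>_::'i. \<Gamma>)))
    \<in> auto (free_product UNIV (\<lambda>_. \<Gamma>))"
proof -
  interpret U: group "free_product UNIV (\<lambda>_::'i. \<Gamma>)" using \<Gamma> by (intro group_free_product)
  have C: "carrier (free_product UNIV (\<lambda>_::'i. \<Gamma>)) = reduced_words UNIV (\<lambda>_. \<Gamma>)"
    by (simp add: free_product_def)
  have cl: "permute_letters q w \<in> reduced_words UNIV (\<lambda>_. \<Gamma>)"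
    if "inj q" "w \<in> reduced_words UNIV (\<lambda>_. \<Gamma>)" for q :: "'i \<Rightarrow> 'i" and w
    using permute_letters_reduced[OF that] reduced_words_mono[of "q ` UNIV" UNIV "\<lambda>_. \<Gamma>"] by auto
  have ip: "inj p" "inj (Hilbert_Choice.inv p)"
    using assms bij_imp_bij_inv bij_is_inj by blast+
  have "permute_letters id w = w" for w :: "('i \<times> 'a) list" by (induction w) auto
  then have inv: "permute_letters p (permute_letters (Hilbert_Choice.inv p) w) = w"
    "permute_letters (Hilbert_Choice.inv p) (permute_letters p w) = w" for w :: "('i \<times> 'a) list"
    using assms by (simp_all add: bij_is_surj surj_iff[THEN iffD1] inv_o_cancel[OF ip(1)] flip: permute_letters_comp)
  have "bij_betw (permute_letters p) (reduced_words UNIV (\<lambda>_. \<Gamma>)) (reduced_words UNIV (\<lambda>_. \<Gamma>))"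
    by (rule bij_betw_byWitness[where f' = "permute_letters (Hilbert_Choice.inv p)"])
      (use inv cl ip in auto)
  then have "restrict (permute_letters p) (reduced_words UNIV (\<lambda>_. \<Gamma>)) \<in> Bij (reduced_words UNIV (\<lambda>_. \<Gamma>))"
    by (simp add: Bij_def)
  moreover have "restrict (permute_letters p) (reduced_words UNIV (\<lambda>_. \<Gamma>))
      \<in> hom (free_product UNIV (\<lambda>_. \<Gamma>)) (free_product UNIV (\<lambda>_. \<Gamma>))"
  proof (rule homI)
    show "restrict (permute_letters p) (reduced_words UNIV (\<lambda>_. \<Gamma>)) u
        \<in> carrier (free_product UNIV (\<lambda>_. \<Gamma>))"
      if "u \<in> carrier (free_product UNIV (\<lambda>_. \<Gamma>))" for u
      using cl[OF ip(1)] that by (simp add: C)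
    show "restrict (permute_letters p) (reduced_words UNIV (\<lambda>_. \<Gamma>)) (u \<otimes>\<^bsub>free_product UNIV (\<lambda>_. \<Gamma>)\<^esub> v)
        = restrict (permute_letters p) (reduced_words UNIV (\<lambda>_. \<Gamma>)) u \<otimes>\<^bsub>free_product UNIV (\<lambda>_. \<Gamma>)\<^esub>
          restrict (permute_letters p) (reduced_words UNIV (\<lambda>_. \<Gamma>)) v"
      if uv: "u \<in> carrier (free_product UNIV (\<lambda>_. \<Gamma>))" "v \<in> carrier (free_product UNIV (\<lambda>_. \<Gamma>))" for u v
      using U.m_closed[OF uv] uv
      by (simp add: C) (simp add: free_product_def permute_letters_foldr[OF ip(1)])
  qed
  ultimately show ?thesis by (simp add: auto_def C)
qed

lemma permuted_factors_free_product:
  "permuted_factors (free_product UNIV (\<lambda>_. \<Gamma>)) (\<lambda>A. reduced_words A (\<lambda>_. \<Gamma>))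
    (\<lambda>p. restrict (permute_letters p) (carrier (free_product UNIV (\<lambda>_. \<Gamma>))))"
proof (intro permuted_factors.intro permuted_factors_axioms.intro)
  have C: "carrier (free_product UNIV (\<lambda>_::nat. \<Gamma>)) = reduced_words UNIV (\<lambda>_. \<Gamma>)"
    by (simp add: free_product_def)
  have U: "w \<in> reduced_words UNIV (\<lambda>_. \<Gamma>)" if "w \<in> reduced_words A (\<lambda>_. \<Gamma>)" for w and A :: "nat set"
    using that reduced_words_mono[of A UNIV] by blast
  show "group (free_product UNIV (\<lambda>_::nat. \<Gamma>))" using \<Gamma> by (intro group_free_product)
  show "subgroup (reduced_words A (\<lambda>_. \<Gamma>)) (free_product UNIV (\<lambda>_::nat. \<Gamma>))" for A
    by (rule subgroup_reduced_words)
  show "reduced_words UNIV (\<lambda>_. \<Gamma>) = carrier (free_product UNIV (\<lambda>_::nat. \<Gamma>))" by (simp add: C)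
  show "reduced_words A (\<lambda>_. \<Gamma>) \<subseteq> reduced_words B (\<lambda>_. \<Gamma>)" if "A \<subseteq> B" for A B :: "nat set"
    using that by (rule reduced_words_mono)
  show "reduced_words (A \<union> B) (\<lambda>_. \<Gamma>) \<subseteq> K"
    if "subgroup K (free_product UNIV (\<lambda>_::nat. \<Gamma>))" "reduced_words A (\<lambda>_. \<Gamma>) \<subseteq> K"
      "reduced_words B (\<lambda>_. \<Gamma>) \<subseteq> K" for A B K
    using that(2,3) by (intro reduced_words_subset_subgroup[OF that(1)])
      (auto simp: subset_iff reduced_words_Cons)
  show "restrict (permute_letters p) (carrier (free_product UNIV (\<lambda>_. \<Gamma>)))
      \<in> auto (free_product UNIV (\<lambda>_::nat. \<Gamma>))" if "bij p" for p
    using that by (rule permute_letters_auto)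
  show "restrict (permute_letters (p \<circ> q)) (carrier (free_product UNIV (\<lambda>_. \<Gamma>))) x =
      restrict (permute_letters p) (carrier (free_product UNIV (\<lambda>_. \<Gamma>)))
        (restrict (permute_letters q) (carrier (free_product UNIV (\<lambda>_. \<Gamma>))) x)"
    if "bij p" "bij q" "x \<in> carrier (free_product UNIV (\<lambda>_::nat. \<Gamma>))" for p q :: "nat \<Rightarrow> nat" and x
    using that permute_letters_reduced[OF bij_is_inj[OF that(2)], of x UNIV \<Gamma>]
    by (auto simp: C permute_letters_comp intro: U)
  show "restrict (permute_letters p) (carrier (free_product UNIV (\<lambda>_. \<Gamma>))) x \<in> reduced_words (p ` A) (\<lambda>_. \<Gamma>)"
    if "bij p" "x \<in> reduced_words A (\<lambda>_. \<Gamma>)" for p :: "nat \<Rightarrow> nat" and x A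
    using permute_letters_reduced[OF bij_is_inj[OF that(1)] that(2)] U[OF that(2)] by (simp add: C)
  show "restrict (permute_letters p) (carrier (free_product UNIV (\<lambda>_. \<Gamma>))) x = x"
    if "bij p" "\<And>i. i \<in> A \<Longrightarrow> p i = i" "x \<in> reduced_words A (\<lambda>_. \<Gamma>)" for p :: "nat \<Rightarrow> nat" and x A
    using permute_letters_fixed[OF that(2,3)] U[OF that(3)] by (simp add: C)
qed

lemma Xsep_boundedly_acyclic_Aut_inf_free_product:
  "Xsep_boundedly_acyclic TYPE('e::banach) TYPE('f::banach) (Aut_inf_free_product \<Gamma>)"
proof -
  let ?U = "free_product UNIV (\<lambda>_::nat. \<Gamma>)" and ?V = "\<lambda>n. free_product {..<n} (\<lambda>_::nat. \<Gamma>)"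
  interpret permuted_factors ?U "\<lambda>A. reduced_words A (\<lambda>_. \<Gamma>)"
    "\<lambda>p. restrict (permute_letters p) (carrier ?U)"
    by (rule permuted_factors_free_product)
  have CV: "carrier (free_product A (\<lambda>_. \<Gamma>)) = reduced_words A (\<lambda>_. \<Gamma>)"
    "mult (?V n) = mult ?U" for A :: "nat set" and n
    by (simp_all add: free_product_def)
  have "(\<psi> \<in> auto ?U \<and> (\<exists>\<phi>\<in>auto (?V n). (\<forall>w\<in>carrier (?V n). \<psi> w = \<phi> w) \<and>
        (\<forall>i\<ge>n. \<forall>g\<in>carrier \<Gamma>. \<psi> (free_product_incl (\<lambda>_. \<Gamma>) i g) = free_product_incl (\<lambda>_. \<Gamma>) i g)))
      \<longleftrightarrow> \<psi> \<in> stage n" (is "?L \<longleftrightarrow> ?R") for n \<psi>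
  proof
    assume ?L
    then obtain \<phi> where \<psi>: "\<psi> \<in> auto ?U" and \<phi>: "\<phi> \<in> auto (?V n)"
      and eq: "\<And>w. w \<in> reduced_words {..<n} (\<lambda>_. \<Gamma>) \<Longrightarrow> \<psi> w = \<phi> w"
      and fx: "\<And>i g. n \<le> i \<Longrightarrow> g \<in> carrier \<Gamma> \<Longrightarrow> \<psi> (free_product_incl (\<lambda>_. \<Gamma>) i g) = free_product_incl (\<lambda>_. \<Gamma>) i g"
      by (auto simp: CV)
    have "\<phi> ` reduced_words {..<n} (\<lambda>_. \<Gamma>) = reduced_words {..<n} (\<lambda>_. \<Gamma>)"
      using \<phi> by (simp add: auto_def Bij_def CV bij_betw_def)
    then have "\<psi> ` reduced_words {..<n} (\<lambda>_. \<Gamma>) = reduced_words {..<n} (\<lambda>_. \<Gamma>)"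
      using eq by (simp cong: image_cong)
    \<comment> \<open>The defining condition speaks of single letters; the equalizer with the
      identity is a subgroup and hence contains all words in these letters.\<close>
    moreover have "reduced_words {n..} (\<lambda>_. \<Gamma>) \<subseteq> {x \<in> carrier ?U. \<psi> x = (\<lambda>x\<in>carrier ?U. x) x}"
    proof (rule reduced_words_subset_subgroup[OF subgroup_equalizer])
      show "\<psi> \<in> hom ?U ?U" using auto_hom[OF \<psi>] .
      show "(\<lambda>x\<in>carrier ?U. x) \<in> hom ?U ?U" using auto_hom[OF id_in_auto] .
      show "group ?U" by (rule group_axioms)
      fix i g assume "i \<in> {n..}" "g \<in> carrier \<Gamma>" "g \<noteq> \<one>\<^bsub>\<Gamma>\<^esub>"
      then show "[(i, g)] \<in> {x \<in> carrier ?U. \<psi> x = (\<lambda>x\<in>carrier ?U. x) x}"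
        using fx[of i g] by (simp add: CV reduced_words_Cons free_product_incl_def)
    qed
    ultimately show ?R using \<psi> by (auto simp: stage_def)
  next
    assume R: ?R
    have \<psi>: "\<psi> \<in> auto ?U" and im: "\<psi> ` reduced_words {..<n} (\<lambda>_. \<Gamma>) = reduced_words {..<n} (\<lambda>_. \<Gamma>)"
      and fx: "\<And>x. x \<in> reduced_words {n..} (\<lambda>_. \<Gamma>) \<Longrightarrow> \<psi> x = x"
      using R by (auto simp: stage_def)
    have sub: "reduced_words {..<n} (\<lambda>_. \<Gamma>) \<subseteq> carrier ?U"
      using reduced_words_mono[of "{..<n}" UNIV] by (simp add: CV)
    interpret V: group "?V n" using \<Gamma> by (intro group_free_product)
    \<comment> \<open>The finite stage uses the same words and the same multiplication, so plain
      restriction yields its automorphism.\<close>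
    let ?\<phi> = "restrict \<psi> (reduced_words {..<n} (\<lambda>_. \<Gamma>))"
    have "inj_on \<psi> (reduced_words {..<n} (\<lambda>_. \<Gamma>))"
      using auto_bij[OF \<psi>] sub by (auto simp: bij_betw_def intro: inj_on_subset)
    then have "?\<phi> \<in> Bij (carrier (?V n))"
      using im by (simp add: Bij_def CV bij_betw_def)
    moreover have "?\<phi> \<in> hom (?V n) (?V n)"
    proof (rule homI)
      show "?\<phi> u \<in> carrier (?V n)" if "u \<in> carrier (?V n)" for u
        using that imageI[of u "reduced_words {..<n} (\<lambda>_. \<Gamma>)" \<psi>] unfolding im by (simp add: CV)
      show "?\<phi> (u \<otimes>\<^bsub>?V n\<^esub> v) = ?\<phi> u \<otimes>\<^bsub>?V n\<^esub> ?\<phi> v"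
        if uv: "u \<in> carrier (?V n)" "v \<in> carrier (?V n)" for u v
        using V.m_closed[OF uv] uv subsetD[OF sub] hom_mult[OF auto_hom[OF \<psi>], of u v]
        by (simp add: CV)
    qed
    ultimately have "?\<phi> \<in> auto (?V n)" by (simp add: auto_def)
    moreover have "\<psi> (free_product_incl (\<lambda>_. \<Gamma>) i g) = free_product_incl (\<lambda>_. \<Gamma>) i g"
      if "n \<le> i" "g \<in> carrier \<Gamma>" for i g
      using that by (intro fx) (simp add: free_product_incl_def reduced_words_Cons)
    ultimately show ?L using \<psi> by (intro conjI bexI[of _ ?\<phi>]) (simp_all add: CV)
  qed
  then have "Aut_inf_free_product \<Gamma> = Aut_inf"
    unfolding Aut_inf_free_product_def Aut_inf_def by (simp add: set_eq_iff)
  then show ?thesis using Xsep_boundedly_acyclic_Aut_inf by simp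
qed

end

text \<open>Treats direct products and direct sums together: sequences with entrywise operations and
  the closure properties that both share. Finite tuples padded with the unit lie in both, so the
  same finite products provide the stages.\<close>

locale sequence_group = group U + \<Gamma>: group \<Gamma> for U :: "(nat \<Rightarrow> 'a) monoid" (structure)
    and \<Gamma> :: "('a, 'b) monoid_scheme" +
  assumes entries: "x \<in> carrier U \<Longrightarrow> x i \<in> carrier \<Gamma>"
    and mult_eq: "x \<otimes> y = (\<lambda>i. x i \<otimes>\<^bsub>\<Gamma>\<^esub> y i)"
    and one_eq: "\<one> = (\<lambda>_. \<one>\<^bsub>\<Gamma>\<^esub>)"
    and truncate_closed: "x \<in> carrier U \<Longrightarrow> (\<lambda>i. if i \<in> A then x i else \<one>\<^bsub>\<Gamma>\<^esub>) \<in> carrier U"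
    and permute_closed: "x \<in> carrier U \<Longrightarrow> bij p \<Longrightarrow> x \<circ> p \<in> carrier U"
    and extend_closed: "z \<in> PiE {..<n} (\<lambda>_. carrier \<Gamma>) \<Longrightarrow> (\<lambda>i. if i < n then z i else \<one>\<^bsub>\<Gamma>\<^esub>) \<in> carrier U"
begin

definition supported :: "nat set \<Rightarrow> (nat \<Rightarrow> 'a) set"
  where "supported A = {x \<in> carrier U. \<forall>i. i \<notin> A \<longrightarrow> x i = \<one>\<^bsub>\<Gamma>\<^esub>}"

text \<open>The inverse makes this a left action that carries the support by \<open>p\<close>; the
  restriction to the carrier gives the extensionality demanded by \<open>auto\<close>.\<close>

definition permute :: "(nat \<Rightarrow> nat) \<Rightarrow> (nat \<Rightarrow> 'a) \<Rightarrow> nat \<Rightarrow> 'a"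
  where "permute p = (\<lambda>x\<in>carrier U. x \<circ> Hilbert_Choice.inv p)"

lemma inv_eq: "x \<in> carrier U \<Longrightarrow> inv x = (\<lambda>i. inv\<^bsub>\<Gamma>\<^esub> x i)"
proof
  fix i assume x: "x \<in> carrier U"
  have "(inv x \<otimes> x) i = \<one>\<^bsub>\<Gamma>\<^esub>" using l_inv[OF x] one_eq by simp
  then have "(inv x) i \<otimes>\<^bsub>\<Gamma>\<^esub> x i = \<one>\<^bsub>\<Gamma>\<^esub>" by (simp add: mult_eq)
  then show "(inv x) i = inv\<^bsub>\<Gamma>\<^esub> x i"
    using \<Gamma>.inv_equality[of "(inv x) i" "x i"] entries[OF x] entries[OF inv_closed[OF x]] by simp
qed

sublocale permuted_factors U supported permute
proof (intro permuted_factors.intro permuted_factors_axioms.intro group_axioms)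
  show "subgroup (supported A) U" for A
  proof (rule subgroupI)
    show "supported A \<noteq> {}" using one_closed by (auto simp: supported_def one_eq)
    show "inv x \<in> supported A" if "x \<in> supported A" for x
      using that inv_closed[of x] inv_eq[of x] by (auto simp: supported_def)
    show "x \<otimes> y \<in> supported A" if "x \<in> supported A" "y \<in> supported A" for x y
      using that m_closed[of x y] mult_eq[of x y] by (auto simp: supported_def)
  qed (auto simp: supported_def)
  show "supported UNIV = carrier U" by (simp add: supported_def)
  show "supported A \<subseteq> supported B" if "A \<subseteq> B" for A B using that by (auto simp: supported_def)
  show "supported (A \<union> B) \<subseteq> K" if K: "subgroup K U" "supported A \<subseteq> K" "supported B \<subseteq> K" for A B K
  proof
    fix x assume x: "x \<in> supported (A \<union> B)"
    \<comment> \<open>The second part is cut off by the complement of \<open>A\<close> rather than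
      by \<open>B\<close>, which also handles overlapping \<open>A\<close> and
      \<open>B\<close>.\<close>
    let ?y = "\<lambda>i. if i \<in> A then x i else \<one>\<^bsub>\<Gamma>\<^esub>" and ?z = "\<lambda>i. if i \<in> - A then x i else \<one>\<^bsub>\<Gamma>\<^esub>"
    have "?y \<in> supported A" "?z \<in> supported B"
      using x truncate_closed[of x A] truncate_closed[of x "- A"] by (auto simp: supported_def)
    then have "?y \<otimes> ?z \<in> K" using K subgroup.m_closed[OF K(1)] by blast
    moreover have "?y \<otimes> ?z = x" using x entries by (auto simp: mult_eq supported_def)
    ultimately show "x \<in> K" by simp
  qed
  have ib: "bij (Hilbert_Choice.inv p)" if "bij p" for p :: "nat \<Rightarrow> nat" using bij_imp_bij_inv that .
  show "permute p \<in> auto U" if p: "bij p" for p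
  proof -
    have pp: "Hilbert_Choice.inv p \<circ> p = id" "p \<circ> Hilbert_Choice.inv p = id"
      using p by (simp_all add: bij_is_inj bij_is_surj surj_iff[symmetric])
    have "bij_betw (\<lambda>x. x \<circ> Hilbert_Choice.inv p) (carrier U) (carrier U)"
    proof (rule bij_betw_byWitness[where f' = "\<lambda>x. x \<circ> p"])
      show "(\<lambda>x. x \<circ> Hilbert_Choice.inv p) ` carrier U \<subseteq> carrier U"
        using permute_closed ib[OF p] by blast
      show "(\<lambda>x. x \<circ> p) ` carrier U \<subseteq> carrier U" using permute_closed p by blast
    qed (simp_all add: comp_assoc pp)
    moreover have "permute p \<in> hom U U"
    proof (rule homI)
      show "permute p x \<in> carrier U" if "x \<in> carrier U" for x
        using permute_closed[OF that ib[OF p]] that by (simp add: permute_def)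
      show "permute p (x \<otimes> y) = permute p x \<otimes> permute p y"
        if "x \<in> carrier U" "y \<in> carrier U" for x y
        using m_closed[OF that] that unfolding permute_def by (simp add: mult_eq comp_def)
    qed
    ultimately show ?thesis by (simp add: auto_def Bij_def permute_def)
  qed
  show "permute (p \<circ> q) x = permute p (permute q x)" if "bij p" "bij q" "x \<in> carrier U" for p q x
    using that permute_closed[OF that(3) ib[OF that(2)]] by (simp add: permute_def o_inv_distrib comp_assoc)
  show "permute p x \<in> supported (p ` A)" if "bij p" "x \<in> supported A" for p x A
    using that permute_closed[OF _ ib[OF that(1)]]
    by (auto simp: supported_def permute_def) (metis bij_inv_eq_iff image_eqI)
  show "permute p x = x" if p: "bij p" "\<And>i. i \<in> A \<Longrightarrow> p i = i" and x: "x \<in> supported A" for p x A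
  proof -
    \<comment> \<open>If neither index lies in \<open>A\<close>, both entries are trivial; if one
      does, \<open>p\<close> fixes it and the two indices coincide.\<close>
    have "x (Hilbert_Choice.inv p i) = x i" for i
    proof (cases "i \<in> A \<or> Hilbert_Choice.inv p i \<in> A")
      case True
      then have "Hilbert_Choice.inv p i = i" using p by (metis bij_inv_eq_iff)
      then show ?thesis by simp
    next
      case False
      then show ?thesis using x by (simp add: supported_def)
    qed
    then show ?thesis using x by (auto simp: permute_def supported_def)
  qed
qed

lemma stage_iff:
  "\<psi> \<in> stage n \<longleftrightarrow> \<psi> \<in> auto U \<and> (\<exists>\<phi>\<in>auto (product_group {..<n} (\<lambda>_. \<Gamma>)).
     \<forall>x\<in>carrier U. \<psi> x = (\<lambda>i. if i < n then \<phi> (restrict x {..<n}) i else x i))"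
    (is "?R \<longleftrightarrow> ?L")
proof
  let ?V = "product_group {..<n} (\<lambda>_. \<Gamma>)"
  define ext where "ext z = (\<lambda>i. if i < n then z i else \<one>\<^bsub>\<Gamma>\<^esub>)" for z :: "nat \<Rightarrow> 'a"
  interpret V: group ?V using \<Gamma>.group_axioms by simp
  have ext: "ext z \<in> supported {..<n}" if "z \<in> carrier ?V" for z
    using extend_closed that by (auto simp: supported_def ext_def)
  have restr: "restrict x {..<n} \<in> carrier ?V" if "x \<in> carrier U" for x
    using entries that by auto
  have ext_restr: "ext (restrict x {..<n}) = x" if "x \<in> supported {..<n}" for x
    using that by (auto simp: ext_def supported_def)
  have restr_ext: "restrict (ext z) {..<n} = z" if "z \<in> carrier ?V" for z
    using that by (auto simp: ext_def PiE_iff extensional_def)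
  {
    assume ?L
    then obtain \<phi> where \<psi>: "\<psi> \<in> auto U" and \<phi>: "\<phi> \<in> auto ?V"
      and eq: "\<And>x. x \<in> carrier U \<Longrightarrow> \<psi> x = (\<lambda>i. if i < n then \<phi> (restrict x {..<n}) i else x i)"
      by blast
    have bij: "bij_betw \<phi> (carrier ?V) (carrier ?V)" using \<phi> by (simp add: auto_def Bij_def)
    have "\<psi> x \<in> supported {..<n}" if "x \<in> supported {..<n}" for x
      using that eq[of x] auto_closed[OF \<psi>, of x] by (auto simp: supported_def)
    moreover have "x \<in> \<psi> ` supported {..<n}" if x: "x \<in> supported {..<n}" for x
    proof -
      have "restrict x {..<n} \<in> \<phi> ` carrier ?V"
        using restr P_carrier[OF x] bij by (simp add: bij_betw_def)
      then obtain z where z: "z \<in> carrier ?V" "\<phi> z = restrict x {..<n}" by auto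
      have "\<psi> (ext z) = ext (restrict x {..<n})"
        using eq[OF P_carrier[OF ext[OF z(1)]]] restr_ext[OF z(1)] z(2) by (auto simp: ext_def)
      then show ?thesis using ext_restr[OF x] ext[OF z(1)] by (metis image_eqI)
    qed
    moreover have "\<psi> x = x" if x: "x \<in> supported {n..}" for x
    proof -
      have "restrict x {..<n} = \<one>\<^bsub>?V\<^esub>" using x by (auto simp: supported_def)
      then have "\<phi> (restrict x {..<n}) = \<one>\<^bsub>?V\<^esub>"
        using \<phi> hom_one[OF _ V.group_axioms V.group_axioms, of \<phi>] by (simp add: auto_def)
      then show ?thesis using eq[OF P_carrier[OF x]] x by (auto simp: supported_def)
    qed
    ultimately show ?R using \<psi> by (auto simp: stage_def)
  }
  {
    assume ?R
    then have \<psi>: "\<psi> \<in> auto U" and im: "\<psi> ` supported {..<n} = supported {..<n}"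
      and fx: "\<And>x. x \<in> supported {n..} \<Longrightarrow> \<psi> x = x"
      by (auto simp: stage_def)
    \<comment> \<open>Transport of \<open>\<psi>\<close> along the identification of the finite
      product with \<open>supported {..<n}\<close> by padding and restricting.\<close>
    define \<phi> where "\<phi> = (\<lambda>z\<in>carrier ?V. restrict (\<psi> (ext z)) {..<n})"
    have \<psi>s: "\<psi> x \<in> supported {..<n}" if "x \<in> supported {..<n}" for x using that im by blast
    have \<phi>_closed: "\<phi> z \<in> carrier ?V" if "z \<in> carrier ?V" for z
      using that restr P_carrier[OF \<psi>s[OF ext]] by (simp only: \<phi>_def restrict_apply')
    have "\<phi> \<in> hom ?V ?V"
    proof (rule homI)
      show "\<phi> z \<in> carrier ?V" if "z \<in> carrier ?V" for z using \<phi>_closed that .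
      fix z w assume zw: "z \<in> carrier ?V" "w \<in> carrier ?V"
      have "ext (z \<otimes>\<^bsub>?V\<^esub> w) = ext z \<otimes> ext w" by (auto simp: ext_def mult_eq)
      then have "\<psi> (ext (z \<otimes>\<^bsub>?V\<^esub> w)) = \<psi> (ext z) \<otimes> \<psi> (ext w)"
        using hom_mult[OF auto_hom[OF \<psi>] P_carrier[OF ext[OF zw(1)]] P_carrier[OF ext[OF zw(2)]]] by simp
      then show "\<phi> (z \<otimes>\<^bsub>?V\<^esub> w) = \<phi> z \<otimes>\<^bsub>?V\<^esub> \<phi> w"
        using V.m_closed[OF zw] zw unfolding \<phi>_def by (simp only: restrict_apply') (auto simp: mult_eq)
    qed
    moreover have "bij_betw \<phi> (carrier ?V) (carrier ?V)"
      unfolding bij_betw_def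
    proof
      show "inj_on \<phi> (carrier ?V)"
      proof (rule inj_onI)
        fix z w assume zw: "z \<in> carrier ?V" "w \<in> carrier ?V" and "\<phi> z = \<phi> w"
        then have "ext (restrict (\<psi> (ext z)) {..<n}) = ext (restrict (\<psi> (ext w)) {..<n})"
          by (simp only: \<phi>_def restrict_apply')
        then have "\<psi> (ext z) = \<psi> (ext w)" using ext_restr \<psi>s ext zw by simp
        then have "ext z = ext w"
          using auto_bij[OF \<psi>] P_carrier[OF ext[OF zw(1)]] P_carrier[OF ext[OF zw(2)]]
          by (auto simp: bij_betw_def inj_on_def)
        then show "z = w" using restr_ext zw by metis
      qed
      show "\<phi> ` carrier ?V = carrier ?V"
      proof
        show "carrier ?V \<subseteq> \<phi> ` carrier ?V"
        proof
          fix w assume w: "w \<in> carrier ?V"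
          then have "ext w \<in> \<psi> ` supported {..<n}" unfolding im by (rule ext)
          then obtain x where x: "x \<in> supported {..<n}" "\<psi> x = ext w" by auto
          then have "\<phi> (restrict x {..<n}) = w"
            using restr[OF P_carrier[OF x(1)]] ext_restr[OF x(1)] restr_ext[OF w]
            by (simp only: \<phi>_def restrict_apply')
          then show "w \<in> \<phi> ` carrier ?V" using restr[OF P_carrier[OF x(1)]] by (metis image_eqI)
        qed
      qed (use \<phi>_closed in blast)
    qed
    moreover have "\<phi> \<in> extensional (carrier ?V)" by (simp add: \<phi>_def)
    ultimately have "\<phi> \<in> auto ?V" by (simp add: auto_def Bij_def del: carrier_product_group)
    moreover have "\<psi> x = (\<lambda>i. if i < n then \<phi> (restrict x {..<n}) i else x i)" if x: "x \<in> carrier U" for x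
    proof -
      \<comment> \<open>\<open>\<psi>\<close> is known on sequences supported below \<open>n\<close>
        and on those supported from \<open>n\<close> on; a general sequence is the product of two
        such parts.\<close>
      let ?y = "ext (restrict x {..<n})" and ?z = "\<lambda>i. if i \<in> {n..} then x i else \<one>\<^bsub>\<Gamma>\<^esub>"
      have y: "?y \<in> supported {..<n}" and z: "?z \<in> supported {n..}"
        using ext[OF restr[OF x]] truncate_closed[OF x, of "{n..}"] by (auto simp: supported_def)
      have "x = ?y \<otimes> ?z" using entries[OF x] by (auto simp: mult_eq ext_def)
      then have "\<psi> x = \<psi> ?y \<otimes> ?z"
        using hom_mult[OF auto_hom[OF \<psi>] P_carrier[OF y] P_carrier[OF z]] fx[OF z] by simp
      then show ?thesis
        using \<psi>s[OF y] restr[OF x] entries[OF x] entries[OF P_carrier[OF \<psi>s[OF y]]]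
        unfolding \<phi>_def by (simp only: restrict_apply') (auto simp: mult_eq supported_def fun_eq_iff)
    qed
    ultimately show ?L using \<psi> by blast
  }
qed

lemma Aut_inf_eq:
  "Aut_inf = AutoGroup U \<lparr>carrier := (\<Union>n. {\<psi> \<in> auto U.
     \<exists>\<phi>\<in>auto (product_group {..<n} (\<lambda>_. \<Gamma>)). \<forall>x\<in>carrier U.
       \<psi> x = (\<lambda>i. if i < n then \<phi> (restrict x {..<n}) i else x i)})\<rparr>"
proof -
  have "stage n = {\<psi> \<in> auto U. \<exists>\<phi>\<in>auto (product_group {..<n} (\<lambda>_. \<Gamma>)). \<forall>x\<in>carrier U.
      \<psi> x = (\<lambda>i. if i < n then \<phi> (restrict x {..<n}) i else x i)}" for n
    using stage_iff by blast
  then show ?thesis by (simp only: Aut_inf_def)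
qed

end

lemma sequence_group_product:
  assumes "group \<Gamma>"
  shows "sequence_group (product_group UNIV (\<lambda>_. \<Gamma>)) \<Gamma>"
proof -
  interpret \<Gamma>: group \<Gamma> by fact
  show ?thesis
    by (intro sequence_group.intro sequence_group_axioms.intro)
      (use \<Gamma>.group_axioms in \<open>auto simp: PiE_iff\<close>)
qed

lemma sequence_group_sum:
  assumes "group \<Gamma>"
  shows "sequence_group (sum_group UNIV (\<lambda>_. \<Gamma>)) \<Gamma>"
proof -
  interpret \<Gamma>: group \<Gamma> by fact
  have C: "carrier (sum_group UNIV (\<lambda>_::nat. \<Gamma>)) = {x. (\<forall>i. x i \<in> carrier \<Gamma>) \<and> finite {i. x i \<noteq> \<one>\<^bsub>\<Gamma>\<^esub>}}"
    using \<Gamma>.group_axioms by (auto simp: carrier_sum_group PiE_iff)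
  show ?thesis
  proof (intro sequence_group.intro sequence_group_axioms.intro)
    show "group (sum_group UNIV (\<lambda>_::nat. \<Gamma>))" "group \<Gamma>" using assms by simp_all
    fix x assume "x \<in> carrier (sum_group UNIV (\<lambda>_::nat. \<Gamma>))"
    then have x: "\<And>i. x i \<in> carrier \<Gamma>" "finite {i. x i \<noteq> \<one>\<^bsub>\<Gamma>\<^esub>}" by (simp_all add: C)
    show "x i \<in> carrier \<Gamma>" for i by (rule x)
    show "(\<lambda>i. if i \<in> A then x i else \<one>\<^bsub>\<Gamma>\<^esub>) \<in> carrier (sum_group UNIV (\<lambda>_. \<Gamma>))" for A
      using x(1) finite_subset[OF _ x(2), of "{i. (if i \<in> A then x i else \<one>\<^bsub>\<Gamma>\<^esub>) \<noteq> \<one>\<^bsub>\<Gamma>\<^esub>}"]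
      by (simp add: C subset_iff)
    show "x \<circ> p \<in> carrier (sum_group UNIV (\<lambda>_. \<Gamma>))" if "bij p" for p :: "nat \<Rightarrow> nat"
      using x(1) finite_vimageI[OF x(2) bij_is_inj[OF that]] by (simp add: C vimage_def)
  next
    fix z n assume z: "z \<in> PiE {..<n} (\<lambda>_::nat. carrier \<Gamma>)"
    have "{i. (if i < n then z i else \<one>\<^bsub>\<Gamma>\<^esub>) \<noteq> \<one>\<^bsub>\<Gamma>\<^esub>} \<subseteq> {..<n}" by auto
    then have "finite {i. (if i < n then z i else \<one>\<^bsub>\<Gamma>\<^esub>) \<noteq> \<one>\<^bsub>\<Gamma>\<^esub>}" by (rule finite_subset) simp
    then show "(\<lambda>i. if i < n then z i else \<one>\<^bsub>\<Gamma>\<^esub>) \<in> carrier (sum_group UNIV (\<lambda>_. \<Gamma>))"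
      using z by (auto simp: C)
  qed (simp_all add: restrict_def)
qed

lemma Xsep_boundedly_acyclic_Aut_inf_direct_product:
  assumes "group \<Gamma>"
  shows "Xsep_boundedly_acyclic TYPE('e::banach) TYPE('f::banach) (Aut_inf_direct_product \<Gamma>)"
proof -
  interpret sequence_group "product_group UNIV (\<lambda>_. \<Gamma>)" \<Gamma> by (rule sequence_group_product[OF assms])
  have "Aut_inf_direct_product \<Gamma> = Aut_inf"
    unfolding Aut_inf_direct_product_def Aut_inf_eq ..
  then show ?thesis using Xsep_boundedly_acyclic_Aut_inf by (simp only:)
qed

lemma Xsep_boundedly_acyclic_Aut_inf_direct_sum:
  assumes "group \<Gamma>"
  shows "Xsep_boundedly_acyclic TYPE('e::banach) TYPE('f::banach) (Aut_inf_direct_sum \<Gamma>)"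
proof -
  interpret sequence_group "sum_group UNIV (\<lambda>_. \<Gamma>)" \<Gamma> by (rule sequence_group_sum[OF assms])
  have "Aut_inf_direct_sum \<Gamma> = Aut_inf"
    unfolding Aut_inf_direct_sum_def Aut_inf_eq ..
  then show ?thesis using Xsep_boundedly_acyclic_Aut_inf by (simp only:)
qed

theorem corollary1p10:
  fixes \<Gamma> :: "('a, 'b) monoid_scheme"
  assumes "group \<Gamma>"
  shows "Xsep_boundedly_acyclic TYPE('e::banach) TYPE('f::banach) (Aut_inf_free_product \<Gamma>) \<and>
         Xsep_boundedly_acyclic TYPE('e) TYPE('f) (Aut_inf_direct_product \<Gamma>) \<and>
         Xsep_boundedly_acyclic TYPE('e) TYPE('f) (Aut_inf_direct_sum \<Gamma>) \<and>
         Xsep_boundedly_acyclic TYPE('e) TYPE('f) (Aut_inf_free_product integer_group)"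
  using Xsep_boundedly_acyclic_Aut_inf_free_product[OF assms]
    Xsep_boundedly_acyclic_Aut_inf_direct_product[OF assms]
    Xsep_boundedly_acyclic_Aut_inf_direct_sum[OF assms]
    Xsep_boundedly_acyclic_Aut_inf_free_product[OF group_integer_group]
  by blast

end
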